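(* Let $A$ and $B$ be $C^*$-algebras, $F$ a correspondence from $A$ to $B$, and $E$ a correspondence from $B$ to $A$. Every adjunction of tensor product functors $$\Phi_{X,Y}\colon\mathfrak B_B(X\otimes_AF,Y)\xrightarrow{\ \cong\ }\mathfrak B_A(X,Y\otimes_BE)$$ restricts to a local adjunction $$\Phi_{X,Y}\colon\mathfrak K_B(X\otimes_AF,Y)\xrightarrow{\ \cong\ }\mathfrak K_A(X,Y\otimes_BE).$$
   Context: A Hilbert $A$-module is a right $A$-module with an $A$-valued inner product (antilinear in the first variable), complete in the norm $\|x\|=\|\langle x,x\rangle\|^{1/2}$. $\mathfrak B_A(X,Y)$ denotes the adjointable operators and $\mathfrak K_A(X,Y)$ the closed linear span of the operators $y\otimes x^*\colon z\mapsto y\langle x,z\rangle$. $\mathcal H_A$ is the category of Hilbert $A$-modules and adjointable maps. A correspondence from $A$ to $B$ is a Hilbert $B$-module $F$ with a nondegenerate $*$-homomorphism $A\to\mathfrak B_B(F,F)$ (the elements $af$ span a dense subspace). $X\otimes_AF$ is the Hilbert $B$-module completion of the algebraic tensor product for $\langle x_1\otimes f_1,x_2\otimes f_2\rangle=\langle f_1,\langle x_1,x_2\rangle f_2\rangle$. An adjunction between $F$ and $E$ is a natural isomorphism $\Phi_{X,Y}$ of set-valued functors of $(X,Y)\in\mathcal H_A^{\mathrm{op}}\times\mathcal H_B$ as in the first display (no linearity or continuity is assumed). A local adjunction is a natural isomorphism of functors as in the second display such that each $\Phi_{X,Y}$ is a continuous linear map. *)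

theory Defs
  imports "HOL-Analysis.Analysis" "HOL-Library.FuncSet"
begin

section \<open>C*-algebras\<close>

text \<open>Not necessarily unital, and possibly zero.\<close>

class cstar_algebra = real_normed_algebra + banach +
  fixes cscale :: "complex \<Rightarrow> 'a \<Rightarrow> 'a"
    and star :: "'a \<Rightarrow> 'a"
  assumes cscale_of_real: "cscale (complex_of_real r) a = scaleR r a"
    and cscale_add_right: "cscale c (a + b) = cscale c a + cscale c b"
    and cscale_add_left: "cscale (c + d) a = cscale c a + cscale d a"
    and cscale_cscale: "cscale c (cscale d a) = cscale (c * d) a"
    and cscale_mult_left: "cscale c a * b = cscale c (a * b)"
    and cscale_mult_right: "a * cscale c b = cscale c (a * b)"
    and norm_cscale: "norm (cscale c a) = cmod c * norm a"
    and star_star: "star (star a) = a"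
    and star_add: "star (a + b) = star a + star b"
    and star_cscale: "star (cscale c a) = cscale (cnj c) (star a)"
    and star_mult: "star (a * b) = star b * star a"
    and cstar_identity: "norm (star a * a) = (norm a)\<^sup>2"

definition cstar_pos :: "'a::cstar_algebra \<Rightarrow> bool" where
  "cstar_pos a \<longleftrightarrow> (\<exists>b. a = star b * b)"


section \<open>Hilbert modules\<close>

text \<open>
  Hilbert modules have explicit carriers, because the statement quantifies over all objects of the
  categories of Hilbert modules. The element type \<open>'x\<close> is the universe from which the
  underlying sets are taken.
\<close>

record ('a, 'x) hmod =
  car :: "'x set"
  zro :: 'x
  add :: "'x \<Rightarrow> 'x \<Rightarrow> 'x"
  scl :: "complex \<Rightarrow> 'x \<Rightarrow> 'x"
  act :: "'x \<Rightarrow> 'a \<Rightarrow> 'x"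
  ip :: "'x \<Rightarrow> 'x \<Rightarrow> 'a"

definition hsub :: "('a, 'x) hmod \<Rightarrow> 'x \<Rightarrow> 'x \<Rightarrow> 'x" where
  "hsub X x y = add X x (scl X (- 1) y)"

definition hnorm :: "('a::cstar_algebra, 'x) hmod \<Rightarrow> 'x \<Rightarrow> real" where
  "hnorm X x = sqrt (norm (ip X x x))"

locale hilbert_module =
  fixes X :: "('a::cstar_algebra, 'x) hmod"
  assumes zro_closed: "zro X \<in> car X"
    and add_closed: "\<lbrakk>x \<in> car X; y \<in> car X\<rbrakk> \<Longrightarrow> add X x y \<in> car X"
    and scl_closed: "x \<in> car X \<Longrightarrow> scl X c x \<in> car X"
    and act_closed: "x \<in> car X \<Longrightarrow> act X x a \<in> car X"
    and add_assoc: "\<lbrakk>x \<in> car X; y \<in> car X; z \<in> car X\<rbrakk>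
          \<Longrightarrow> add X (add X x y) z = add X x (add X y z)"
    and add_commute: "\<lbrakk>x \<in> car X; y \<in> car X\<rbrakk> \<Longrightarrow> add X x y = add X y x"
    and add_zro: "x \<in> car X \<Longrightarrow> add X x (zro X) = x"
    and add_neg: "x \<in> car X \<Longrightarrow> add X x (scl X (- 1) x) = zro X"
    and scl_add: "\<lbrakk>x \<in> car X; y \<in> car X\<rbrakk>
          \<Longrightarrow> scl X c (add X x y) = add X (scl X c x) (scl X c y)"
    and add_scl: "x \<in> car X \<Longrightarrow> scl X (c + d) x = add X (scl X c x) (scl X d x)"
    and scl_scl: "x \<in> car X \<Longrightarrow> scl X c (scl X d x) = scl X (c * d) x"
    and scl_one: "x \<in> car X \<Longrightarrow> scl X 1 x = x"
    and act_add_left: "\<lbrakk>x \<in> car X; y \<in> car X\<rbrakk>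
          \<Longrightarrow> act X (add X x y) a = add X (act X x a) (act X y a)"
    and act_add_right: "x \<in> car X \<Longrightarrow> act X x (a + b) = add X (act X x a) (act X x b)"
    and act_act: "x \<in> car X \<Longrightarrow> act X (act X x a) b = act X x (a * b)"
    and act_scl_left: "x \<in> car X \<Longrightarrow> act X (scl X c x) a = scl X c (act X x a)"
    and act_scl_right: "x \<in> car X \<Longrightarrow> act X x (cscale c a) = scl X c (act X x a)"
    and ip_add: "\<lbrakk>x \<in> car X; y \<in> car X; z \<in> car X\<rbrakk>
          \<Longrightarrow> ip X x (add X y z) = ip X x y + ip X x z"
    and ip_scl: "\<lbrakk>x \<in> car X; y \<in> car X\<rbrakk> \<Longrightarrow> ip X x (scl X c y) = cscale c (ip X x y)"
    and ip_act: "\<lbrakk>x \<in> car X; y \<in> car X\<rbrakk> \<Longrightarrow> ip X x (act X y a) = ip X x y * a"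
    and ip_star: "\<lbrakk>x \<in> car X; y \<in> car X\<rbrakk> \<Longrightarrow> star (ip X x y) = ip X y x"
    and ip_pos: "x \<in> car X \<Longrightarrow> cstar_pos (ip X x x)"
    and ip_definite: "\<lbrakk>x \<in> car X; ip X x x = 0\<rbrakk> \<Longrightarrow> x = zro X"
    and complete: "\<lbrakk>\<forall>n. s n \<in> car X;
            \<forall>e>0. \<exists>N. \<forall>m\<ge>N. \<forall>n\<ge>N. hnorm X (hsub X (s m) (s n)) < e\<rbrakk>
          \<Longrightarrow> \<exists>l\<in>car X. (\<lambda>n. hnorm X (hsub X (s n) l)) \<longlonglongrightarrow> 0"

inductive_set lin_span :: "'v \<Rightarrow> ('v \<Rightarrow> 'v \<Rightarrow> 'v) \<Rightarrow> (complex \<Rightarrow> 'v \<Rightarrow> 'v) \<Rightarrow> 'v set \<Rightarrow> 'v set"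
  for z :: 'v and pl :: "'v \<Rightarrow> 'v \<Rightarrow> 'v" and sc :: "complex \<Rightarrow> 'v \<Rightarrow> 'v" and S :: "'v set"
  where
    lin_span_zero: "z \<in> lin_span z pl sc S"
  | lin_span_step: "\<lbrakk>s \<in> S; v \<in> lin_span z pl sc S\<rbrakk> \<Longrightarrow> pl (sc c s) v \<in> lin_span z pl sc S"

definition spans_densely :: "('a::cstar_algebra, 'x) hmod \<Rightarrow> 'x set \<Rightarrow> bool" where
  "spans_densely X S \<longleftrightarrow>
     (\<forall>x\<in>car X. \<forall>e>0. \<exists>v\<in>lin_span (zro X) (add X) (scl X) S. hnorm X (hsub X x v) < e)"


section \<open>Adjointable and compact operators\<close>

text \<open>
  Operators are extensional functions on the carrier (\<open>undefined\<close> outside), so that equality of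
  functions is equality of operators.
\<close>

definition adjointables ::
    "('a::cstar_algebra, 'x) hmod \<Rightarrow> ('a, 'y) hmod \<Rightarrow> ('x \<Rightarrow> 'y) set" where
  "adjointables X Y = {T \<in> car X \<rightarrow>\<^sub>E car Y.
     \<exists>S \<in> car Y \<rightarrow>\<^sub>E car X. \<forall>x\<in>car X. \<forall>y\<in>car Y. ip Y (T x) y = ip X x (S y)}"

definition op_zero :: "('a, 'x) hmod \<Rightarrow> ('a, 'y) hmod \<Rightarrow> 'x \<Rightarrow> 'y" where
  "op_zero X Y = (\<lambda>x\<in>car X. zro Y)"

definition op_add ::
    "('a, 'x) hmod \<Rightarrow> ('a, 'y) hmod \<Rightarrow> ('x \<Rightarrow> 'y) \<Rightarrow> ('x \<Rightarrow> 'y) \<Rightarrow> 'x \<Rightarrow> 'y" where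
  "op_add X Y T S = (\<lambda>x\<in>car X. add Y (T x) (S x))"

definition op_scl ::
    "('a, 'x) hmod \<Rightarrow> ('a, 'y) hmod \<Rightarrow> complex \<Rightarrow> ('x \<Rightarrow> 'y) \<Rightarrow> 'x \<Rightarrow> 'y" where
  "op_scl X Y c T = (\<lambda>x\<in>car X. scl Y c (T x))"

definition op_sub ::
    "('a, 'x) hmod \<Rightarrow> ('a, 'y) hmod \<Rightarrow> ('x \<Rightarrow> 'y) \<Rightarrow> ('x \<Rightarrow> 'y) \<Rightarrow> 'x \<Rightarrow> 'y" where
  "op_sub X Y T S = (\<lambda>x\<in>car X. hsub Y (T x) (S x))"

text \<open>Adjointable operators are automatically bounded, so on them the supremum is a genuine one.\<close>

definition op_norm ::
    "('a::cstar_algebra, 'x) hmod \<Rightarrow> ('a, 'y) hmod \<Rightarrow> ('x \<Rightarrow> 'y) \<Rightarrow> real" where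
  "op_norm X Y T = (SUP x\<in>{x \<in> car X. hnorm X x \<le> 1}. hnorm Y (T x))"

definition rank_one :: "('a, 'x) hmod \<Rightarrow> ('a, 'y) hmod \<Rightarrow> 'y \<Rightarrow> 'x \<Rightarrow> 'x \<Rightarrow> 'y" where
  "rank_one X Y y x = (\<lambda>z\<in>car X. act Y y (ip X x z))"

definition compacts ::
    "('a::cstar_algebra, 'x) hmod \<Rightarrow> ('a, 'y) hmod \<Rightarrow> ('x \<Rightarrow> 'y) set" where
  "compacts X Y = {T \<in> adjointables X Y. \<forall>e>0.
     \<exists>S \<in> lin_span (op_zero X Y) (op_add X Y) (op_scl X Y)
            {rank_one X Y y x |y x. y \<in> car Y \<and> x \<in> car X}.
       op_norm X Y (op_sub X Y T S) < e}"


section \<open>Correspondences and tensor products\<close>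

definition correspondence ::
    "('b::cstar_algebra, 'f) hmod \<Rightarrow> ('a::cstar_algebra \<Rightarrow> 'f \<Rightarrow> 'f) \<Rightarrow> bool" where
  "correspondence F l \<longleftrightarrow>
     hilbert_module F \<and>
     (\<forall>a. l a \<in> adjointables F F) \<and>
     (\<forall>a a'. l (a + a') = op_add F F (l a) (l a')) \<and>
     (\<forall>c a. l (cscale c a) = op_scl F F c (l a)) \<and>
     (\<forall>a a'. l (a * a') = compose (car F) (l a) (l a')) \<and>
     (\<forall>a. \<forall>f\<in>car F. \<forall>g\<in>car F. ip F (l a f) g = ip F f (l (star a) g)) \<and>
     spans_densely F {l a f |a f. f \<in> car F}"

text \<open>
  \<open>H\<close> with the pure tensors \<open>t x f\<close> is a completion of the algebraic tensor product of \<open>X\<close> and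
  \<open>F\<close> over \<open>A\<close>: the balanced map \<open>t\<close> induces a \<open>B\<close>-linear map from the algebraic tensor product
  into the complete module \<open>H\<close>, which carries the semi-inner product of the algebraic tensor
  product to the inner product of \<open>H\<close> and has dense image. A completion is determined only up to
  unique unitary isomorphism, and no particular model is singled out.
\<close>

definition tensor_product ::
    "('b::cstar_algebra, 'f) hmod \<Rightarrow> ('a::cstar_algebra \<Rightarrow> 'f \<Rightarrow> 'f) \<Rightarrow>
     ('a, 'x) hmod \<Rightarrow> ('b, 'y) hmod \<Rightarrow> ('x \<Rightarrow> 'f \<Rightarrow> 'y) \<Rightarrow> bool" where
  "tensor_product F l X H t \<longleftrightarrow>
     hilbert_module H \<and>
     (\<forall>x\<in>car X. \<forall>f\<in>car F. t x f \<in> car H) \<and>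
     (\<forall>x\<in>car X. \<forall>x'\<in>car X. \<forall>f\<in>car F. t (add X x x') f = add H (t x f) (t x' f)) \<and>
     (\<forall>x\<in>car X. \<forall>f\<in>car F. \<forall>f'\<in>car F. t x (add F f f') = add H (t x f) (t x f')) \<and>
     (\<forall>c. \<forall>x\<in>car X. \<forall>f\<in>car F. t (scl X c x) f = scl H c (t x f)) \<and>
     (\<forall>c. \<forall>x\<in>car X. \<forall>f\<in>car F. t x (scl F c f) = scl H c (t x f)) \<and>
     (\<forall>a. \<forall>x\<in>car X. \<forall>f\<in>car F. t (act X x a) f = t x (l a f)) \<and>
     (\<forall>b. \<forall>x\<in>car X. \<forall>f\<in>car F. t x (act F f b) = act H (t x f) b) \<and>
     (\<forall>x1\<in>car X. \<forall>x2\<in>car X. \<forall>f1\<in>car F. \<forall>f2\<in>car F.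
        ip H (t x1 f1) (t x2 f2) = ip F f1 (l (ip X x1 x2) f2)) \<and>
     spans_densely H {t x f |x f. x \<in> car X \<and> f \<in> car F}"

text \<open>
  The tensor product functor, given on objects by \<open>T\<close> with pure tensors \<open>t X x f\<close>. Its values on
  the objects with elements in \<open>'x\<close> are objects with elements in \<open>'y\<close>.
\<close>

definition tensor_functor ::
    "('b::cstar_algebra, 'f) hmod \<Rightarrow> ('a::cstar_algebra \<Rightarrow> 'f \<Rightarrow> 'f) \<Rightarrow>
     (('a, 'x) hmod \<Rightarrow> ('b, 'y) hmod) \<Rightarrow> (('a, 'x) hmod \<Rightarrow> 'x \<Rightarrow> 'f \<Rightarrow> 'y) \<Rightarrow> bool" where
  "tensor_functor F l T t \<longleftrightarrow> (\<forall>X. hilbert_module X \<longrightarrow> tensor_product F l X (T X) (t X))"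

text \<open>The functor on morphisms: \<open>S\<close> goes to the operator determined by
  \<open>t X x f \<mapsto> t X' (S x) f\<close>.\<close>

definition tensor_map ::
    "('b::cstar_algebra, 'f) hmod \<Rightarrow>
     (('a::cstar_algebra, 'x) hmod \<Rightarrow> ('b, 'y) hmod) \<Rightarrow> (('a, 'x) hmod \<Rightarrow> 'x \<Rightarrow> 'f \<Rightarrow> 'y) \<Rightarrow>
     ('a, 'x) hmod \<Rightarrow> ('a, 'x) hmod \<Rightarrow> ('x \<Rightarrow> 'x) \<Rightarrow> 'y \<Rightarrow> 'y" where
  "tensor_map F T t X X' S =
     (THE R. R \<in> adjointables (T X) (T X') \<and>
        (\<forall>x\<in>car X. \<forall>f\<in>car F. R (t X x f) = t X' (S x) f))"


section \<open>Adjunctions and local adjunctions\<close>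

text \<open>
  \<open>homB\<close> and \<open>homA\<close> are the hom sets (all adjointable operators or the compact ones) between
  Hilbert modules over \<open>B\<close> and \<open>A\<close>. In either case naturality is with respect to all adjointable
  operators \<open>S: X' \<rightarrow> X\<close> and \<open>R: Y \<rightarrow> Y'\<close>.
\<close>

definition natural_isomorphism ::
    "(('b::cstar_algebra, 'y) hmod \<Rightarrow> ('b, 'y) hmod \<Rightarrow> ('y \<Rightarrow> 'y) set) \<Rightarrow>
     (('a::cstar_algebra, 'x) hmod \<Rightarrow> ('a, 'x) hmod \<Rightarrow> ('x \<Rightarrow> 'x) set) \<Rightarrow>
     ('b, 'f) hmod \<Rightarrow> (('a, 'x) hmod \<Rightarrow> ('b, 'y) hmod) \<Rightarrow> (('a, 'x) hmod \<Rightarrow> 'x \<Rightarrow> 'f \<Rightarrow> 'y) \<Rightarrow>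
     ('a, 'e) hmod \<Rightarrow> (('b, 'y) hmod \<Rightarrow> ('a, 'x) hmod) \<Rightarrow> (('b, 'y) hmod \<Rightarrow> 'y \<Rightarrow> 'e \<Rightarrow> 'x) \<Rightarrow>
     (('a, 'x) hmod \<Rightarrow> ('b, 'y) hmod \<Rightarrow> ('y \<Rightarrow> 'y) \<Rightarrow> ('x \<Rightarrow> 'x)) \<Rightarrow> bool" where
  "natural_isomorphism homB homA F TF tF E TE tE \<Phi> \<longleftrightarrow>
     (\<forall>X Y. hilbert_module X \<and> hilbert_module Y \<longrightarrow>
        bij_betw (\<Phi> X Y) (homB (TF X) Y) (homA X (TE Y))) \<and>
     (\<forall>X X' Y Y'. hilbert_module X \<and> hilbert_module X' \<and> hilbert_module Y \<and> hilbert_module Y' \<longrightarrow>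
        (\<forall>S\<in>adjointables X' X. \<forall>R\<in>adjointables Y Y'. \<forall>T\<in>homB (TF X) Y.
           \<Phi> X' Y' (compose (car (TF X')) R (compose (car (TF X')) T (tensor_map F TF tF X' X S)))
           = compose (car X') (tensor_map E TE tE Y Y' R) (compose (car X') (\<Phi> X Y T) S)))"

definition adjunction ::
    "('b::cstar_algebra, 'f) hmod \<Rightarrow>
     (('a::cstar_algebra, 'x) hmod \<Rightarrow> ('b, 'y) hmod) \<Rightarrow> (('a, 'x) hmod \<Rightarrow> 'x \<Rightarrow> 'f \<Rightarrow> 'y) \<Rightarrow>
     ('a, 'e) hmod \<Rightarrow> (('b, 'y) hmod \<Rightarrow> ('a, 'x) hmod) \<Rightarrow> (('b, 'y) hmod \<Rightarrow> 'y \<Rightarrow> 'e \<Rightarrow> 'x) \<Rightarrow>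
     (('a, 'x) hmod \<Rightarrow> ('b, 'y) hmod \<Rightarrow> ('y \<Rightarrow> 'y) \<Rightarrow> ('x \<Rightarrow> 'x)) \<Rightarrow> bool" where
  "adjunction F TF tF E TE tE \<Phi> \<longleftrightarrow>
     natural_isomorphism adjointables adjointables F TF tF E TE tE \<Phi>"

text \<open>
  Only the values of \<open>\<Phi> X Y\<close> on compact operators matter here, so for an adjunction \<open>\<Phi>\<close> the
  predicate says that the restrictions of the bijections \<open>\<Phi> X Y\<close> form a local adjunction.
\<close>

definition local_adjunction ::
    "('b::cstar_algebra, 'f) hmod \<Rightarrow>
     (('a::cstar_algebra, 'x) hmod \<Rightarrow> ('b, 'y) hmod) \<Rightarrow> (('a, 'x) hmod \<Rightarrow> 'x \<Rightarrow> 'f \<Rightarrow> 'y) \<Rightarrow>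
     ('a, 'e) hmod \<Rightarrow> (('b, 'y) hmod \<Rightarrow> ('a, 'x) hmod) \<Rightarrow> (('b, 'y) hmod \<Rightarrow> 'y \<Rightarrow> 'e \<Rightarrow> 'x) \<Rightarrow>
     (('a, 'x) hmod \<Rightarrow> ('b, 'y) hmod \<Rightarrow> ('y \<Rightarrow> 'y) \<Rightarrow> ('x \<Rightarrow> 'x)) \<Rightarrow> bool" where
  "local_adjunction F TF tF E TE tE \<Phi> \<longleftrightarrow>
     natural_isomorphism compacts compacts F TF tF E TE tE \<Phi> \<and>
     (\<forall>X Y. hilbert_module X \<and> hilbert_module Y \<longrightarrow>
        (\<forall>T\<in>compacts (TF X) Y. \<forall>S\<in>compacts (TF X) Y.
           \<Phi> X Y (op_add (TF X) Y T S) = op_add X (TE Y) (\<Phi> X Y T) (\<Phi> X Y S)) \<and>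
        (\<forall>c. \<forall>T\<in>compacts (TF X) Y.
           \<Phi> X Y (op_scl (TF X) Y c T) = op_scl X (TE Y) c (\<Phi> X Y T)) \<and>
        (\<forall>T\<in>compacts (TF X) Y. \<forall>e>0. \<exists>d>0. \<forall>S\<in>compacts (TF X) Y.
           op_norm (TF X) Y (op_sub (TF X) Y S T) < d \<longrightarrow>
           op_norm X (TE Y) (op_sub X (TE Y) (\<Phi> X Y S) (\<Phi> X Y T)) < e))"

end

theory Submission
  imports Defs
begin

text \<open>
  An adjunction is determined by its unit and counit: naturality gives
  \<open>\<Phi> T = (T \<otimes> 1) \<circ> \<Phi> id\<close>, and the inverse sends \<open>S\<close> to \<open>\<Phi>\<^sup>-\<^sup>1 id \<circ> (S \<otimes> 1)\<close>. As
  \<open>T \<mapsto> T \<otimes> 1\<close> is linear and contractive and adjointable operators are bounded, \<open>\<Phi>\<close> and its inverse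
  are linear and continuous, so they need only be followed on operators of rank one. Let
  \<open>T = y \<otimes> (x \<otimes> f)\<^sup>*\<close>. There is \<open>w\<close> with \<open>x\<close> close to \<open>w \<langle>x, x\<rangle>\<close>, so for \<open>K = x \<otimes> w\<^sup>*\<close> the
  operator \<open>T\<close> is close to \<open>T (K \<otimes> 1)\<close>, which \<open>\<Phi>\<close> maps to \<open>\<Phi> T \<circ> K\<close> by naturality, an operator of
  rank one. The argument for the inverse is dual.

  All norm estimates rest on the inequality \<open>\<parallel>c\<^sup>* c\<parallel> \<le> \<parallel>c\<^sup>* c + d\<^sup>* d\<parallel>\<close> in a C*-algebra. It follows
  from the positivity of \<open>c\<^sup>* c\<close>, which is proved in the unitization by Kaplansky's argument, with
  square roots obtained from the Banach fixed point theorem in place of functional calculus.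
\<close>

section \<open>Positivity in C*-algebras\<close>

text \<open>\<open>\<Phi>\<close> is only a natural family of bijections of sets, and nothing in its
  definition ties it to rank one operators. The reduction works because K = x \<otimes> w^* already
  has rank one: precomposing with K turns every adjointable operator, in particular
  \<open>\<Phi>\<close> T, into one of rank one, and naturality carries this precomposition across
  \<open>\<Phi>\<close>. With h = \<langle>x, x\<rangle> the element w is x (h + e)^-1, the inverse
  being taken in the unitization; then x - w h = e x (h + e)^-1 has norm of order sqrt e. The other
  obstacle is S \<otimes> 1. The completed tensor product is given only by its defining properties,
  and \<open>tensor_map\<close> is a definite description, so existence, uniqueness and the bound by
  the norm of S must all be established. The usual proof of the bound uses positive matrices over A;
  here it comes from the growth of the powers of S^* S. Positivity of a selfadjoint element a is
  used in the form \<parallel>t 1 - a\<parallel> \<le> t.\<close>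

lemma star_zero [simp]: "star (0::'a::cstar_algebra) = 0"
  by (metis add_cancel_right_left star_add)

lemma cscale_zero_left [simp]: "cscale 0 (a::'a::cstar_algebra) = 0"
  using cscale_of_real[of 0 a] by simp

lemma cscale_zero_right [simp]: "cscale c (0::'a::cstar_algebra) = 0"
  using cscale_add_right[of c "0::'a" 0] by simp

lemma cscale_one [simp]: "cscale 1 (a::'a::cstar_algebra) = a"
  using cscale_of_real[of 1 a] by simp

lemma cscale_minus_one [simp]: "cscale (-1) (a::'a::cstar_algebra) = - a"
  using cscale_of_real[of "-1" a] by simp

lemma cscale_minus_right: "cscale c (- a) = - cscale c (a::'a::cstar_algebra)"
  using cscale_add_right[of c a "- a"] by (simp add: minus_unique)

lemma cscale_minus_left: "cscale (- c) a = - cscale c (a::'a::cstar_algebra)"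
  using cscale_add_left[of c "- c" a] by (simp add: minus_unique)

lemma cscale_diff_right: "cscale c (a - b) = cscale c a - cscale c (b::'a::cstar_algebra)"
  using cscale_add_right[of c a "- b"] by (simp add: cscale_minus_right)

lemma star_scaleR: "star (r *\<^sub>R a) = r *\<^sub>R star (a::'a::cstar_algebra)"
  using star_cscale[of "complex_of_real r" a] by (simp add: cscale_of_real)

lemma star_minus: "star (- a) = - star (a::'a::cstar_algebra)"
  using star_scaleR[of "-1" a] by simp

lemma star_diff: "star (a - b) = star a - star (b::'a::cstar_algebra)"
  using star_add[of a "- b"] by (simp add: star_minus)

lemma norm_star [simp]: "norm (star a) = norm (a::'a::cstar_algebra)"
proof -
  have le: "norm b \<le> norm (star b)" for b :: 'a
  proof (cases "b = 0")
    case False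
    have "norm b * norm b \<le> norm (star b) * norm b"
      using norm_mult_ineq[of "star b" b] cstar_identity[of b] by (simp add: power2_eq_square)
    then show ?thesis using False by simp
  qed simp
  show ?thesis using le[of a] le[of "star a"] by (simp add: star_star)
qed

lemma norm_mult_star: "norm (a * star a) = (norm (a::'a::cstar_algebra))\<^sup>2"
  using cstar_identity[of "star a"] by (simp add: star_star)

lemma norm_square_selfadjoint: "star h = h \<Longrightarrow> norm (h * h) = (norm (h::'a::cstar_algebra))\<^sup>2"
  using cstar_identity[of h] by simp

lemma bounded_linear_star: "bounded_linear (star :: 'a::cstar_algebra \<Rightarrow> 'a)"
  by (rule bounded_linear_intro[where K=1]) (auto simp: star_add star_scaleR)

section \<open>Square roots and positivity expressed through norms\<close>

text \<open>\<open>k\<close> stands for 1 - sqrt (1 - h), written without a unit: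
  \<open>h = 2 *\<^sub>R k - k * k\<close> says that (1 - k)^2 = 1 - h. It is the fixed point of k
  \<mapsto> (h + k^2) / 2.\<close>

lemma sqrt_one_minus:
  fixes h :: "'a::cstar_algebra"
  assumes h: "star h = h" "norm h < 1"
  obtains k where "star k = k" "norm k < 1" "h = 2 *\<^sub>R k - k * k"
    "\<And>g. g * h = h * g \<Longrightarrow> g * k = k * g"
proof -
  \<comment> \<open>\<open>r\<close> solves the scalar equation
    \<open>norm h + r * r = 2 * r\<close>. Hence the ball of radius \<open>r\<close> is mapped into
    itself, and \<open>r\<close> is also the contraction constant there.\<close>
  define r where "r = 1 - sqrt (1 - norm h)"
  have r: "0 \<le> r" "r < 1" using h by (auto simp: r_def)
  have rh: "norm h + r * r = 2 * r"
    using h by (simp add: r_def algebra_simps)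
  \<comment> \<open>Commutation with everything that commutes with \<open>h\<close> is built into
    the complete set, so the fixed point inherits it.\<close>
  define S where "S = {k::'a. star k = k \<and> norm k \<le> r \<and> (\<forall>g. g * h = h * g \<longrightarrow> g * k = k * g)}"
  define f where "f k = (1/2) *\<^sub>R (h + k * k)" for k :: 'a
  have SD: "star k = k" "norm k \<le> r" "g * h = h * g \<Longrightarrow> g * k = k * g" if "k \<in> S" for k g
    using that unfolding S_def by blast+
  have "closed S"
  proof -
    have "S = {k. star k = k} \<inter> {k. norm k \<le> r} \<inter> (\<Inter>g\<in>{g. g * h = h * g}. {k. g * k = k * g})"
      by (auto simp: S_def)
    moreover have "closed \<dots>"
      by (intro closed_Int closed_INT ballI closed_Collect_eq closed_Collect_le continuous_intros
          linear_continuous_on bounded_linear_star)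
    ultimately show ?thesis by simp
  qed
  then have "complete S" by (simp add: complete_eq_closed)
  moreover have "S \<noteq> {}" using r by (auto simp: S_def intro!: exI[of _ 0])
  moreover have "f ` S \<subseteq> S"
  proof -
    have "f k \<in> S" if "k \<in> S" for k
    proof -
      have "norm (k * k) \<le> r * r"
        using SD(2)[OF that] r by (intro order_trans[OF norm_mult_ineq] mult_mono) auto
      then have "norm (h + k * k) \<le> 2 * r" using norm_triangle_ineq[of h "k * k"] rh by linarith
      moreover have "\<forall>g. g * h = h * g \<longrightarrow> g * f k = f k * g"
      proof (intro allI impI)
        fix g assume g: "g * h = h * g"
        then have "g * k = k * g" by (rule SD(3)[OF that])
        then have "g * (k * k) = k * k * g" by (metis mult.assoc)
        with g show "g * f k = f k * g" by (simp add: f_def distrib_left distrib_right)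
      qed
      moreover have "star (f k) = f k"
        using SD(1)[OF that] h by (simp add: f_def star_scaleR star_add star_mult)
      moreover have "norm (f k) \<le> r" using \<open>norm (h + k * k) \<le> 2 * r\<close> by (simp add: f_def)
      ultimately show ?thesis unfolding S_def by blast
    qed
    then show ?thesis by auto
  qed
  moreover have "dist (f k) (f l) \<le> r * dist k l" if "k \<in> S" "l \<in> S" for k l
  proof -
    have "k * k - l * l = k * (k - l) + (k - l) * l" by (simp add: algebra_simps)
    then have "norm (k * k - l * l) \<le> norm k * norm (k - l) + norm (k - l) * norm l"
      by (metis norm_mult_ineq norm_triangle_le add_mono)
    also have "\<dots> \<le> r * norm (k - l) + norm (k - l) * r"
      using SD(2)[OF that(1)] SD(2)[OF that(2)] r by (intro add_mono mult_mono) auto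
    finally have "norm (k * k - l * l) \<le> 2 * (r * norm (k - l))" by simp
    moreover have "f k - f l = (1/2) *\<^sub>R (k * k - l * l)" by (simp add: f_def algebra_simps)
    ultimately show ?thesis by (simp add: dist_norm)
  qed
  ultimately have "\<exists>!k. k \<in> S \<and> f k = k"
    using Banach_fix[of S r f] r by blast
  then obtain k where k: "k \<in> S" "f k = k" by blast
  have "2 *\<^sub>R k = 2 *\<^sub>R f k" by (simp only: k(2))
  also have "\<dots> = h + k * k" by (simp add: f_def)
  finally have "2 *\<^sub>R k = h + k * k" .
  then have hk: "h = 2 *\<^sub>R k - k * k" by (simp only: eq_diff_eq)
  show ?thesis
  proof (rule that)
    show "star k = k" "norm k < 1" using SD(1,2)[OF k(1)] r by auto
    show "h = 2 *\<^sub>R k - k * k" by (rule hk)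
    show "g * k = k * g" if "g * h = h * g" for g by (rule SD(3)[OF k(1) that])
  qed
qed

text \<open>w = u + i v is normal with \<open>star w * w = u * u + v * v\<close>, and u is the mean
  of w and \<open>star w\<close>, both of norm sqrt \<parallel>u^2 + v^2\<parallel>.\<close>

lemma norm_square_le_norm_sum_squares:
  fixes u v :: "'a::cstar_algebra"
  assumes u: "star u = u" and v: "star v = v" and uv: "u * v = v * u"
  shows "(norm u)\<^sup>2 \<le> norm (u * u + v * v)"
proof -
  define w where "w = u + cscale \<i> v"
  define w' where "w' = u - cscale \<i> v"
  have s: "star w = w'" "star w' = w"
    by (simp_all add: w_def w'_def star_add star_diff star_cscale u v cscale_minus_left)
  have vv: "cscale \<i> v * cscale \<i> v = - (v * v)"
    by (simp add: cscale_mult_left cscale_mult_right cscale_cscale)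
  have c: "u * cscale \<i> v = cscale \<i> v * u"
    by (simp add: cscale_mult_left cscale_mult_right uv)
  have ww: "w' * w = u * u + v * v" "w * w' = u * u + v * v"
    by (simp_all add: w_def w'_def distrib_left distrib_right left_diff_distrib right_diff_distrib vv c)
  have "(norm w)\<^sup>2 = norm (u * u + v * v)" "(norm w')\<^sup>2 = norm (u * u + v * v)"
    using cstar_identity[of w] cstar_identity[of w'] by (simp_all add: s ww)
  moreover from this have "norm w = norm w'" by (metis norm_ge_zero power2_eq_imp_eq)
  moreover have "2 * norm u \<le> norm w + norm w'"
    using norm_triangle_ineq[of w w'] by (simp add: w_def w'_def scaleR_2[symmetric])
  ultimately show ?thesis by (metis mult_2 mult_le_cancel_left_pos norm_ge_zero power_mono zero_less_numeral)
qed

class cstar_algebra_1 = cstar_algebra + real_normed_algebra_1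

lemma star_one [simp]: "star (1::'a::cstar_algebra_1) = 1"
  by (metis mult.right_neutral star_mult star_star)

lemma norm_shift_mono:
  fixes h :: "'a::cstar_algebra_1"
  assumes "norm (t *\<^sub>R 1 - h) \<le> s" "t \<le> t'"
  shows "norm (t' *\<^sub>R 1 - h) \<le> s + (t' - t)"
proof -
  have "t' *\<^sub>R 1 - h = (t *\<^sub>R 1 - h) + (t' - t) *\<^sub>R 1" by (simp add: algebra_simps)
  then have "norm (t' *\<^sub>R 1 - h) \<le> norm (t *\<^sub>R 1 - h) + norm ((t' - t) *\<^sub>R (1::'a))"
    by (metis norm_triangle_ineq)
  with assms show ?thesis by simp
qed

text \<open>After scaling, 1 - k^2 / t = u^2 and k^2 / t = v^2 with commuting selfadjoint u and v;
  then u^2 + v^2 = 1 forces \<parallel>u\<parallel> \<le> 1.\<close>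

lemma norm_diff_square_le:
  fixes k :: "'a::cstar_algebra_1"
  assumes k: "star k = k" "(norm k)\<^sup>2 < t"
  shows "norm (t *\<^sub>R 1 - k * k) \<le> t"
proof -
  have t: "0 < t" using k by (meson le_less_trans zero_le_power2)
  define h where "h = (1/t) *\<^sub>R (k * k)"
  have "star h = h" "norm h < 1"
    using k t by (simp_all add: h_def star_scaleR star_mult norm_square_selfadjoint)
  then obtain m where m: "star m = m" "h = 2 *\<^sub>R m - m * m"
    and comm: "\<And>g. g * h = h * g \<Longrightarrow> g * m = m * g"
    using sqrt_one_minus by blast
  have km: "k * m = m * k" by (rule comm) (simp add: h_def mult.assoc)
  define u where "u = 1 - m"
  define v where "v = (1 / sqrt t) *\<^sub>R k"
  have uu: "u * u = 1 - h" by (simp add: u_def m(2) algebra_simps scaleR_2)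
  have vv: "v * v = h" using t by (simp add: v_def h_def)
  have "(norm u)\<^sup>2 \<le> norm (u * u + v * v)"
    by (rule norm_square_le_norm_sum_squares)
      (simp_all add: u_def v_def star_diff star_scaleR m(1) k(1) km algebra_simps)
  then have "norm (u * u) \<le> 1"
    using norm_mult_ineq[of u u] by (simp add: uu vv power2_eq_square)
  moreover have "t *\<^sub>R 1 - k * k = t *\<^sub>R (u * u)"
    using t by (simp add: uu h_def algebra_simps)
  ultimately show ?thesis using t by (simp add: mult_left_le)
qed

text \<open>The root is sqrt t (1 - m) with (1 - m)^2 = h / t. The bound obtained for
  \<open>w\<close> has the shape of the hypothesis on \<open>h\<close>, so a root can be taken once
  more.\<close>

lemma sqrt_shifted:
  fixes h :: "'a::cstar_algebra_1"
  assumes h: "star h = h" "norm (t *\<^sub>R 1 - h) < t"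
  obtains w where "star w = w" "w * w = h" "norm (sqrt t *\<^sub>R 1 - w) < sqrt t"
    "\<And>g. g * h = h * g \<Longrightarrow> g * w = w * g"
proof -
  have t: "0 < t" using h by (meson le_less_trans norm_ge_zero)
  define h' where "h' = (1/t) *\<^sub>R (t *\<^sub>R 1 - h)"
  have "star h' = h'" "norm h' < 1"
    using h t by (simp_all add: h'_def star_scaleR star_diff)
  then obtain m where m: "star m = m" "norm m < 1" "h' = 2 *\<^sub>R m - m * m"
    and comm: "\<And>g. g * h' = h' * g \<Longrightarrow> g * m = m * g"
    using sqrt_one_minus by blast
  define w where "w = sqrt t *\<^sub>R (1 - m)"
  show ?thesis
  proof (rule that[of w])
    show "star w = w" by (simp add: w_def star_scaleR star_diff m(1))
    have "w * w = t *\<^sub>R (1 - h')"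
      using t by (simp add: w_def m(3) algebra_simps scaleR_2)
    also have "\<dots> = h" using t by (simp add: h'_def algebra_simps)
    finally show "w * w = h" .
    have "sqrt t *\<^sub>R 1 - w = sqrt t *\<^sub>R m" by (simp add: w_def algebra_simps)
    then show "norm (sqrt t *\<^sub>R 1 - w) < sqrt t" using m(2) t by simp
    show "g * w = w * g" if "g * h = h * g" for g
    proof -
      have "g * h' = h' * g" by (simp add: h'_def left_diff_distrib right_diff_distrib that)
      then have "g * m = m * g" by (rule comm)
      then show ?thesis by (simp add: w_def left_diff_distrib right_diff_distrib)
    qed
  qed
qed

text \<open>For M above the right-hand side, M - t - k^2 is a square v^2 with v commuting with k,
  and k^2 + v^2 = M - t bounds \<parallel>k\<parallel>^2.\<close>

lemma norm_add_square_ge: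
  fixes k :: "'a::cstar_algebra_1"
  assumes k: "star k = k" and t: "0 \<le> t"
  shows "t + (norm k)\<^sup>2 \<le> norm (t *\<^sub>R 1 + k * k)"
proof (rule dense_ge)
  fix M assume M: "norm (t *\<^sub>R 1 + k * k) < M"
  \<comment> \<open>The inequality \<open>t \<le> M\<close> is settled beforehand, because the norm
    of \<open>(M - t) *\<^sub>R 1\<close> is the absolute value of M - t.\<close>
  define s where "s = (norm k)\<^sup>2 + 1"
  have "(t + s) *\<^sub>R 1 = (t *\<^sub>R 1 + k * k) + (s *\<^sub>R 1 - k * k)" by (simp add: algebra_simps)
  then have "norm ((t + s) *\<^sub>R (1::'a)) \<le> norm (t *\<^sub>R 1 + k * k) + norm (s *\<^sub>R 1 - k * k)"
    by (metis norm_triangle_ineq)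
  moreover have "norm (s *\<^sub>R 1 - k * k) \<le> s" by (rule norm_diff_square_le) (simp_all add: k s_def)
  moreover have "0 \<le> s" by (simp add: s_def)
  ultimately have tM: "t \<le> M" using M t by simp
  define h where "h = M *\<^sub>R 1 - (t *\<^sub>R 1 + k * k)"
  have "star h = h" by (simp add: h_def star_diff star_add star_scaleR star_mult k)
  moreover have "norm (M *\<^sub>R 1 - h) < M" using M by (simp add: h_def add.commute)
  ultimately obtain v where v: "star v = v" "v * v = h" "\<And>g. g * h = h * g \<Longrightarrow> g * v = v * g"
    using sqrt_shifted by blast
  have "k * h = h * k" by (simp add: h_def algebra_simps)
  then have "k * v = v * k" by (rule v(3))
  then have "(norm k)\<^sup>2 \<le> norm (k * k + v * v)"
    by (intro norm_square_le_norm_sum_squares k v(1))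
  also have "k * k + v * v = (M - t) *\<^sub>R 1" by (simp add: v(2) h_def algebra_simps)
  finally show "t + (norm k)\<^sup>2 \<le> M" using tM by simp
qed

section \<open>Positivity of \<open>star c * c\<close>\<close>

text \<open>A substitute for the spectral radius formula: factors that grow linearly in the exponent
  disappear under roots. Exponents 2^n suffice, and for these a selfadjoint element satisfies
  \<parallel>h^(2^n)\<parallel> = \<parallel>h\<parallel>^(2^n).\<close>

lemma growth_bound:
  fixes x s :: real
  assumes x: "0 \<le> x" and s: "0 < s"
    and le: "\<And>n. x ^ 2 ^ n \<le> (A + B * 2 ^ n) * s ^ 2 ^ n"
  shows "x \<le> s"
proof (rule ccontr)
  assume "\<not> x \<le> s"
  then have sx: "s < x" by simp
  define q where "q = s / x"
  have q: "0 < q" "q < 1" using s sx by (auto simp: q_def)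
  have "(\<lambda>n. A * q ^ n + B * (real n * q ^ n)) \<longlonglongrightarrow> A * 0 + B * 0"
    using q by (intro tendsto_intros LIMSEQ_power_zero powser_times_n_limit_0) auto
  then have "(\<lambda>n. (A + B * real n) * q ^ n) \<longlonglongrightarrow> 0" by (simp add: algebra_simps)
  moreover have "strict_mono (\<lambda>n. 2 ^ n :: nat)" by (rule strict_monoI_Suc) simp
  ultimately have "((\<lambda>n. (A + B * real n) * q ^ n) \<circ> (\<lambda>n. 2 ^ n)) \<longlonglongrightarrow> 0"
    by (rule LIMSEQ_subseq_LIMSEQ)
  then have "eventually (\<lambda>n. (A + B * 2 ^ n) * q ^ 2 ^ n < 1) sequentially"
    by (auto simp: o_def dest: order_tendstoD(2)[where a=1])
  then obtain n where "(A + B * 2 ^ n) * q ^ 2 ^ n < 1" by (auto simp: eventually_sequentially)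
  moreover have "1 \<le> (A + B * 2 ^ n) * q ^ 2 ^ n"
    using le[of n] sx s by (simp add: q_def power_divide field_simps)
  ultimately show False by simp
qed

lemma norm_selfadjoint_power:
  fixes h :: "'a::cstar_algebra_1"
  assumes "star h = h"
  shows "norm (h ^ 2 ^ n) = norm h ^ 2 ^ n \<and> star (h ^ 2 ^ n) = h ^ 2 ^ n"
proof (induction n)
  case (Suc n)
  have "h ^ 2 ^ Suc n = h ^ 2 ^ n * h ^ 2 ^ n" by (simp add: power_add[symmetric] mult_2)
  moreover have "norm h ^ 2 ^ Suc n = (norm h ^ 2 ^ n)\<^sup>2"
    by (simp add: power_mult[symmetric] mult.commute)
  ultimately show ?case using Suc by (simp add: norm_square_selfadjoint star_mult)
qed (simp add: assms)

text \<open>Takes the place of the equality of the spectra of \<open>star y * y\<close> and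
  \<open>y * star y\<close> outside 0. From G y = y H one gets G^(n+1) = t G^n + y H^n
  \<open>star y\<close>, so \<parallel>G^n\<parallel> exceeds s^n by a factor at most linear in n,
  and G is selfadjoint.\<close>

lemma norm_shift_swap:
  fixes y :: "'a::cstar_algebra_1"
  assumes t: "0 \<le> t" "t \<le> s" "0 < s" and y: "norm (t *\<^sub>R 1 + star y * y) \<le> s"
  shows "norm (t *\<^sub>R 1 + y * star y) \<le> s"
proof -
  define G where "G = t *\<^sub>R 1 + y * star y"
  define H where "H = t *\<^sub>R 1 + star y * y"
  define b where "b = (norm y)\<^sup>2 / s"
  have b: "0 \<le> b" using t by (simp add: b_def)
  have GH: "G * y = y * H" by (simp add: G_def H_def algebra_simps)
  have GHn: "G ^ n * y = y * H ^ n" for n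
  proof (induction n)
    case (Suc n)
    have "G ^ Suc n * y = G ^ n * (G * y)" by (simp add: power_Suc2 mult.assoc del: power_Suc)
    also have "\<dots> = y * H ^ n * H" by (simp add: GH Suc[symmetric] mult.assoc[symmetric])
    finally show ?case by (simp add: power_Suc2 mult.assoc del: power_Suc)
  qed simp
  have "norm (G ^ n) \<le> (1 + b * n) * s ^ n" for n
  proof (induction n)
    case (Suc n)
    have "G ^ Suc n = t *\<^sub>R G ^ n + y * H ^ n * star y"
      unfolding GHn[symmetric] by (simp add: power_Suc2 mult.assoc distrib_left del: power_Suc) (simp add: G_def distrib_left mult.assoc)
    then have "norm (G ^ Suc n) \<le> t * norm (G ^ n) + norm (y * H ^ n * star y)"
      using norm_triangle_ineq[of "t *\<^sub>R G ^ n"] t by simp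
    also have "\<dots> \<le> s * ((1 + b * n) * s ^ n) + norm y * s ^ n * norm y"
    proof (rule add_mono)
      show "t * norm (G ^ n) \<le> s * ((1 + b * n) * s ^ n)" using Suc t b by (intro mult_mono) auto
      have "norm (H ^ n) \<le> norm H ^ n" by (rule norm_power_ineq)
      also have "\<dots> \<le> s ^ n" using y by (intro power_mono) (auto simp: H_def)
      finally have "norm (H ^ n) \<le> s ^ n" .
      then have le: "norm (y * H ^ n) \<le> norm y * s ^ n"
        by (intro order_trans[OF norm_mult_ineq] mult_left_mono) auto
      have "norm (y * H ^ n * star y) \<le> norm (y * H ^ n) * norm y"
        using norm_mult_ineq[of "y * H ^ n" "star y"] by simp
      also have "\<dots> \<le> norm y * s ^ n * norm y" using le by (rule mult_right_mono) simp
      finally show "norm (y * H ^ n * star y) \<le> norm y * s ^ n * norm y" .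
    qed
    also have "\<dots> = (1 + b * Suc n) * s ^ Suc n"
      using t by (simp add: b_def field_simps power2_eq_square)
    finally show ?case .
  qed simp
  then have Gn: "norm (G ^ n) \<le> (1 + b * n) * s ^ n" for n .
  have "star G = G" by (simp add: G_def star_add star_scaleR star_mult star_star)
  then have "norm G ^ 2 ^ n \<le> (1 + b * 2 ^ n) * s ^ 2 ^ n" for n
    using Gn[of "2 ^ n"] norm_selfadjoint_power[of G n] by simp
  then have "norm G \<le> s" by (rule growth_bound[OF norm_ge_zero t(3)])
  then show ?thesis by (simp add: G_def)
qed

text \<open>Kaplansky's argument with error terms. For h = \<open>star c * c\<close>, r = sqrt (h^2
  + e) replaces the absolute value of h, f = r - h replaces twice its negative part, and y = c f. Up
  to terms of order e, \<open>star y * y\<close> is negative, hence so is \<open>y * star y\<close>;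
  but the latter is also positive up to such terms, since the sum of the two is positive. So y is
  small, and then f. The constants do not depend on \<open>e\<close>, which tends to 0
  afterwards.\<close>

lemma star_mult_self_decomposition:
  fixes c :: "'a::cstar_algebra_1"
  assumes e: "0 < e" "e \<le> 1"
    and T: "T = sqrt ((norm (star c * c))\<^sup>2 + 2)" and C: "C = 2 * T + norm (star c * c)"
    and t: "t = 5 * ((norm c * C)\<^sup>2 + 2 * T * C\<^sup>2 + 1)"
  obtains f y :: 'a where "norm (T *\<^sub>R 1 - star c * c) \<le> T + norm f"
    "norm f ^ 4 \<le> C * (e * C + (norm y)\<^sup>2 + norm c * norm y * C)"
    "norm y ^ 4 \<le> 2 * t * (e * C) + (e * C)\<^sup>2"
proof -
  define h where "h = star c * c"
  define t1 where "t1 = (norm h)\<^sup>2 + 1"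
  have hs: "star h = h" by (simp add: h_def star_mult star_star)
  have t1: "0 < t1" "t1 + 1 = (norm (star c * c))\<^sup>2 + 2" by (simp_all add: t1_def h_def add_nonneg_pos)
  have T0: "0 < T" "sqrt (t1 + e) \<le> T" using e t1 by (auto simp: T)
  have Cp: "0 < C" using T0 by (simp add: C add_pos_nonneg)
  have 1: "norm (t1 *\<^sub>R 1 - h * h) \<le> t1"
    by (rule norm_diff_square_le) (simp_all add: hs t1_def)
  have 2: "norm ((t1 + e) *\<^sub>R 1 - (h * h + e *\<^sub>R 1)) < t1 + e"
    using 1 e by (simp add: algebra_simps)
  have 3: "star (h * h + e *\<^sub>R 1) = h * h + e *\<^sub>R 1" by (simp add: star_add star_mult star_scaleR hs)
  obtain r where r: "star r = r" "r * r = h * h + e *\<^sub>R 1"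
      "norm (sqrt (t1 + e) *\<^sub>R 1 - r) < sqrt (t1 + e)"
    and rc: "\<And>g. g * (h * h + e *\<^sub>R 1) = (h * h + e *\<^sub>R 1) * g \<Longrightarrow> g * r = r * g"
    by (rule sqrt_shifted[OF 3 2]) blast
  obtain w where w: "star w = w" "w * w = r" and wc: "\<And>g. g * r = r * g \<Longrightarrow> g * w = w * g"
    by (rule sqrt_shifted[OF r(1,3)]) blast
  have hr: "h * r = r * h" by (rule rc) (simp add: algebra_simps)
  have hw: "h * w = w * h" by (rule wc) (rule hr)
  have rw: "r * w = w * r" by (rule wc) simp
  have Tr: "norm (T *\<^sub>R 1 - r) \<le> T"
    using norm_shift_mono[of "sqrt (t1 + e)" r "sqrt (t1 + e)" T] r(3) T0(2) by simp
  have nr: "norm r \<le> 2 * T"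
    using norm_triangle_ineq4[of "T *\<^sub>R 1" "T *\<^sub>R 1 - r"] Tr T0 by simp
  define f where "f = r - h"
  define y where "y = c * f"
  have fs: "star f = f" by (simp add: f_def star_diff r hs)
  have fC: "norm f \<le> C" using norm_triangle_ineq4[of r h] nr by (simp add: f_def C h_def)
  have hf: "h * f = f * h" by (simp add: f_def algebra_simps hr)
  have wf: "w * f = f * w" by (simp add: f_def algebra_simps hw rw)
  have ys: "star y = f * star c" by (simp add: y_def star_mult fs)
  have yC: "norm y \<le> norm c * C"
    unfolding y_def by (rule order_trans[OF norm_mult_ineq]) (simp add: fC mult_left_mono)
  have wff: "(w * f) * (w * f) = r * (f * f)"
    by (metis mult.assoc w(2) wf)
  have rh: "(r + h) * f = e *\<^sub>R 1" by (simp add: f_def algebra_simps hr r(2))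
  have "star y * y = (f * h) * f" unfolding ys unfolding y_def h_def by (simp only: mult.assoc)
  also have "\<dots> = h * (f * f)" by (simp only: hf[symmetric] mult.assoc)
  also have "\<dots> = (r + h) * f * f - r * (f * f)" by (simp add: algebra_simps)
  finally have yy: "star y * y = e *\<^sub>R f - (w * f) * (w * f)" by (simp add: rh wff)
  \<comment> \<open>\<open>x\<close> and \<open>z\<close> are the real and imaginary parts of
    \<open>y\<close>. Their squares express \<open>y * star y + star y * y\<close> and thereby show
    that it is positive.\<close>
  define x where "x = (1/2) *\<^sub>R (y + star y)"
  define z where "z = cscale (- \<i> / 2) (y - star y)"
  have xs: "star x = x" by (simp add: x_def star_scaleR star_add star_star add.commute)
  have zs: "star z = z"
    by (simp add: z_def star_cscale star_diff star_star cscale_minus_left[symmetric] cscale_minus_right[symmetric]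
        cscale_diff_right) (simp add: cscale_minus_left)
  have xz: "y * star y + star y * y = 2 *\<^sub>R (x * x) + 2 *\<^sub>R (z * z)"
  proof -
    have "4 *\<^sub>R (x * x) = (y + star y) * (y + star y)" by (simp add: x_def)
    moreover have "cscale (- \<i> / 2) (cscale (- \<i> / 2) a) = - ((1/4) *\<^sub>R a)" for a :: 'a
    proof -
      have "cscale (- \<i> / 2) (cscale (- \<i> / 2) a) = cscale (complex_of_real (- 1/4)) a"
        by (simp add: cscale_cscale)
      then show ?thesis by (simp only: cscale_of_real) simp
    qed
    then have "4 *\<^sub>R (z * z) = - ((y - star y) * (y - star y))"
      by (simp add: z_def cscale_mult_left cscale_mult_right)
    moreover have "(y + star y) * (y + star y) - (y - star y) * (y - star y)
        = 2 *\<^sub>R (y * star y + star y * y)"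
      by (simp add: algebra_simps scaleR_2)
    ultimately have "2 *\<^sub>R (y * star y + star y * y) = 2 *\<^sub>R (2 *\<^sub>R (x * x) + 2 *\<^sub>R (z * z))"
      by (simp add: scaleR_right_distrib)
    then show ?thesis by simp
  qed
  \<comment> \<open>\<open>s\<close> exceeds the squared norms of \<open>x\<close>, \<open>z\<close>
    and \<open>w * f\<close>. The factor 5 in \<open>t\<close> is 2 + 2 + 1, the multiplicities with
    which these squares occur in \<open>y * star y\<close>.\<close>
  define s where "s = (norm c * C)\<^sup>2 + 2 * T * C\<^sup>2 + 1"
  have ts: "t = 5 * s" by (simp add: t s_def)
  have s0: "0 < s" using T0 by (simp add: s_def add_nonneg_pos)
  have ny: "(norm y)\<^sup>2 \<le> (norm c * C)\<^sup>2" using yC by (intro power_mono) auto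
  have nx: "norm x \<le> norm y"
    using norm_triangle_ineq[of y "star y"] by (simp add: x_def)
  have nz: "norm z \<le> norm y"
    using norm_triangle_ineq4[of y "star y"] by (simp add: z_def norm_cscale norm_divide)
  have TC: "0 \<le> 2 * T * C\<^sup>2" using T0 by simp
  have sx: "norm (s *\<^sub>R 1 - x * x) \<le> s"
    by (rule norm_diff_square_le[OF xs])
      (use power_mono[OF nx norm_ge_zero, of 2] ny TC in \<open>unfold s_def, linarith\<close>)
  have sz: "norm (s *\<^sub>R 1 - z * z) \<le> s"
    by (rule norm_diff_square_le[OF zs])
      (use power_mono[OF nz norm_ge_zero, of 2] ny TC in \<open>unfold s_def, linarith\<close>)
  have sw: "norm (s *\<^sub>R 1 - (w * f) * (w * f)) \<le> s"
  proof (rule norm_diff_square_le)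
    show ss: "star (w * f) = w * f" by (simp add: star_mult fs w wf)
    have "(norm (w * f))\<^sup>2 = norm (r * (f * f))"
      using norm_square_selfadjoint[OF ss] by (simp add: wff)
    also have "\<dots> \<le> norm r * (norm f * norm f)"
      by (intro order_trans[OF norm_mult_ineq] mult_left_mono norm_mult_ineq) auto
    also have "\<dots> \<le> 2 * T * (C * C)" using nr fC T0 Cp by (intro mult_mono) auto
    finally show "(norm (w * f))\<^sup>2 < s"
      using zero_le_power2[of "norm c * C"] unfolding s_def power2_eq_square[of C] by linarith
  qed
  define d where "d = e * C"
  have d0: "0 \<le> d" using e Cp by (simp add: d_def)
  have ef: "norm (e *\<^sub>R f) \<le> d" using e fC by (simp add: d_def mult_left_mono)
  have eq: "s *\<^sub>R 1 - (- (star y * y)) = (s *\<^sub>R 1 - (w * f) * (w * f)) + e *\<^sub>R f" by (simp add: yy)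
  have "norm (s *\<^sub>R 1 - (- (star y * y))) \<le> s + d"
    unfolding eq by (rule norm_triangle_le[OF add_mono[OF sw ef]])
  then have "norm (t *\<^sub>R 1 - (- (star y * y))) \<le> s + d + (t - s)"
    by (rule norm_shift_mono) (use ts s0 in simp)
  then have "norm (t *\<^sub>R 1 + star y * y) \<le> t + d" by simp
  then have plus: "norm (t *\<^sub>R 1 + y * star y) \<le> t + d"
    by (intro norm_shift_swap) (use ts s0 d0 in auto)
  have "y * star y = 2 *\<^sub>R (x * x) + 2 *\<^sub>R (z * z) - (e *\<^sub>R f - (w * f) * (w * f))"
    using xz yy by (metis add_diff_cancel_right')
  then have "t *\<^sub>R 1 - y * star y = 2 *\<^sub>R (s *\<^sub>R 1 - x * x) + 2 *\<^sub>R (s *\<^sub>R 1 - z * z)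
      + (s *\<^sub>R 1 - (w * f) * (w * f)) + e *\<^sub>R f"
    by (simp add: ts algebra_simps flip: scaleR_left_distrib)
  also have "norm \<dots> \<le> 2 * s + 2 * s + s + d"
    by (intro norm_triangle_le[OF add_mono] sw ef) (use sx sz in simp_all)
  finally have minus: "norm (t *\<^sub>R 1 - y * star y) \<le> t + d" by (simp add: ts)
  define g where "g = y * star y"
  have gs: "star g = g" by (simp add: g_def star_mult star_star)
  have t0: "0 \<le> t" using ts s0 by simp
  \<comment> \<open>Both t + g and t - g have norm at most t + d. Averaging their squares bounds t^2
    + g^2, and \<open>norm_add_square_ge\<close> turns this into a bound for g.\<close>
  have "2 *\<^sub>R (t\<^sup>2 *\<^sub>R 1 + g * g) = (t *\<^sub>R 1 + g) * (t *\<^sub>R 1 + g) + (t *\<^sub>R 1 - g) * (t *\<^sub>R 1 - g)"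
    by (simp add: algebra_simps scaleR_2 power2_eq_square) (simp flip: scaleR_left_distrib)
  then have "2 * norm (t\<^sup>2 *\<^sub>R 1 + g * g)
      = norm ((t *\<^sub>R 1 + g) * (t *\<^sub>R 1 + g) + (t *\<^sub>R 1 - g) * (t *\<^sub>R 1 - g))"
    by (metis abs_numeral norm_scaleR)
  also have "\<dots> \<le> norm (t *\<^sub>R 1 + g) * norm (t *\<^sub>R 1 + g) + norm (t *\<^sub>R 1 - g) * norm (t *\<^sub>R 1 - g)"
    by (intro norm_triangle_le[OF add_mono] norm_mult_ineq)
  also have "\<dots> \<le> (t + d) * (t + d) + (t + d) * (t + d)"
    using plus minus t0 d0 by (intro add_mono mult_mono) (auto simp: g_def)
  finally have "norm (t\<^sup>2 *\<^sub>R 1 + g * g) \<le> (t + d)\<^sup>2" by (simp add: power2_eq_square)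
  then have "t\<^sup>2 + (norm g)\<^sup>2 \<le> (t + d)\<^sup>2"
    using norm_add_square_ge[OF gs, of "t\<^sup>2"] by simp
  moreover have "norm g = (norm y)\<^sup>2" by (simp add: g_def norm_mult_star)
  ultimately have y4: "norm y ^ 4 \<le> 2 * t * (e * C) + (e * C)\<^sup>2"
    by (simp add: power_mult[symmetric] power2_sum d_def[symmetric])
  \<comment> \<open>f^3 = r f^2 - h f^2, and y controls both terms: r f^2 = e f -
    \<open>star y * y\<close> and h f^2 = \<open>star c * (y * f)\<close>.\<close>
  have fff: "f * (f * f) = e *\<^sub>R f - star y * y - star c * (y * f)"
    by (simp add: yy wff) (simp add: f_def y_def h_def algebra_simps)
  have "norm (f * (f * f)) \<le> e * C + (norm y)\<^sup>2 + norm c * norm y * C"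
  proof -
    have "norm (star c * (y * f)) \<le> norm c * (norm y * norm f)"
      by (rule order_trans[OF norm_mult_ineq]) (simp add: norm_mult_ineq mult_left_mono)
    also have "\<dots> \<le> norm c * (norm y * C)" using fC by (intro mult_left_mono) auto
    finally have "norm (star c * (y * f)) \<le> norm c * norm y * C" by (simp add: mult.assoc)
    then show ?thesis unfolding fff using ef cstar_identity[of y]
      by (intro order_trans[OF norm_triangle_ineq4] add_mono) (auto simp: d_def)
  qed
  have "norm f ^ 4 = norm (f * (f * (f * f)))"
  proof -
    have "norm ((f * f) * (f * f)) = (norm (f * f))\<^sup>2"
      by (rule norm_square_selfadjoint) (simp add: star_mult fs)
    then show ?thesis by (simp add: norm_square_selfadjoint[OF fs] mult.assoc power_mult[symmetric])
  qed
  also have "\<dots> \<le> norm f * norm (f * (f * f))" by (rule norm_mult_ineq)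
  also have "\<dots> \<le> C * (e * C + (norm y)\<^sup>2 + norm c * norm y * C)"
    by (intro mult_mono) (use fC Cp in \<open>auto intro: \<open>norm (f * (f * f)) \<le> _\<close>\<close>)
  finally have f4: "norm f ^ 4 \<le> C * (e * C + (norm y)\<^sup>2 + norm c * norm y * C)" .
  have eq: "T *\<^sub>R 1 - star c * c = (T *\<^sub>R 1 - r) + f" by (simp add: f_def h_def)
  have "norm (T *\<^sub>R 1 - star c * c) \<le> T + norm f"
    unfolding eq by (rule norm_triangle_le[OF add_mono[OF Tr order_refl]])
  from this f4 y4 show ?thesis by (rule that)
qed

text \<open>The positivity of \<open>c\<^sup>* c\<close>, expressed through norms.\<close>

lemma norm_shift_star_mult_self_le:
  fixes c :: "'a::cstar_algebra_1"
  obtains T where "0 \<le> T" "norm (T *\<^sub>R 1 - star c * c) \<le> T"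
proof -
  define T where "T = sqrt ((norm (star c * c))\<^sup>2 + 2)"
  define C where "C = 2 * T + norm (star c * c)"
  define t where "t = 5 * ((norm c * C)\<^sup>2 + 2 * T * C\<^sup>2 + 1)"
  define e where "e n = inverse (real (Suc n))" for n
  have e: "0 < e n" "e n \<le> 1" for n by (simp_all add: e_def field_simps)
  have e0: "e \<longlonglongrightarrow> 0" unfolding e_def by (rule LIMSEQ_inverse_real_of_nat)
  have "\<exists>f y. norm (T *\<^sub>R 1 - star c * c) \<le> T + norm (f::'a) \<and>
      norm f ^ 4 \<le> C * (e n * C + (norm (y::'a))\<^sup>2 + norm c * norm y * C) \<and>
      norm y ^ 4 \<le> 2 * t * (e n * C) + (e n * C)\<^sup>2" for n
    by (rule star_mult_self_decomposition[OF e T_def C_def t_def]) blast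
  then obtain f y where fy: "\<And>n. norm (T *\<^sub>R 1 - star c * c) \<le> T + norm (f n :: 'a)"
      "\<And>n. norm (f n) ^ 4 \<le> C * (e n * C + (norm (y n :: 'a))\<^sup>2 + norm c * norm (y n) * C)"
      "\<And>n. norm (y n) ^ 4 \<le> 2 * t * (e n * C) + (e n * C)\<^sup>2"
    by metis
  have root: "u \<longlonglongrightarrow> 0" if "\<And>n. 0 \<le> u n" "\<And>n. u n ^ 4 \<le> b n" "b \<longlonglongrightarrow> 0" for u b :: "nat \<Rightarrow> real"
  proof -
    have "(\<lambda>n. u n ^ 4) \<longlonglongrightarrow> 0"
      by (rule tendsto_sandwich[OF always_eventually always_eventually tendsto_const that(3)])
        (use that(1,2) in simp_all)
    then show ?thesis
      using tendsto_real_root[of "\<lambda>n. u n ^ 4" 0 sequentially 4] that(1) by (simp add: real_root_power_cancel)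
  qed
  have "(\<lambda>n. 2 * t * (e n * C) + (e n * C)\<^sup>2) \<longlonglongrightarrow> 2 * t * (0 * C) + (0 * C)\<^sup>2"
    by (rule tendsto_add[OF tendsto_mult_left[OF tendsto_mult_right] tendsto_power[OF tendsto_mult_right]]; rule e0)
  then have "(\<lambda>n. 2 * t * (e n * C) + (e n * C)\<^sup>2) \<longlonglongrightarrow> 0" by simp
  from root[OF norm_ge_zero fy(3) this] have y0: "(\<lambda>n. norm (y n)) \<longlonglongrightarrow> 0" .
  have "(\<lambda>n. C * (e n * C + (norm (y n))\<^sup>2 + norm c * norm (y n) * C))
      \<longlonglongrightarrow> C * (0 * C + 0\<^sup>2 + norm c * 0 * C)"
    by (rule tendsto_mult_left tendsto_add tendsto_mult_right tendsto_power e0 y0)+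
  then have "(\<lambda>n. C * (e n * C + (norm (y n))\<^sup>2 + norm c * norm (y n) * C)) \<longlonglongrightarrow> 0" by simp
  from root[OF norm_ge_zero fy(2) this] have "(\<lambda>n. norm (f n)) \<longlonglongrightarrow> 0" .
  then have "(\<lambda>n. T + norm (f n)) \<longlonglongrightarrow> T + 0" by (rule tendsto_add[OF tendsto_const])
  then have "norm (T *\<^sub>R 1 - star c * c) \<le> T + 0"
    by (rule LIMSEQ_le_const) (use fy(1) in blast)
  moreover have "0 \<le> T" by (simp add: T_def)
  ultimately show ?thesis by (intro that) auto
qed

text \<open>For M above the norm of p + q, M - p is the sum of q and a square, so it is positive and
  \<parallel>p\<parallel> \<le> M follows. A small multiple of 1 is added to p to make it a square,
  as \<open>norm_add_square_ge\<close> requires.\<close>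

lemma norm_star_mult_self_le_unital:
  fixes c d :: "'a::cstar_algebra_1"
  shows "norm (star c * c) \<le> norm (star c * c + star d * d)"
proof (rule dense_ge)
  define p where "p = star c * c"
  define q where "q = star d * d"
  have ps: "star p = p" and qs: "star q = q" by (simp_all add: p_def q_def star_mult star_star)
  fix M assume M: "norm (star c * c + star d * d) < M"
  obtain T1 where T1: "0 \<le> T1" "norm (T1 *\<^sub>R 1 - p) \<le> T1" 
    unfolding p_def by (rule norm_shift_star_mult_self_le)
  obtain T2 where T2: "0 \<le> T2" "norm (T2 *\<^sub>R 1 - q) \<le> T2" 
    unfolding q_def by (rule norm_shift_star_mult_self_le)
  define h where "h = M *\<^sub>R 1 - (p + q)"
  have hs: "star h = h" by (simp add: h_def star_diff star_add star_scaleR ps qs)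
  have hM: "norm (M *\<^sub>R 1 - h) < M" using M by (simp add: h_def p_def q_def add.commute)
  obtain v where v: "star v = v" "v * v = h" by (rule sqrt_shifted[OF hs hM])
  \<comment> \<open>The summand \<open>M\<close> keeps \<open>T2 + T3 - M\<close>
    nonnegative.\<close>
  define T3 where "T3 = (norm v)\<^sup>2 + M + 1"
  have M0: "0 \<le> M" using M by (meson norm_ge_zero less_imp_le order_trans)
  have "norm (T3 *\<^sub>R 1 - v * v) \<le> T3"
    by (rule norm_diff_square_le) (use M0 in \<open>simp_all add: v T3_def\<close>)
  then have "norm ((T2 *\<^sub>R 1 - q) + (T3 *\<^sub>R 1 - v * v)) \<le> T2 + T3"
    by (intro norm_triangle_le[OF add_mono] T2)
  moreover have "(T2 *\<^sub>R 1 - q) + (T3 *\<^sub>R 1 - v * v) = (T2 + T3 - M) *\<^sub>R 1 + p"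
    by (simp add: v h_def algebra_simps)
  ultimately have up: "norm ((T2 + T3 - M) *\<^sub>R 1 + p) \<le> T2 + T3" by simp
  show "norm (star c * c) \<le> M"
  proof (rule field_le_epsilon)
    fix e' :: real assume e': "0 < e'"
    define e where "e = e' / 2"
    have e: "0 < e" using e' by (simp add: e_def)
    have pe: "norm ((T1 + e) *\<^sub>R 1 - (p + e *\<^sub>R 1)) < T1 + e" using T1 e by (simp add: algebra_simps)
    have ps': "star (p + e *\<^sub>R 1) = p + e *\<^sub>R 1" by (simp add: star_add star_scaleR ps)
    obtain k where k: "star k = k" "k * k = p + e *\<^sub>R 1"
      by (rule sqrt_shifted[OF ps' pe])
    have T: "0 \<le> T2 + T3 - M" using T2 by (simp add: T3_def add_nonneg_nonneg)
    from norm_add_square_ge[OF k(1) T]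
    have "T2 + T3 - M + norm (p + e *\<^sub>R 1) \<le> norm (((T2 + T3 - M) *\<^sub>R 1 + p) + e *\<^sub>R 1)"
      by (simp add: norm_square_selfadjoint[OF k(1), symmetric] k(2) add.assoc)
    also have "\<dots> \<le> (T2 + T3) + e"
      by (intro norm_triangle_le[OF add_mono] up) (use e in simp)
    finally have "norm (p + e *\<^sub>R 1) \<le> M + e" by simp
    have "norm p \<le> norm (p + e *\<^sub>R 1) + norm (e *\<^sub>R (1::'a))"
      using norm_triangle_ineq4[of "p + e *\<^sub>R 1" "e *\<^sub>R 1"] by simp
    with \<open>norm (p + e *\<^sub>R 1) \<le> M + e\<close> show "norm (star c * c) \<le> M + e'"
      using e' by (simp add: p_def e_def)
  qed
qed

text \<open>\<open>g\<close> is the inverse of h + e for h = \<open>star c * c\<close>, so that c -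
  c g h = e c g.\<close>

lemma resolvent_approximation:
  fixes c :: "'a::cstar_algebra_1"
  assumes e: "0 < e"
  obtains g where "(norm (c - c * g * (star c * c)))\<^sup>2 \<le> e"
proof -
  define h where "h = star c * c"
  have hs: "star h = h" by (simp add: h_def star_mult star_star)
  obtain T where T: "0 \<le> T" "norm (T *\<^sub>R 1 - h) \<le> T" unfolding h_def by (rule norm_shift_star_mult_self_le)
  define M where "M = T + e"
  have M: "0 < M" using T e by (simp add: M_def)
  \<comment> \<open>h + e = M (1 - v) with \<parallel>v\<parallel> < 1. The inverse is the fixed
    point of g \<mapsto> v g + 1/M, sought among the elements that commute with
    \<open>h\<close>.\<close>
  define v where "v = (1/M) *\<^sub>R (M *\<^sub>R 1 - (h + e *\<^sub>R 1))"
  have "v = (1/M) *\<^sub>R (T *\<^sub>R 1 - h)" by (simp add: v_def M_def algebra_simps)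
  then have "norm v \<le> T / M" using T M by (simp add: divide_right_mono)
  also have "T / M < 1" using M e by (simp add: M_def)
  finally have v1: "norm v < 1" .
  define S where "S = {g::'a. g * h = h * g}"
  have "closed S"
    unfolding S_def by (intro closed_Collect_eq continuous_intros)
  have vh: "v * h = h * v" by (simp add: v_def algebra_simps)
  have "\<exists>!g. g \<in> S \<and> v * g + (1/M) *\<^sub>R 1 = g"
  proof (rule Banach_fix[where c="norm v"])
    show "complete S" using \<open>closed S\<close> by (simp add: complete_eq_closed)
    show "S \<noteq> {}" by (auto simp: S_def intro!: exI[of _ 0])
    show "dist (v * x + (1/M) *\<^sub>R 1) (v * y + (1/M) *\<^sub>R 1) \<le> norm v * dist x y" for x y :: 'a
      using norm_mult_ineq[of v "x - y"] by (simp add: dist_norm right_diff_distrib)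
    show "(\<lambda>g. v * g + (1/M) *\<^sub>R 1) ` S \<subseteq> S"
    proof (intro image_subsetI)
      fix g assume "g \<in> S"
      then have gh: "g * h = h * g" by (simp add: S_def)
      have "h * (v * g) = v * (h * g)" by (simp add: vh mult.assoc[symmetric])
      then show "v * g + (1/M) *\<^sub>R 1 \<in> S" by (simp add: S_def distrib_left distrib_right mult.assoc gh)
    qed
  qed (use v1 in simp_all)
  then obtain g where gh: "g * h = h * g" and g: "v * g + (1/M) *\<^sub>R 1 = g" by (auto simp: S_def)
  have "M *\<^sub>R g = M *\<^sub>R (v * g) + 1" using M by (subst g[symmetric]) (simp add: scaleR_right_distrib)
  also have "M *\<^sub>R (v * g) = M *\<^sub>R g - (h + e *\<^sub>R 1) * g" using M by (simp add: v_def left_diff_distrib)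
  finally have inv: "(h + e *\<^sub>R 1) * g = 1" by simp
  have gs: "star g = g"
  proof -
    have "star g * (h + e *\<^sub>R 1) = 1"
      using arg_cong[OF inv, of star] by (simp add: star_mult star_add star_scaleR hs)
    then have "star g * ((h + e *\<^sub>R 1) * g) = g" by (simp add: mult.assoc[symmetric])
    then show ?thesis by (simp add: inv)
  qed
  \<comment> \<open>Multiplying 4 e h + (h - e)^2 = (h + e)^2 by g^2 gives
    \<open>star d * d + star a * a = 1\<close>. Hence \<parallel>d\<parallel> \<le> 1, and e c g =
    (sqrt e / 2) d is small.\<close>
  define d where "d = (2 * sqrt e) *\<^sub>R (c * g)"
  define a where "a = (h - e *\<^sub>R 1) * g"
  have as: "star a = a" by (simp add: a_def star_mult star_diff star_scaleR hs gs left_diff_distrib right_diff_distrib gh)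
  have "star d * d = (4 * e) *\<^sub>R (h * (g * g))"
  proof -
    have "star d * d = (4 * e) *\<^sub>R (g * h * g)"
      using e by (simp add: d_def star_scaleR star_mult gs h_def mult.assoc)
    then show ?thesis by (simp add: gh mult.assoc)
  qed
  moreover have "a * a = ((h + e *\<^sub>R 1) * g) * ((h + e *\<^sub>R 1) * g) - (4 * e) *\<^sub>R (h * (g * g))"
  proof -
    have gh': "g * (h * x) = h * (g * x)" for x by (metis gh mult.assoc)
    show ?thesis
      by (simp add: a_def distrib_left distrib_right left_diff_distrib right_diff_distrib mult.assoc gh gh'
          flip: scaleR_left_distrib scaleR_left_diff_distrib)
         (simp add: algebra_simps flip: scaleR_left_distrib scaleR_left_diff_distrib)
  qed
  ultimately have "star d * d + star a * a = 1" by (simp add: inv as)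
  then have "norm (star d * d) \<le> 1" using norm_star_mult_self_le_unital[of d a] by simp
  then have d1: "(norm d)\<^sup>2 \<le> 1" by (simp add: cstar_identity)
  have "c - c * g * h = c * ((h + e *\<^sub>R 1) * g) - c * (h * g)" by (simp add: inv gh mult.assoc)
  also have "\<dots> = e *\<^sub>R (c * g)" by (simp add: distrib_left distrib_right)
  also have "\<dots> = (sqrt e / 2) *\<^sub>R d" using e by (simp add: d_def)
  finally have "(norm (c - c * g * h))\<^sup>2 = e / 4 * (norm d)\<^sup>2" using e by (simp add: power_mult_distrib power_divide)
  also have "\<dots> \<le> e / 4 * 1" using d1 e by (intro mult_left_mono) auto
  also have "\<dots> \<le> e" using e by simp
  finally show ?thesis by (intro that[of g]) (simp add: h_def)
qed

section \<open>The unitization\<close>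

text \<open>
  The first entry of the maximum in the norm keeps it definite when \<open>'a\<close> already has a unit.
\<close>

datatype 'a unitization = Unitization (scalar_part: complex) (vector_part: 'a)

text \<open>The unitization acts on the original algebra by left multiplication; the operator norm
  of this action is the main ingredient of its norm.\<close>

definition unit_mult :: "'a::cstar_algebra unitization \<Rightarrow> 'a \<Rightarrow> 'a" where
  "unit_mult u x = cscale (scalar_part u) x + vector_part u * x"

lemma cscale_of_real_mult: "cscale (complex_of_real r * c) (a::'a::cstar_algebra) = r *\<^sub>R cscale c a"
  by (simp add: cscale_cscale[symmetric] cscale_of_real)

lemma cscale_scaleR: "cscale c (r *\<^sub>R a) = r *\<^sub>R cscale c (a::'a::cstar_algebra)"
  by (metis cscale_cscale cscale_of_real mult.commute)

lemma bounded_linear_cscale: "bounded_linear (cscale c :: 'a::cstar_algebra \<Rightarrow> 'a)"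
  by (rule bounded_linear_intro[where K="cmod c"])
    (simp_all add: cscale_add_right norm_cscale cscale_scaleR)

lemma bounded_linear_unit_mult: "bounded_linear (unit_mult u)"
  unfolding unit_mult_def
  by (intro bounded_linear_add bounded_linear_cscale bounded_linear_mult_right)

instantiation unitization :: (cstar_algebra) real_normed_algebra_1
begin

definition "(0 :: 'a unitization) = Unitization 0 0"
definition "(1 :: 'a unitization) = Unitization 1 0"
definition "(u :: 'a unitization) + v =
  Unitization (scalar_part u + scalar_part v) (vector_part u + vector_part v)"
definition "- (u :: 'a unitization) = Unitization (- scalar_part u) (- vector_part u)"
definition "(u :: 'a unitization) - v =
  Unitization (scalar_part u - scalar_part v) (vector_part u - vector_part v)"
definition "r *\<^sub>R (u :: 'a unitization) =
  Unitization (complex_of_real r * scalar_part u) (r *\<^sub>R vector_part u)"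
definition "(u :: 'a unitization) * v = Unitization (scalar_part u * scalar_part v)
  (cscale (scalar_part u) (vector_part v) + cscale (scalar_part v) (vector_part u)
    + vector_part u * vector_part v)"
definition "norm (u :: 'a unitization) = max (cmod (scalar_part u)) (onorm (unit_mult u))"
definition "dist (u :: 'a unitization) v = norm (u - v)"
definition "sgn (u :: 'a unitization) = inverse (norm u) *\<^sub>R u"
definition "uniformity =
  (INF e\<in>{0 <..}. principal {(x :: 'a unitization, y). dist x y < e})"
definition "open (U :: 'a unitization set) \<longleftrightarrow>
  (\<forall>x\<in>U. eventually (\<lambda>(x', y). x' = x \<longrightarrow> y \<in> U) uniformity)"

lemmas unitization_defs = zero_unitization_def one_unitization_def plus_unitization_def
  uminus_unitization_def minus_unitization_def scaleR_unitization_def times_unitization_def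

lemma unit_mult_simps:
  fixes u v :: "'a unitization"
  shows "unit_mult (u + v) x = unit_mult u x + unit_mult v x"
    "unit_mult (r *\<^sub>R u) x = r *\<^sub>R unit_mult u x"
    "unit_mult (u * v) x = unit_mult u (unit_mult v x)"
  by (simp_all add: unit_mult_def unitization_defs cscale_of_real_mult cscale_add_left cscale_add_right
      cscale_mult_left cscale_mult_right cscale_cscale mult.assoc scaleR_right_distrib distrib_left distrib_right)

lemma norm_unit_mult_le: "norm (unit_mult u x) \<le> norm u * norm (x::'a)"
  using onorm[OF bounded_linear_unit_mult[of u], of x]
  by (rule order_trans) (simp add: norm_unitization_def mult_right_mono)

lemma norm_unitization_le:
  assumes "cmod (scalar_part (u :: 'a unitization)) \<le> b" "\<And>x::'a. norm (unit_mult u x) \<le> b * norm x"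
  shows "norm u \<le> b"
proof -
  have "0 \<le> b" using assms(1) norm_ge_zero order_trans by blast
  then show ?thesis unfolding norm_unitization_def by (intro max.boundedI assms onorm_bound)
qed

lemma scalar_part_le: "cmod (scalar_part u) \<le> norm (u::'a unitization)"
  by (simp add: norm_unitization_def)

text \<open>Applying u to \<open>star a\<close> returns \<open>a * star a\<close> up to a scalar
  multiple of \<open>star a\<close>. The estimate makes the second coordinate continuous, which
  yields definiteness and completeness of the norm.\<close>

lemma vector_part_le: "norm (vector_part u) \<le> 2 * norm (u :: 'a unitization)"
proof (cases "vector_part u = 0")
  case True
  then show ?thesis using order_trans[OF norm_ge_zero scalar_part_le[of u]] by simp
next
  case False
  define a where "a = vector_part u"
  have "a * star a = unit_mult u (star a) - cscale (scalar_part u) (star a)"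
    by (simp add: unit_mult_def a_def)
  then have "norm (a * star a) \<le> norm (unit_mult u (star a)) + norm (cscale (scalar_part u) (star a))"
    by (simp only: norm_triangle_ineq4)
  also have "\<dots> \<le> norm u * norm a + norm u * norm a"
    using norm_unit_mult_le[of u "star a"] scalar_part_le[of u]
    by (intro add_mono) (auto simp: norm_cscale mult_right_mono)
  finally have "norm a * norm a \<le> (2 * norm u) * norm a"
    by (simp add: norm_mult_star power2_eq_square mult_ac)
  then show ?thesis using False mult_right_le_imp_le[of "norm a" "norm a" "2 * norm u"] by (simp add: a_def)
qed

lemma norm_le_parts: "norm (u :: 'a unitization) \<le> cmod (scalar_part u) + norm (vector_part u)"
proof (rule norm_unitization_le)
  fix x :: 'a
  show "norm (unit_mult u x) \<le> (cmod (scalar_part u) + norm (vector_part u)) * norm x"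
    unfolding unit_mult_def distrib_right
    by (intro norm_triangle_le add_mono norm_mult_ineq) (simp add: norm_cscale)
qed simp

lemma norm_scaleR_unitization_le: "norm (r *\<^sub>R (u :: 'a unitization)) \<le> \<bar>r\<bar> * norm u"
proof (rule norm_unitization_le)
  show "cmod (scalar_part (r *\<^sub>R u)) \<le> \<bar>r\<bar> * norm u"
    using scalar_part_le[of u] by (simp add: unitization_defs norm_mult mult_left_mono)
  show "norm (unit_mult (r *\<^sub>R u) x) \<le> \<bar>r\<bar> * norm u * norm x" for x
    using mult_left_mono[OF norm_unit_mult_le[of u x], of "\<bar>r\<bar>"]
    by (simp add: unit_mult_simps mult.assoc)
qed

instance
proof
  fix u v w :: "'a unitization" and r s :: real
  show "u + v + w = u + (v + w)" "u + v = v + u" "0 + u = u" "- u + u = 0" "u - v = u + - v"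
    "r *\<^sub>R (u + v) = r *\<^sub>R u + r *\<^sub>R v" "(r + s) *\<^sub>R u = r *\<^sub>R u + s *\<^sub>R u"
    "r *\<^sub>R s *\<^sub>R u = (r * s) *\<^sub>R u" "1 *\<^sub>R u = u" "(0 :: 'a unitization) \<noteq> 1"
    "1 * u = u" "u * 1 = u"
    by (simp_all add: unitization_defs algebra_simps)
  show "(u + v) * w = u * w + v * w" "u * (v + w) = u * v + u * w"
    by (simp_all add: unitization_defs cscale_add_left cscale_add_right distrib_left distrib_right)
  show "u * v * w = u * (v * w)"
    by (simp add: unitization_defs cscale_add_left cscale_add_right distrib_left distrib_right
        cscale_mult_left cscale_mult_right cscale_cscale mult.assoc) (simp add: mult.commute)
  show "r *\<^sub>R u * v = r *\<^sub>R (u * v)" "u * r *\<^sub>R v = r *\<^sub>R (u * v)"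
    by (simp_all add: unitization_defs cscale_of_real_mult cscale_scaleR scaleR_right_distrib)
  show "dist u v = norm (u - v)" by (rule dist_unitization_def)
  show "sgn u = inverse (norm u) *\<^sub>R u" by (rule sgn_unitization_def)
  show "(uniformity :: ('a unitization \<times> 'a unitization) filter) =
      (INF e\<in>{0 <..}. principal {(x, y). dist x y < e})"
    by (rule uniformity_unitization_def)
  show "open U \<longleftrightarrow> (\<forall>x\<in>U. eventually (\<lambda>(x', y). x' = x \<longrightarrow> y \<in> U) uniformity)" for U :: "'a unitization set"
    by (rule open_unitization_def)
  \<comment> \<open>\<open>norm_ge_zero\<close> is not yet available on the type being
    instantiated.\<close>
  have n0: "0 \<le> norm x" for x :: "'a unitization"
    using scalar_part_le[of x] by (rule order_trans[OF norm_ge_zero])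
  show "norm u = 0 \<longleftrightarrow> u = 0"
  proof
    assume "norm u = 0"
    then show "u = 0" using scalar_part_le[of u] vector_part_le[of u]
      by (intro unitization.expand) (auto simp: unitization_defs)
  next
    assume "u = 0"
    then show "norm u = 0" using norm_le_parts[of u] n0[of u] by (simp add: unitization_defs)
  qed
  show "norm (u + v) \<le> norm u + norm v"
  proof (rule norm_unitization_le)
    show "cmod (scalar_part (u + v)) \<le> norm u + norm v"
      using scalar_part_le[of u] scalar_part_le[of v] norm_triangle_ineq[of "scalar_part u" "scalar_part v"]
      by (simp add: unitization_defs)
    show "norm (unit_mult (u + v) x) \<le> (norm u + norm v) * norm x" for x
      unfolding unit_mult_simps distrib_right
      by (intro norm_triangle_le add_mono norm_unit_mult_le)
  qed
  show "norm (r *\<^sub>R u) = \<bar>r\<bar> * norm u"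
  proof (cases "r = 0")
    case True
    then show ?thesis using norm_scaleR_unitization_le[of r u] n0[of "r *\<^sub>R u"] by simp
  next
    case False
    have "inverse r *\<^sub>R r *\<^sub>R u = u" using False by (simp add: unitization_defs mult.assoc[symmetric])
    then have "norm u \<le> \<bar>inverse r\<bar> * norm (r *\<^sub>R u)"
      using norm_scaleR_unitization_le[of "inverse r" "r *\<^sub>R u"] by simp
    then have "\<bar>r\<bar> * norm u \<le> norm (r *\<^sub>R u)" using False by (simp add: field_simps)
    with norm_scaleR_unitization_le[of r u] show ?thesis by simp
  qed
  show "norm (u * v) \<le> norm u * norm v"
  proof (rule norm_unitization_le)
    show "cmod (scalar_part (u * v)) \<le> norm u * norm v"
      using scalar_part_le[of u] scalar_part_le[of v]
      by (simp add: unitization_defs norm_mult mult_mono')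
    fix x :: 'a
    have "norm (unit_mult u (unit_mult v x)) \<le> norm u * norm (unit_mult v x)" by (rule norm_unit_mult_le)
    also have "\<dots> \<le> norm u * (norm v * norm x)"
      by (intro mult_left_mono norm_unit_mult_le n0)
    finally show "norm (unit_mult (u * v) x) \<le> norm u * norm v * norm x"
      by (simp add: unit_mult_simps mult.assoc)
  qed
  show "norm (1 :: 'a unitization) = 1"
  proof (rule antisym)
    show "norm (1 :: 'a unitization) \<le> 1"
      by (rule norm_unitization_le) (simp_all add: unit_mult_def unitization_defs)
    show "1 \<le> norm (1 :: 'a unitization)"
      using scalar_part_le[of "1 :: 'a unitization"] by (simp add: unitization_defs)
  qed
qed

end

instantiation unitization :: (cstar_algebra) cstar_algebra_1
begin

definition "cscale c (u :: 'a unitization) = Unitization (c * scalar_part u) (cscale c (vector_part u))"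
definition "star (u :: 'a unitization) = Unitization (cnj (scalar_part u)) (star (vector_part u))"

lemma star_unit_mult_mult: "star (unit_mult u x) * y = star (x::'a) * unit_mult (star u) y"
  by (simp add: unit_mult_def star_unitization_def star_add star_cscale star_mult cscale_mult_left
      cscale_mult_right distrib_left distrib_right mult.assoc)

text \<open>\<parallel>u x\<parallel>^2 is the norm of \<open>star x\<close> times
  (\<open>star u * u\<close>) x. With submultiplicativity this one inequality yields first
  \<parallel>\<open>star u\<close>\<parallel> = \<parallel>u\<parallel> and then the
  C*-identity.\<close>

lemma norm_square_le_unitization: "(norm u)\<^sup>2 \<le> norm (star u * (u :: 'a unitization))"
proof -
  have "norm u \<le> sqrt (norm (star u * u))"
  proof (rule norm_unitization_le)
    have "(cmod (scalar_part u))\<^sup>2 \<le> norm (star u * u)"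
      using scalar_part_le[of "star u * u"]
      by (simp add: unitization_defs star_unitization_def norm_mult power2_eq_square)
    then show "cmod (scalar_part u) \<le> sqrt (norm (star u * u))" by (rule real_le_rsqrt)
    fix x :: 'a
    have "(norm (unit_mult u x))\<^sup>2 = norm (star x * unit_mult (star u * u) x)"
      by (simp add: cstar_identity[symmetric] unit_mult_simps star_unit_mult_mult)
    also have "\<dots> \<le> norm x * norm (unit_mult (star u * u) x)"
      using norm_mult_ineq[of "star x"] by simp
    also have "\<dots> \<le> norm x * (norm (star u * u) * norm x)"
      by (intro mult_left_mono norm_unit_mult_le) simp
    also have "\<dots> = norm (star u * u) * (norm x)\<^sup>2" by (simp add: power2_eq_square)
    finally have "norm (unit_mult u x) \<le> sqrt (norm (star u * u) * (norm x)\<^sup>2)" by (rule real_le_rsqrt)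
    then show "norm (unit_mult u x) \<le> sqrt (norm (star u * u)) * norm x" by (simp add: real_sqrt_mult)
  qed
  then have "(norm u)\<^sup>2 \<le> (sqrt (norm (star u * u)))\<^sup>2" by (rule power_mono) simp
  then show ?thesis by simp
qed

instance
proof
  fix u v :: "'a unitization" and r :: real and c d :: complex
  show "cscale c (u + v) = cscale c u + cscale c v"
    "cscale (c + d) u = cscale c u + cscale d u"
    "cscale c (cscale d u) = cscale (c * d) u"
    "star (u + v) = star u + star v"
    "cscale (complex_of_real r) u = r *\<^sub>R u"
    "star (cscale c u) = cscale (cnj c) (star u)"
    by (simp_all add: unitization_defs cscale_unitization_def star_unitization_def distrib_left distrib_right
        cscale_add_left cscale_add_right cscale_cscale star_add star_cscale cscale_of_real mult.assoc)
  show ss: "star (star u) = u" by (simp add: star_unitization_def star_star)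
  show "cscale c u * v = cscale c (u * v)" "u * cscale c v = cscale c (u * v)"
    by (simp_all add: unitization_defs cscale_unitization_def cscale_add_right cscale_cscale
        cscale_mult_left cscale_mult_right mult_ac)
  show "star (u * v) = star v * star u"
    by (simp add: unitization_defs star_unitization_def star_add star_cscale star_mult mult.commute add.commute)
  have le: "norm (cscale c u) \<le> cmod c * norm u" for c and u :: "'a unitization"
  proof (rule norm_unitization_le)
    show "cmod (scalar_part (cscale c u)) \<le> cmod c * norm u"
      using scalar_part_le[of u] by (simp add: cscale_unitization_def norm_mult mult_left_mono)
    have "unit_mult (cscale c u) x = cscale c (unit_mult u x)" for x
      by (simp add: unit_mult_def cscale_unitization_def cscale_add_right cscale_cscale cscale_mult_left)
    then show "norm (unit_mult (cscale c u) x) \<le> cmod c * norm u * norm x" for x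
      using mult_left_mono[OF norm_unit_mult_le[of u x], of "cmod c"]
      by (simp add: norm_cscale mult.assoc)
  qed
  show "norm (cscale c u) = cmod c * norm u"
  proof (cases "c = 0")
    case True
    then show ?thesis using le[of c u] by simp
  next
    case False
    have "cscale (inverse c) (cscale c u) = u"
      using False by (simp add: cscale_unitization_def cscale_cscale mult.assoc[symmetric])
    then have "norm u \<le> cmod (inverse c) * norm (cscale c u)" using le[of "inverse c" "cscale c u"] by simp
    then have "cmod c * norm u \<le> norm (cscale c u)" using False by (simp add: norm_inverse norm_divide field_simps)
    with le[of c u] show ?thesis by simp
  qed
  have le: "norm u \<le> norm (star u)" for u :: "'a unitization"
  proof (cases "u = 0")
    case False
    have "norm u * norm u \<le> norm (star u) * norm u"
      using order_trans[OF norm_square_le_unitization[of u] norm_mult_ineq] by (simp add: power2_eq_square)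
    then show ?thesis using False by simp
  qed simp
  have "star (star u) = u" by (rule ss)
  then have "norm (star u) = norm u" using le[of u] le[of "star u"] by simp
  then show "norm (star u * u) = (norm u)\<^sup>2"
    using norm_square_le_unitization[of u] norm_mult_ineq[of "star u" u] by (simp add: power2_eq_square)
next
  fix X :: "nat \<Rightarrow> 'a unitization" assume X: "Cauchy X"
  have "bounded_linear (scalar_part :: 'a unitization \<Rightarrow> complex)"
    by (rule bounded_linear_intro[where K=1])
      (simp_all add: unitization_defs scaleR_conv_of_real scalar_part_le)
  from bounded_linear.Cauchy[OF this X]
  obtain a where a: "(\<lambda>n. scalar_part (X n)) \<longlonglongrightarrow> a" by (auto simp: Cauchy_convergent_iff convergent_def)
  have "bounded_linear (vector_part :: 'a unitization \<Rightarrow> 'a)"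
    by (rule bounded_linear_intro[where K=2])
      (use vector_part_le in \<open>simp_all add: unitization_defs mult.commute\<close>)
  from bounded_linear.Cauchy[OF this X]
  obtain b where b: "(\<lambda>n. vector_part (X n)) \<longlonglongrightarrow> b" by (auto simp: Cauchy_convergent_iff convergent_def)
  have "(\<lambda>n. cmod (scalar_part (X n) - a) + norm (vector_part (X n) - b)) \<longlonglongrightarrow> 0"
    by (rule tendsto_add_zero) (use a b in \<open>simp_all add: LIM_zero_iff tendsto_norm_zero\<close>)
  then have "(\<lambda>n. X n - Unitization a b) \<longlonglongrightarrow> 0"
    by (rule Lim_null_comparison[rotated])
      (use norm_le_parts[of "X _ - Unitization a b"] in \<open>auto simp: unitization_defs\<close>)
  then show "convergent X" by (auto simp: LIM_zero_iff convergent_def)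
qed

end

lemma unitization_embedding:
  fixes a b :: "'a::cstar_algebra"
  shows "Unitization 0 a * Unitization 0 b = Unitization 0 (a * b)"
    "star (Unitization 0 a) = Unitization 0 (star a)"
    "Unitization 0 a + Unitization 0 b = Unitization 0 (a + b)"
    "Unitization 0 a - Unitization 0 b = Unitization 0 (a - b)"
  by (simp_all add: unitization_defs star_unitization_def)

lemma norm_unitization_embedding: "norm (Unitization 0 (a::'a::cstar_algebra)) = norm a"
proof (rule antisym)
  show "norm (Unitization 0 a) \<le> norm a" using norm_le_parts[of "Unitization 0 a"] by simp
  show "norm a \<le> norm (Unitization 0 a)"
  proof (cases "a = 0")
    case False
    have "norm a * norm a \<le> norm (Unitization 0 a) * norm a"
      using norm_unit_mult_le[of "Unitization 0 a" "star a"] 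
      by (simp add: unit_mult_def norm_mult_star power2_eq_square)
    then show ?thesis using False by simp
  qed simp
qed

lemma norm_star_mult_self_le:
  fixes c d :: "'a::cstar_algebra"
  shows "norm (star c * c) \<le> norm (star c * c + star d * d)"
  using norm_star_mult_self_le_unital[of "Unitization 0 c" "Unitization 0 d"]
  by (simp add: unitization_embedding norm_unitization_embedding)

text \<open>With g = l + a from the unitization, c g = l c + c a lies in the original algebra, which
  is an ideal.\<close>

lemma approximate_factorization:
  fixes c :: "'a::cstar_algebra"
  assumes "0 < e"
  obtains l a where "norm (c - (cscale l c + c * a) * (star c * c)) < e"
proof -
  have "0 < (e/2)\<^sup>2" using assms by simp
  then obtain g where g: "(norm (Unitization 0 c - Unitization 0 c * g * (star (Unitization 0 c) * Unitization 0 c)))\<^sup>2 \<le> (e/2)\<^sup>2"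
    by (rule resolvent_approximation)
  have "Unitization 0 c * g = Unitization 0 (cscale (scalar_part g) c + c * vector_part g)"
    by (simp add: unitization_defs)
  with g have "(norm (c - (cscale (scalar_part g) c + c * vector_part g) * (star c * c)))\<^sup>2 \<le> (e/2)\<^sup>2"
    by (simp add: unitization_embedding norm_unitization_embedding)
  then have "norm (c - (cscale (scalar_part g) c + c * vector_part g) * (star c * c)) \<le> e / 2"
    using assms by (simp add: abs_le_square_iff[symmetric])
  then show ?thesis using assms by (intro that[of "scalar_part g" "vector_part g"]) simp
qed

section \<open>Hilbert modules and adjointable operators\<close>

context hilbert_module
begin

lemma hsub_closed: "\<lbrakk>x \<in> car X; y \<in> car X\<rbrakk> \<Longrightarrow> hsub X x y \<in> car X"
  by (simp add: hsub_def add_closed scl_closed)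

lemmas closed = zro_closed add_closed scl_closed act_closed hsub_closed

lemma ip_hsub: "\<lbrakk>x \<in> car X; y \<in> car X; z \<in> car X\<rbrakk> \<Longrightarrow> ip X x (hsub X y z) = ip X x y - ip X x z"
  by (simp add: hsub_def ip_add ip_scl scl_closed)

lemma ip_zro: "x \<in> car X \<Longrightarrow> ip X x (zro X) = 0"
  by (metis ip_hsub hsub_def add_neg zro_closed diff_self)

lemma ip_add_left:
  assumes "x \<in> car X" "y \<in> car X" "z \<in> car X"
  shows "ip X (add X x y) z = ip X x z + ip X y z"
proof -
  have "ip X (add X x y) z = star (ip X z (add X x y))" using assms by (simp add: ip_star closed)
  also have "\<dots> = star (ip X z x) + star (ip X z y)" using assms by (simp add: ip_add star_add)
  finally show ?thesis using assms by (simp add: ip_star)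
qed

lemma ip_scl_left:
  assumes "x \<in> car X" "y \<in> car X"
  shows "ip X (scl X c x) y = cscale (cnj c) (ip X x y)"
proof -
  have "ip X (scl X c x) y = star (ip X y (scl X c x))" using assms by (simp add: ip_star closed)
  also have "\<dots> = cscale (cnj c) (star (ip X y x))" using assms by (simp add: ip_scl star_cscale)
  finally show ?thesis using assms by (simp add: ip_star)
qed

lemma ip_act_left:
  assumes "x \<in> car X" "y \<in> car X"
  shows "ip X (act X x a) y = star a * ip X x y"
proof -
  have "ip X (act X x a) y = star (ip X y (act X x a))" using assms by (simp add: ip_star closed)
  also have "\<dots> = star a * star (ip X y x)" using assms by (simp add: ip_act star_mult)
  finally show ?thesis using assms by (simp add: ip_star)
qed

lemma ip_hsub_left:
  assumes "x \<in> car X" "y \<in> car X" "z \<in> car X"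
  shows "ip X (hsub X x y) z = ip X x z - ip X y z"
proof -
  have "ip X (hsub X x y) z = star (ip X z (hsub X x y))" using assms by (simp add: ip_star closed)
  also have "\<dots> = star (ip X z x) - star (ip X z y)" using assms by (simp add: ip_hsub star_diff)
  finally show ?thesis using assms by (simp add: ip_star)
qed

lemma ip_zro_left: "x \<in> car X \<Longrightarrow> ip X (zro X) x = 0"
  using ip_star[of x "zro X"] by (simp add: ip_zro zro_closed)

lemmas ip_simps = ip_add ip_scl ip_act ip_hsub ip_zro
  ip_add_left ip_scl_left ip_act_left ip_hsub_left ip_zro_left

lemma add_hsub: "\<lbrakk>x \<in> car X; y \<in> car X\<rbrakk> \<Longrightarrow> add X (hsub X x y) y = x"
  by (simp add: hsub_def add_assoc add_commute[of "scl X (- 1) y"] add_neg add_zro scl_closed)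

lemma eq_if_hsub_zro: "\<lbrakk>x \<in> car X; y \<in> car X; hsub X x y = zro X\<rbrakk> \<Longrightarrow> x = y"
  using add_hsub[of x y] add_commute[of "zro X" y] add_zro[of y] by (simp add: zro_closed)

text \<open>The main device for module identities: comparing inner products turns them into
  identities in the algebra, where the simplifier can work with a type class.\<close>

lemma eq_by_ip:
  assumes "x \<in> car X" "y \<in> car X" "\<And>z. z \<in> car X \<Longrightarrow> ip X z x = ip X z y"
  shows "x = y"
  by (rule eq_if_hsub_zro[OF assms(1,2) ip_definite]) (simp_all add: assms ip_hsub hsub_closed)

lemma hnorm_nonneg: "0 \<le> hnorm X x"
  by (simp add: hnorm_def)

lemma hnorm_square: "(hnorm X x)\<^sup>2 = norm (ip X x x)"
  by (simp add: hnorm_def)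

lemma hnorm_zro: "hnorm X (zro X) = 0"
  by (simp add: hnorm_def ip_zro zro_closed)

lemma hnorm_eq_0: "\<lbrakk>x \<in> car X; hnorm X x = 0\<rbrakk> \<Longrightarrow> x = zro X"
  by (rule ip_definite) (simp_all add: hnorm_def)

lemma hnorm_scl: "x \<in> car X \<Longrightarrow> hnorm X (scl X c x) = cmod c * hnorm X x"
  by (simp add: hnorm_def ip_simps scl_closed cscale_cscale norm_cscale norm_mult real_sqrt_mult)

lemma hnorm_act_le: 
  assumes "x \<in> car X"
  shows "hnorm X (act X x a) \<le> hnorm X x * norm a"
proof -
  have "norm (star a * (ip X x x * a)) \<le> norm (star a) * (norm (ip X x x) * norm a)"
    by (intro order_trans[OF norm_mult_ineq] mult_left_mono norm_mult_ineq norm_ge_zero)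
  then have "(hnorm X (act X x a))\<^sup>2 \<le> (hnorm X x * norm a)\<^sup>2"
    using assms by (simp add: hnorm_square power_mult_distrib ip_simps act_closed power2_eq_square[of "norm a"] mult_ac)
  then show ?thesis by (rule power2_le_imp_le) (simp add: hnorm_nonneg)
qed

text \<open>The element \<open>x - y t \<langle>y, x\<rangle>\<close> with \<open>t = 1 / \<parallel>y\<parallel>\<^sup>2\<close> yields the estimate.\<close>

lemma Cauchy_Schwarz:
  assumes x: "x \<in> car X" and y: "y \<in> car X"
  shows "norm (ip X x y) \<le> hnorm X x * hnorm X y"
proof (cases "hnorm X y = 0")
  case True
  then have "y = zro X" using y by (rule hnorm_eq_0[rotated])
  then show ?thesis using x by (simp add: ip_zro hnorm_zro)
next
  case False
  define t where "t = 1 / (hnorm X y)\<^sup>2"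
  have t: "0 < t" "t * (hnorm X y)\<^sup>2 = 1" using False by (simp_all add: t_def)
  define c where "c = ip X y x"
  have sc: "star c = ip X x y" using x y by (simp add: c_def ip_star)
  define w where "w = hsub X x (act X y (t *\<^sub>R c))"
  have "w \<in> car X" using x y by (simp add: w_def closed)
  then obtain d where d: "ip X w w = star d * d" using ip_pos by (auto simp: cstar_pos_def)
  \<comment> \<open>The cross terms contribute -2 t \<open>star c * c\<close> to
    \<open>ip X w w\<close>. Moved to the other side they become \<open>star c' * c'\<close>, and
    monotonicity of the norm then discards \<open>ip X w w\<close> =
    \<open>star d * d\<close>.\<close>
  define c' where "c' = sqrt (2 * t) *\<^sub>R c"
  have c': "star c' * c' = (2 * t) *\<^sub>R (star c * c)" using t by (simp add: c'_def star_scaleR)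
  have "ip X w w = ip X x x - (2 * t) *\<^sub>R (star c * c) + t\<^sup>2 *\<^sub>R (star c * (ip X y y * c))"
    using x y by (simp add: w_def closed ip_simps sc star_scaleR mult.assoc c_def[symmetric] power2_eq_square
        right_diff_distrib scaleR_2[symmetric] algebra_simps flip: scaleR_left_distrib)
  then have "star c' * c' + star d * d = ip X x x + t\<^sup>2 *\<^sub>R (star c * (ip X y y * c))"
    by (simp add: c' d[symmetric])
  then have "norm (star c' * c') \<le> norm (ip X x x + t\<^sup>2 *\<^sub>R (star c * (ip X y y * c)))"
    using norm_star_mult_self_le[of c' d] by simp
  also have "\<dots> \<le> norm (ip X x x) + norm (t\<^sup>2 *\<^sub>R (star c * (ip X y y * c)))" by (rule norm_triangle_ineq)
  also have "norm (t\<^sup>2 *\<^sub>R (star c * (ip X y y * c))) \<le> t\<^sup>2 * (norm c * (norm (ip X y y) * norm c))"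
    unfolding norm_scaleR abs_power2
    by (intro mult_left_mono order_trans[OF norm_mult_ineq] norm_mult_ineq) (simp_all add: norm_mult_ineq mult_left_mono)
  finally have "2 * (t * (norm c)\<^sup>2) \<le> norm (ip X x x) + t\<^sup>2 * (norm c * (norm (ip X y y) * norm c))"
    using t by (simp add: c' cstar_identity)
  also have "t\<^sup>2 * (norm c * (norm (ip X y y) * norm c)) = (t * (hnorm X y)\<^sup>2) * (t * (norm c)\<^sup>2)"
    unfolding hnorm_square by (simp add: power2_eq_square)
  finally have "t * (norm c)\<^sup>2 \<le> (hnorm X x)\<^sup>2" using t(2) by (simp add: hnorm_square)
  then have "(norm c)\<^sup>2 \<le> (hnorm X x * hnorm X y)\<^sup>2" using False by (simp add: t_def field_simps)
  then have "norm c \<le> hnorm X x * hnorm X y" by (rule power2_le_imp_le) (simp add: hnorm_nonneg)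
  then show ?thesis by (simp add: sc[symmetric])
qed

lemma hnorm_triangle:
  assumes "x \<in> car X" "y \<in> car X"
  shows "hnorm X (add X x y) \<le> hnorm X x + hnorm X y"
proof (rule power2_le_imp_le)
  have "ip X (add X x y) (add X x y) = (ip X x x + ip X x y) + (ip X y x + ip X y y)"
    using assms by (simp add: ip_simps add_closed)
  then have "norm (ip X (add X x y) (add X x y))
      \<le> (norm (ip X x x) + norm (ip X x y)) + (norm (ip X y x) + norm (ip X y y))"
    by (simp only:) (intro norm_triangle_le add_mono norm_triangle_ineq)
  also have "\<dots> \<le> ((hnorm X x)\<^sup>2 + hnorm X x * hnorm X y) + (hnorm X y * hnorm X x + (hnorm X y)\<^sup>2)"
    using assms by (intro add_mono Cauchy_Schwarz) (simp_all add: hnorm_square)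
  finally show "(hnorm X (add X x y))\<^sup>2 \<le> (hnorm X x + hnorm X y)\<^sup>2"
    by (simp add: hnorm_square power2_sum algebra_simps)
qed (simp add: hnorm_nonneg)

lemma hnorm_hsub_commute:
  assumes "x \<in> car X" "y \<in> car X"
  shows "hnorm X (hsub X x y) = hnorm X (hsub X y x)"
  using assms by (simp add: hnorm_def ip_simps hsub_closed algebra_simps)

lemma hsub_self: "x \<in> car X \<Longrightarrow> hsub X x x = zro X"
  by (simp add: hsub_def add_neg)

lemma hsub_zro: "x \<in> car X \<Longrightarrow> hsub X x (zro X) = x"
  by (rule eq_by_ip) (simp_all add: closed ip_simps)

lemma hnorm_hsub_triangle:
  assumes "x \<in> car X" "y \<in> car X" "z \<in> car X"
  shows "hnorm X (hsub X x z) \<le> hnorm X (hsub X x y) + hnorm X (hsub X y z)"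
proof -
  have "hsub X x z = add X (hsub X x y) (hsub X y z)"
    by (rule eq_by_ip) (use assms in \<open>simp_all add: closed ip_simps\<close>)
  then show ?thesis using hnorm_triangle assms by (simp add: hsub_closed)
qed

lemma hnorm_le_add_hsub:
  assumes "x \<in> car X" "y \<in> car X"
  shows "hnorm X x \<le> hnorm X y + hnorm X (hsub X x y)"
  using hnorm_hsub_triangle[of x y "zro X"] assms by (simp add: hsub_zro zro_closed)

lemma hnorm_le_by_ip:
  assumes "x \<in> car X" "norm (ip X x x) \<le> B * hnorm X x" "0 \<le> B"
  shows "hnorm X x \<le> B"
proof (cases "hnorm X x = 0")
  case False
  then have "0 < hnorm X x" using hnorm_nonneg[of x] by simp
  then show ?thesis using assms(2) by (simp add: hnorm_square[symmetric] power2_eq_square)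
qed (simp add: assms)

end

section \<open>Adjointable operators and their boundedness\<close>

definition is_adjoint ::
    "('a::cstar_algebra, 'x) hmod \<Rightarrow> ('a, 'y) hmod \<Rightarrow> ('x \<Rightarrow> 'y) \<Rightarrow> ('y \<Rightarrow> 'x) \<Rightarrow> bool" where
  "is_adjoint X Y T S \<longleftrightarrow> S \<in> adjointables Y X \<and> (\<forall>x\<in>car X. \<forall>y\<in>car Y. ip Y (T x) y = ip X x (S y))"

locale hilbert_pair = X: hilbert_module X + Y: hilbert_module Y
  for X :: "('a::cstar_algebra, 'x) hmod" and Y :: "('a, 'y) hmod"
begin

lemma adjointable_closed: "\<lbrakk>T \<in> adjointables X Y; x \<in> car X\<rbrakk> \<Longrightarrow> T x \<in> car Y"
  by (auto simp: adjointables_def)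

lemma adjointable_undefined: "\<lbrakk>T \<in> adjointables X Y; x \<notin> car X\<rbrakk> \<Longrightarrow> T x = undefined"
  by (auto simp: adjointables_def PiE_def extensional_def)

lemma ip_adjoint:
  assumes "T \<in> adjointables X Y" "is_adjoint X Y T S" "x \<in> car X" "y \<in> car Y"
  shows "ip Y (T x) y = ip X x (S y)" "ip Y y (T x) = ip X (S y) x"
proof -
  show l: "ip Y (T x) y = ip X x (S y)" using assms by (simp add: is_adjoint_def)
  have "S y \<in> car X" using assms by (auto simp: is_adjoint_def adjointables_def)
  then show "ip Y y (T x) = ip X (S y) x"
    using arg_cong[OF l, of star] assms by (simp add: X.ip_star Y.ip_star adjointable_closed)
qed

lemma adjoint_closed: "\<lbrakk>is_adjoint X Y T S; y \<in> car Y\<rbrakk> \<Longrightarrow> S y \<in> car X"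
  by (auto simp: is_adjoint_def adjointables_def)

lemma adjoint_exists:
  assumes T: "T \<in> adjointables X Y"
  obtains S where "is_adjoint X Y T S"
proof -
  from T obtain S where S: "S \<in> car Y \<rightarrow>\<^sub>E car X"
    and TS: "\<forall>x\<in>car X. \<forall>y\<in>car Y. ip Y (T x) y = ip X x (S y)"
    unfolding adjointables_def by blast
  have "ip X (S y) x = ip Y y (T x)" if "x \<in> car X" "y \<in> car Y" for x y
    using arg_cong[OF TS[rule_format, OF that], of star] that S
    by (simp add: X.ip_star Y.ip_star adjointable_closed[OF T] PiE_mem[OF S])
  moreover have "T \<in> car X \<rightarrow>\<^sub>E car Y" using T by (simp add: adjointables_def)
  ultimately have "S \<in> adjointables Y X" unfolding adjointables_def using S by blast
  with TS show ?thesis by (intro that[of S]) (simp add: is_adjoint_def)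
qed

lemma adjointablesI:
  assumes "\<And>x. x \<in> car X \<Longrightarrow> T x \<in> car Y" "T \<in> extensional (car X)" "\<And>y. y \<in> car Y \<Longrightarrow> S y \<in> car X"
    "\<And>x y. \<lbrakk>x \<in> car X; y \<in> car Y\<rbrakk> \<Longrightarrow> ip Y (T x) y = ip X x (S y)"
  shows "T \<in> adjointables X Y"
proof -
  have "restrict S (car Y) \<in> car Y \<rightarrow>\<^sub>E car X" using assms(3) by auto
  moreover have "\<forall>x\<in>car X. \<forall>y\<in>car Y. ip Y (T x) y = ip X x (restrict S (car Y) y)" using assms(4) by simp
  ultimately show ?thesis using assms(1,2) unfolding adjointables_def by (blast intro: PiE_I dest: extensional_arb)
qed

lemma adjointable_eqI:
  assumes "T \<in> adjointables X Y" "S \<in> adjointables X Y" "\<And>x. x \<in> car X \<Longrightarrow> T x = S x"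
  shows "T = S"
  using assms adjointable_undefined by (metis ext)

text \<open>Membership in \<open>adjointables\<close> asserts nothing about linearity. Each law
  holds because both sides have the same inner product with every element of Y once T is moved
  across by its adjoint.\<close>

lemma adjointable_linear:
  assumes T: "T \<in> adjointables X Y"
  shows "\<lbrakk>x \<in> car X; x' \<in> car X\<rbrakk> \<Longrightarrow> T (add X x x') = add Y (T x) (T x')"
    "x \<in> car X \<Longrightarrow> T (scl X c x) = scl Y c (T x)"
    "x \<in> car X \<Longrightarrow> T (act X x a) = act Y (T x) a"
    "\<lbrakk>x \<in> car X; x' \<in> car X\<rbrakk> \<Longrightarrow> T (hsub X x x') = hsub Y (T x) (T x')"
    "T (zro X) = zro Y"
proof -
  obtain S where "is_adjoint X Y T S" using adjoint_exists[OF T] .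
  note S = adjoint_closed[OF this] ip_adjoint[OF T this]
  note simps = X.closed Y.closed adjointable_closed[OF T] S(1,3) X.ip_simps Y.ip_simps
  show "\<lbrakk>x \<in> car X; x' \<in> car X\<rbrakk> \<Longrightarrow> T (add X x x') = add Y (T x) (T x')"
    "x \<in> car X \<Longrightarrow> T (scl X c x) = scl Y c (T x)"
    "x \<in> car X \<Longrightarrow> T (act X x a) = act Y (T x) a"
    "\<lbrakk>x \<in> car X; x' \<in> car X\<rbrakk> \<Longrightarrow> T (hsub X x x') = hsub Y (T x) (T x')"
    "T (zro X) = zro Y"
    by (rule Y.eq_by_ip; simp add: simps)+
qed

text \<open>
  Uniform boundedness by a gliding hump: \<open>l\<close> is the limit of points chosen so that the functionals
  \<open>\<langle>T (x n), _\<rangle>\<close>, which are pointwise bounded because \<open>T\<close> has an adjoint, grow on \<open>l\<close>.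
\<close>

lemma adjointable_bounded:
  assumes T: "T \<in> adjointables X Y"
  obtains C where "0 \<le> C" "\<And>x. x \<in> car X \<Longrightarrow> hnorm Y (T x) \<le> C * hnorm X x"
proof (rule ccontr)
  note bounded = that
  assume "\<not> thesis"
  then have unb: "\<exists>x\<in>car X. C * hnorm X x < hnorm Y (T x)" if "0 \<le> C" for C
    using bounded[OF that] by (meson not_le)
  obtain S where "is_adjoint X Y T S" using adjoint_exists[OF T] .
  note S = adjoint_closed[OF this] ip_adjoint[OF T this]
  note Tc = adjointable_closed[OF T]
  \<comment> \<open>The rate 4^n is chosen to outgrow the step lengths 3^-n used below.\<close>
  have "\<exists>x\<in>car X. hnorm X x = 1 \<and> 4 ^ n < hnorm Y (T x)" for n :: nat
  proof -
    obtain x where x: "x \<in> car X" "4 ^ n * hnorm X x < hnorm Y (T x)" using unb[of "4 ^ n"] by auto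
    have "hnorm X x \<noteq> 0"
    proof
      assume "hnorm X x = 0"
      then have "x = zro X" using x(1) by (rule X.hnorm_eq_0[rotated])
      then show False using x(2) by (simp add: adjointable_linear(5)[OF T] X.hnorm_zro Y.hnorm_zro)
    qed
    then have p: "0 < hnorm X x" using X.hnorm_nonneg[of x] by simp
    define r where "r = 1 / hnorm X x"
    have r: "0 < r" "r * hnorm X x = 1" using p by (simp_all add: r_def)
    have "hnorm X (scl X (complex_of_real r) x) = 1" using x r by (simp add: X.hnorm_scl)
    moreover have "hnorm Y (T (scl X (complex_of_real r) x)) = r * hnorm Y (T x)"
      using x r Tc by (simp add: adjointable_linear(2)[OF T] Y.hnorm_scl)
    moreover have "4 ^ n < r * hnorm Y (T x)"
    proof -
      have "r * (4 ^ n * hnorm X x) = 4 ^ n * (r * hnorm X x)" by (rule mult.left_commute)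
      also have "\<dots> = 4 ^ n" by (simp only: r(2) mult_1_right)
      finally have e: "r * (4 ^ n * hnorm X x) = 4 ^ n" .
      show ?thesis using mult_strict_left_mono[OF x(2) r(1)] unfolding e .
    qed
    ultimately show ?thesis using x(1) X.scl_closed by metis
  qed
  then obtain u where u: "\<And>n. u n \<in> car X" "\<And>n. hnorm X (u n) = 1" "\<And>n. 4 ^ n < hnorm Y (T (u n))"
    by metis
  \<comment> \<open>For z of length 3^-n in the direction of T (u n), the pairings of T (u n) with y
    + z and y - z differ by twice its pairing with z. So one of them has at least the norm of the
    latter.\<close>
  have step: "\<exists>y'\<in>car Y. hnorm Y (hsub Y y' y) \<le> (1/3) ^ n \<and>
      (1/3) ^ n * hnorm Y (T (u n)) \<le> norm (ip Y (T (u n)) y')" if y: "y \<in> car Y" for y n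
  proof -
    define N where "N = hnorm Y (T (u n))"
    have N: "0 < N" unfolding N_def by (rule less_trans[OF _ u(3)]) simp
    define z where "z = scl Y (complex_of_real ((1/3) ^ n / N)) (T (u n))"
    have z: "z \<in> car Y" using u Tc by (simp add: z_def Y.closed)
    have nz: "hnorm Y z = (1/3) ^ n"
      using u Tc N by (simp add: z_def Y.hnorm_scl norm_mult norm_divide norm_power N_def[symmetric])
    have Lz: "norm (ip Y (T (u n)) z) = (1/3) ^ n * N"
      using u Tc N by (simp add: z_def Y.ip_simps norm_cscale Y.hnorm_square[symmetric] N_def[symmetric]
          norm_mult norm_divide norm_power power2_eq_square)
    have "2 *\<^sub>R ip Y (T (u n)) z = ip Y (T (u n)) (add Y y z) - ip Y (T (u n)) (hsub Y y z)"
      using u Tc y z by (simp add: Y.ip_simps scaleR_2)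
    then have "2 * norm (ip Y (T (u n)) z) \<le> norm (ip Y (T (u n)) (add Y y z)) + norm (ip Y (T (u n)) (hsub Y y z))"
      using norm_triangle_ineq4[of "ip Y (T (u n)) (add Y y z)" "ip Y (T (u n)) (hsub Y y z)"]
      by (metis abs_numeral norm_scaleR)
    then consider "(1/3) ^ n * N \<le> norm (ip Y (T (u n)) (add Y y z))"
      | "(1/3) ^ n * N \<le> norm (ip Y (T (u n)) (hsub Y y z))" unfolding Lz by linarith
    then show ?thesis
    proof cases
      case 1
      have "hsub Y (add Y y z) y = z" by (rule Y.eq_by_ip) (use y z in \<open>simp_all add: Y.closed Y.ip_simps\<close>)
      then show ?thesis using 1 y z nz by (intro bexI[of _ "add Y y z"]) (simp_all add: Y.closed N_def)
    next
      case 2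
      have "hsub Y (hsub Y y z) y = scl Y (-1) z"
        by (rule Y.eq_by_ip) (use y z in \<open>simp_all add: Y.closed Y.ip_simps\<close>)
      then show ?thesis using 2 y z nz by (intro bexI[of _ "hsub Y y z"]) (simp_all add: Y.closed N_def Y.hnorm_scl)
    qed
  qed
  then obtain g where g: "\<And>y n. y \<in> car Y \<Longrightarrow> g y n \<in> car Y"
    "\<And>y n. y \<in> car Y \<Longrightarrow> hnorm Y (hsub Y (g y n) y) \<le> (1/3) ^ n"
    "\<And>y n. y \<in> car Y \<Longrightarrow> (1/3) ^ n * hnorm Y (T (u n)) \<le> norm (ip Y (T (u n)) (g y n))"
    by metis
  define w where "w = rec_nat (zro Y) (\<lambda>n y. g y n)"
  have wS: "w (Suc n) = g (w n) n" for n by (simp add: w_def)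
  have wc: "w n \<in> car Y" for n by (induction n) (simp_all add: wS g, simp add: w_def Y.closed)
  have wd: "hnorm Y (hsub Y (w (n + k)) (w n)) \<le> (3/2) * ((1/3) ^ n - (1/3) ^ (n + k))" for n k
  proof (induction k)
    case 0
    show ?case using wc by (simp add: Y.hsub_self Y.hnorm_zro)
  next
    case (Suc k)
    have "hnorm Y (hsub Y (w (n + Suc k)) (w n))
        \<le> hnorm Y (hsub Y (w (Suc (n + k))) (w (n + k))) + hnorm Y (hsub Y (w (n + k)) (w n))"
      using Y.hnorm_hsub_triangle[OF wc wc wc] by simp
    also have "\<dots> \<le> (1/3) ^ (n + k) + (3/2) * ((1/3) ^ n - (1/3) ^ (n + k))"
      using g(2)[OF wc] Suc by (intro add_mono) (simp_all add: wS)
    also have "\<dots> = (3/2) * ((1/3) ^ n - (1/3) ^ (n + Suc k))" by (simp add: algebra_simps)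
    finally show ?case .
  qed
  have wle: "hnorm Y (hsub Y (w m) (w n)) \<le> (3/2) * (1/3) ^ n" if le: "n \<le> m" for m n
  proof -
    obtain k where m: "m = n + k" using le_Suc_ex[OF le] by auto
    have "0 \<le> (1/3::real) ^ (n + k)" by simp
    then show ?thesis using wd[of n k] unfolding m by (simp only: right_diff_distrib)
  qed
  have "\<exists>l\<in>car Y. (\<lambda>n. hnorm Y (hsub Y (w n) l)) \<longlonglongrightarrow> 0"
  proof (rule Y.complete)
    show "\<forall>n. w n \<in> car Y" using wc by blast
    show "\<forall>e>0. \<exists>N. \<forall>m\<ge>N. \<forall>n\<ge>N. hnorm Y (hsub Y (w m) (w n)) < e"
    proof (intro allI impI)
      fix e :: real assume "0 < e"
      then obtain N where N: "(1/3::real) ^ N < e / 3" using real_arch_pow_inv[of "e/3" "1/3"] by auto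
      have "hnorm Y (hsub Y (w m) (w n)) < e" if "N \<le> m" "N \<le> n" for m n
        using Y.hnorm_hsub_triangle[OF wc[of m] wc[of N] wc[of n]] wle[OF that(1)] wle[OF that(2)] N
          Y.hnorm_hsub_commute[OF wc[of N] wc[of n]] by linarith
      then show "\<exists>N. \<forall>m\<ge>N. \<forall>n\<ge>N. hnorm Y (hsub Y (w m) (w n)) < e" by blast
    qed
  qed
  then obtain l where l: "l \<in> car Y" "(\<lambda>n. hnorm Y (hsub Y (w n) l)) \<longlonglongrightarrow> 0" by blast
  have wl: "hnorm Y (hsub Y l (w n)) \<le> (3/2) * (1/3) ^ n" for n
  proof (rule field_le_epsilon)
    fix e :: real assume "0 < e"
    then have "eventually (\<lambda>m. hnorm Y (hsub Y (w m) l) < e) sequentially" using l(2) by (rule order_tendstoD(2)[rotated])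
    then obtain M where M: "\<And>m. M \<le> m \<Longrightarrow> hnorm Y (hsub Y (w m) l) < e" by (auto simp: eventually_sequentially)
    define m where "m = max M n"
    show "hnorm Y (hsub Y l (w n)) \<le> (3/2) * (1/3) ^ n + e"
      using Y.hnorm_hsub_triangle[OF l(1) wc[of m] wc[of n]] wle[of n m] M[of m]
        Y.hnorm_hsub_commute[OF l(1) wc[of m]] by (simp add: m_def)
  qed
  \<comment> \<open>All steps after step n together move the sequence by at most (3/2) 3^-(n+1),
    half of 3^-n. So half of the pairing gained at step n survives at \<open>l\<close>, while the
    adjoint bounds it by \<parallel>S l\<parallel>.\<close>
  have "(4/3) ^ n \<le> 2 * hnorm X (S l)" for n :: nat
  proof -
    define N where "N = hnorm Y (T (u n))"
    have Tu: "T (u n) \<in> car Y" using u Tc by simp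
    have "ip Y (T (u n)) (w (Suc n)) = ip Y (T (u n)) l - ip Y (T (u n)) (hsub Y l (w (Suc n)))"
      using Tu l wc by (simp add: Y.ip_simps)
    then have "norm (ip Y (T (u n)) (w (Suc n))) \<le> norm (ip Y (T (u n)) l) + norm (ip Y (T (u n)) (hsub Y l (w (Suc n))))"
      by (simp only: norm_triangle_ineq4)
    also have "norm (ip Y (T (u n)) (hsub Y l (w (Suc n)))) \<le> N * ((3/2) * (1/3) ^ Suc n)"
    proof -
      have "norm (ip Y (T (u n)) (hsub Y l (w (Suc n)))) \<le> N * hnorm Y (hsub Y l (w (Suc n)))"
        unfolding N_def using Tu l wc by (intro Y.Cauchy_Schwarz) (simp_all add: Y.closed)
      also have "\<dots> \<le> N * ((3/2) * (1/3) ^ Suc n)" by (intro mult_left_mono wl) (simp add: N_def Y.hnorm_nonneg)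
      finally show ?thesis .
    qed
    also have "norm (ip Y (T (u n)) l) \<le> hnorm X (S l)"
      using X.Cauchy_Schwarz[OF u(1) S(1)[OF l(1)], of n] by (simp add: S(2) u l)
    finally have "(1/3) ^ n * N \<le> hnorm X (S l) + N * ((3/2) * (1/3) ^ Suc n)"
      using g(3)[OF wc, of n n] by (simp add: wS N_def)
    then have "(1/3) ^ n * N \<le> 2 * hnorm X (S l)" by (simp add: mult.commute[of N])
    moreover have "(1/3) ^ n * 4 ^ n \<le> (1/3) ^ n * N" using u(3)[of n] by (intro mult_left_mono) (simp_all add: N_def)
    moreover have "(1/3) ^ n * 4 ^ n = (4/3 :: real) ^ n" by (simp flip: power_mult_distrib)
    ultimately show ?thesis by simp
  qed
  moreover obtain n where "2 * hnorm X (S l) < (4/3) ^ n" using real_arch_pow[of "4/3"] by auto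
  ultimately show False by (meson not_le)
qed

end

section \<open>The operator norm and the algebra of operators\<close>

context hilbert_pair
begin

lemma op_norm_bdd_above:
  assumes "T \<in> adjointables X Y"
  shows "bdd_above ((\<lambda>x. hnorm Y (T x)) ` {x \<in> car X. hnorm X x \<le> 1})"
proof -
  obtain C where C: "0 \<le> C" "\<And>x. x \<in> car X \<Longrightarrow> hnorm Y (T x) \<le> C * hnorm X x"
    using adjointable_bounded[OF assms] by metis
  have "hnorm Y (T x) \<le> C" if "x \<in> car X" "hnorm X x \<le> 1" for x
    using C(2)[OF that(1)] mult_left_le[OF that(2) C(1)] by simp
  then show ?thesis by (auto intro!: bdd_aboveI2)
qed

lemma op_norm_nonneg:
  assumes "T \<in> adjointables X Y"
  shows "0 \<le> op_norm X Y T"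
proof -
  have "hnorm Y (T (zro X)) \<le> op_norm X Y T"
    unfolding op_norm_def
    by (rule cSUP_upper[OF _ op_norm_bdd_above[OF assms]]) (simp add: X.closed X.hnorm_zro)
  then show ?thesis using Y.hnorm_nonneg order_trans by blast
qed

lemma hnorm_le_op_norm:
  assumes T: "T \<in> adjointables X Y" and x: "x \<in> car X"
  shows "hnorm Y (T x) \<le> op_norm X Y T * hnorm X x"
proof (cases "hnorm X x = 0")
  case True
  then have "x = zro X" using x by (rule X.hnorm_eq_0[rotated])
  then show ?thesis by (simp add: adjointable_linear(5)[OF T] X.hnorm_zro Y.hnorm_zro)
next
  case False
  then have p: "0 < hnorm X x" using X.hnorm_nonneg[of x] by simp
  define y where "y = scl X (complex_of_real (1 / hnorm X x)) x"
  have y: "y \<in> car X" "hnorm X y = 1" using x p by (simp_all add: y_def X.closed X.hnorm_scl norm_divide)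
  have "hnorm Y (T y) \<le> op_norm X Y T"
    unfolding op_norm_def by (rule cSUP_upper[OF _ op_norm_bdd_above[OF T]]) (simp add: y)
  moreover have "hnorm Y (T y) = hnorm Y (T x) / hnorm X x"
    using x p adjointable_closed[OF T x] by (simp add: y_def adjointable_linear(2)[OF T] Y.hnorm_scl norm_divide)
  ultimately show ?thesis using p by (simp add: divide_le_eq)
qed

lemma op_norm_le:
  assumes "0 \<le> C" "\<And>x. x \<in> car X \<Longrightarrow> hnorm Y (T x) \<le> C * hnorm X x"
  shows "op_norm X Y T \<le> C"
  unfolding op_norm_def
proof (rule cSUP_least)
  show "{x \<in> car X. hnorm X x \<le> 1} \<noteq> {}" using X.closed(1) X.hnorm_zro by force
  show "hnorm Y (T x) \<le> C" if "x \<in> {x \<in> car X. hnorm X x \<le> 1}" for x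
    using that assms(2)[of x] mult_left_le[OF _ assms(1), of "hnorm X x"] by simp
qed

lemma op_zero_adjointable: "op_zero X Y \<in> adjointables X Y"
  by (rule adjointablesI[where S="\<lambda>_. zro X"])
    (auto simp: op_zero_def X.closed Y.closed X.ip_simps Y.ip_simps)

lemma op_add_adjointable:
  assumes T: "T \<in> adjointables X Y" and S: "S \<in> adjointables X Y"
  shows "op_add X Y T S \<in> adjointables X Y"
proof -
  obtain T' where T': "is_adjoint X Y T T'" using adjoint_exists[OF T] .
  obtain S' where S': "is_adjoint X Y S S'" using adjoint_exists[OF S] .
  show ?thesis
    by (rule adjointablesI[where S="\<lambda>y. add X (T' y) (S' y)"])
      (auto simp: op_add_def X.closed Y.closed X.ip_simps Y.ip_simps adjointable_closed[OF T]
        adjointable_closed[OF S] adjoint_closed[OF T'] adjoint_closed[OF S']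
        ip_adjoint(1)[OF T T'] ip_adjoint(1)[OF S S'])
qed

lemma op_scl_adjointable:
  assumes T: "T \<in> adjointables X Y"
  shows "op_scl X Y c T \<in> adjointables X Y"
proof -
  obtain T' where T': "is_adjoint X Y T T'" using adjoint_exists[OF T] .
  show ?thesis
    by (rule adjointablesI[where S="\<lambda>y. scl X (cnj c) (T' y)"])
      (auto simp: op_scl_def X.closed Y.closed X.ip_simps Y.ip_simps adjointable_closed[OF T]
        adjoint_closed[OF T'] ip_adjoint(1)[OF T T'])
qed

lemma op_sub_eq: "op_sub X Y T S = op_add X Y T (op_scl X Y (-1) S)"
  by (auto simp: op_sub_def op_add_def op_scl_def hsub_def)

lemma op_sub_adjointable:
  "\<lbrakk>T \<in> adjointables X Y; S \<in> adjointables X Y\<rbrakk> \<Longrightarrow> op_sub X Y T S \<in> adjointables X Y"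
  by (simp add: op_sub_eq op_add_adjointable op_scl_adjointable)

lemma rank_one_adjointable:
  assumes "y \<in> car Y" "x \<in> car X"
  shows "rank_one X Y y x \<in> adjointables X Y"
  by (rule adjointablesI[where S="\<lambda>w. act X x (ip Y y w)"])
    (use assms in \<open>auto simp: rank_one_def X.closed Y.closed X.ip_simps Y.ip_simps X.ip_star\<close>)

lemma op_norm_add_le:
  assumes T: "T \<in> adjointables X Y" and S: "S \<in> adjointables X Y"
  shows "op_norm X Y (op_add X Y T S) \<le> op_norm X Y T + op_norm X Y S"
proof (rule op_norm_le)
  fix x assume x: "x \<in> car X"
  have "hnorm Y (op_add X Y T S x) \<le> hnorm Y (T x) + hnorm Y (S x)"
    using x adjointable_closed T S by (simp add: op_add_def Y.hnorm_triangle)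
  also have "\<dots> \<le> op_norm X Y T * hnorm X x + op_norm X Y S * hnorm X x"
    by (intro add_mono hnorm_le_op_norm T S x)
  finally show "hnorm Y (op_add X Y T S x) \<le> (op_norm X Y T + op_norm X Y S) * hnorm X x"
    by (simp add: distrib_right)
qed (simp add: op_norm_nonneg T S)

lemma op_norm_scl_le:
  assumes T: "T \<in> adjointables X Y"
  shows "op_norm X Y (op_scl X Y c T) \<le> cmod c * op_norm X Y T"
proof (rule op_norm_le)
  fix x assume x: "x \<in> car X"
  show "hnorm Y (op_scl X Y c T x) \<le> cmod c * op_norm X Y T * hnorm X x"
    using x adjointable_closed[OF T x] mult_left_mono[OF hnorm_le_op_norm[OF T x], of "cmod c"]
    by (simp add: op_scl_def Y.hnorm_scl mult.assoc)
qed (simp add: op_norm_nonneg T)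

lemma op_norm_rank_one_le:
  assumes "y \<in> car Y" "x \<in> car X"
  shows "op_norm X Y (rank_one X Y y x) \<le> hnorm Y y * hnorm X x"
proof (rule op_norm_le)
  fix z assume z: "z \<in> car X"
  have "hnorm Y (act Y y (ip X x z)) \<le> hnorm Y y * norm (ip X x z)" by (rule Y.hnorm_act_le) (rule assms)
  also have "\<dots> \<le> hnorm Y y * (hnorm X x * hnorm X z)"
    by (intro mult_left_mono X.Cauchy_Schwarz assms z Y.hnorm_nonneg)
  finally show "hnorm Y (rank_one X Y y x z) \<le> hnorm Y y * hnorm X x * hnorm X z"
    using z by (simp add: rank_one_def mult.assoc)
qed (simp add: X.hnorm_nonneg Y.hnorm_nonneg)

lemma op_norm_zero: "op_norm X Y (op_zero X Y) = 0"
  by (rule antisym[OF op_norm_le op_norm_nonneg[OF op_zero_adjointable]])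
    (simp_all add: op_zero_def Y.hnorm_zro)

end

lemma compose_adjointable:
  assumes "hilbert_module X" "hilbert_module Y" "hilbert_module Z"
    and T: "T \<in> adjointables X Y" and S: "S \<in> adjointables Y Z"
  shows "compose (car X) S T \<in> adjointables X Z"
proof -
  interpret XY: hilbert_pair X Y by (intro hilbert_pair.intro assms)
  interpret YZ: hilbert_pair Y Z by (intro hilbert_pair.intro assms)
  interpret XZ: hilbert_pair X Z by (intro hilbert_pair.intro assms)
  obtain T' where T': "is_adjoint X Y T T'" using XY.adjoint_exists[OF T] .
  obtain S' where S': "is_adjoint Y Z S S'" using YZ.adjoint_exists[OF S] .
  show ?thesis
    by (rule XZ.adjointablesI[where S="\<lambda>z. T' (S' z)"])
      (auto simp: compose_def XY.adjointable_closed[OF T] YZ.adjointable_closed[OF S]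
        XY.adjoint_closed[OF T'] YZ.adjoint_closed[OF S'] YZ.ip_adjoint(1)[OF S S'] XY.ip_adjoint(1)[OF T T'])
qed

lemma op_norm_compose_le:
  assumes "hilbert_module X" "hilbert_module Y" "hilbert_module Z"
    and T: "T \<in> adjointables X Y" and S: "S \<in> adjointables Y Z"
  shows "op_norm X Z (compose (car X) S T) \<le> op_norm Y Z S * op_norm X Y T"
proof -
  interpret XY: hilbert_pair X Y by (intro hilbert_pair.intro assms)
  interpret YZ: hilbert_pair Y Z by (intro hilbert_pair.intro assms)
  interpret XZ: hilbert_pair X Z by (intro hilbert_pair.intro assms)
  show ?thesis
  proof (rule XZ.op_norm_le)
    fix x assume x: "x \<in> car X"
    have "hnorm Z (S (T x)) \<le> op_norm Y Z S * hnorm Y (T x)"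
      by (intro YZ.hnorm_le_op_norm S XY.adjointable_closed[OF T x])
    also have "\<dots> \<le> op_norm Y Z S * (op_norm X Y T * hnorm X x)"
      by (intro mult_left_mono XY.hnorm_le_op_norm T x YZ.op_norm_nonneg S)
    finally show "hnorm Z (compose (car X) S T x) \<le> op_norm Y Z S * op_norm X Y T * hnorm X x"
      using x by (simp add: compose_def mult.assoc)
  qed (simp add: XY.op_norm_nonneg T YZ.op_norm_nonneg S)
qed

definition op_id :: "('a, 'x) hmod \<Rightarrow> 'x \<Rightarrow> 'x" where
  "op_id X = (\<lambda>x\<in>car X. x)"

lemma op_id_adjointable: "op_id X \<in> adjointables X X"
  unfolding adjointables_def op_id_def
  by (auto intro!: bexI[of _ "\<lambda>x\<in>car X. x"])

section \<open>Tensor products\<close>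

text \<open>Lets a bound with constant c be proved for each s > c. Such an s is positive even when c
  = 0 is a norm, and strict inequalities become available.\<close>

lemma le_mult_if_le_greater:
  fixes x y c :: real
  assumes "\<And>s. c < s \<Longrightarrow> x \<le> s * y" "0 \<le> y"
  shows "x \<le> c * y"
proof (cases "y = 0")
  case True
  then show ?thesis using assms(1)[of "c + 1"] by simp
next
  case False
  then have y: "0 < y" using assms(2) by simp
  have "x / y \<le> c" by (rule dense_ge) (use assms(1) y in \<open>simp add: divide_le_eq\<close>)
  then show ?thesis using y by (simp add: divide_le_eq)
qed

context hilbert_module
begin

lemma ip_diff_le:
  assumes "x \<in> car X" "x0 \<in> car X" "y \<in> car X" "y0 \<in> car X"
    and e: "hnorm X (hsub X x x0) \<le> e" "hnorm X (hsub X y y0) \<le> e" "e \<le> 1"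
  shows "norm (ip X x y - ip X x0 y0) \<le> e * (hnorm X x + hnorm X y + 1)"
proof -
  have e0: "0 \<le> e" using e(1) hnorm_nonneg order_trans by blast
  have "ip X x y - ip X x0 y0 = ip X (hsub X x x0) y + ip X x0 (hsub X y y0)"
    using assms(1-4) by (simp add: ip_simps)
  then have "norm (ip X x y - ip X x0 y0) \<le> norm (ip X (hsub X x x0) y) + norm (ip X x0 (hsub X y y0))"
    by (simp only: norm_triangle_ineq)
  also have "\<dots> \<le> e * hnorm X y + (hnorm X x + 1) * e"
  proof (rule add_mono)
    have "norm (ip X (hsub X x x0) y) \<le> hnorm X (hsub X x x0) * hnorm X y"
      by (rule Cauchy_Schwarz) (simp_all add: assms closed)
    then show "norm (ip X (hsub X x x0) y) \<le> e * hnorm X y"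
      by (rule order_trans) (simp add: e mult_right_mono hnorm_nonneg)
    have "hnorm X x0 \<le> hnorm X x + 1"
      using hnorm_le_add_hsub[OF assms(2,1)] hnorm_hsub_commute[OF assms(2,1)] e by simp
    moreover have "norm (ip X x0 (hsub X y y0)) \<le> hnorm X x0 * hnorm X (hsub X y y0)"
      by (rule Cauchy_Schwarz) (simp_all add: assms closed)
    ultimately show "norm (ip X x0 (hsub X y y0)) \<le> (hnorm X x + 1) * e"
      by (intro order_trans[OF _ mult_mono[OF _ e(2)]]) (simp_all add: hnorm_nonneg)
  qed
  finally show ?thesis by (simp add: algebra_simps)
qed

lemma eq_by_ip_left:
  assumes "x \<in> car X" "y \<in> car X" "\<And>z. z \<in> car X \<Longrightarrow> ip X x z = ip X y z"
  shows "x = y"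
proof (rule eq_by_ip[OF assms(1,2)])
  fix z assume z: "z \<in> car X"
  show "ip X z x = ip X z y"
    using arg_cong[OF assms(3)[OF z], of star] z assms(1,2) by (simp add: ip_star)
qed

lemma lin_span_closed:
  assumes "A \<subseteq> car X" "v \<in> lin_span (zro X) (add X) (scl X) A"
  shows "v \<in> car X"
  using assms(2)
proof induction
  case lin_span_zero
  show ?case by (rule zro_closed)
next
  case (lin_span_step s v c)
  then show ?case using assms(1) by (intro add_closed scl_closed) auto
qed

end

text \<open>The uniqueness behind \<open>tensor_map\<close>: the difference vanishes on the span by
  linearity and elsewhere by boundedness.\<close>

lemma (in hilbert_pair) adjointable_eq_on_dense:
  assumes T: "T \<in> adjointables X Y" and S: "S \<in> adjointables X Y"
    and A: "A \<subseteq> car X" "spans_densely X A" "\<And>x. x \<in> A \<Longrightarrow> T x = S x"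
  shows "T = S"
proof (rule adjointable_eqI[OF T S])
  fix x assume x: "x \<in> car X"
  define D where "D = op_sub X Y T S"
  have D: "D \<in> adjointables X Y" unfolding D_def by (rule op_sub_adjointable[OF T S])
  have D0: "D v = zro Y" if "v \<in> lin_span (zro X) (add X) (scl X) A" for v
    using that
  proof induction
    case lin_span_zero
    show ?case by (rule adjointable_linear(5)[OF D])
  next
    case (lin_span_step s v c)
    have s: "s \<in> car X" using lin_span_step A by auto
    have v: "v \<in> car X" by (rule X.lin_span_closed[OF A(1)]) (rule lin_span_step)
    have "D s = zro Y"
      using s A(3)[OF lin_span_step(1)] adjointable_closed[OF S s] by (simp add: D_def op_sub_def Y.hsub_self)
    moreover have "scl Y c (zro Y) = zro Y"
      by (rule Y.eq_by_ip) (simp_all add: Y.closed Y.ip_simps)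
    ultimately show ?case
      using s v lin_span_step by (simp add: adjointable_linear[OF D] X.closed Y.add_zro Y.closed)
  qed
  have small: "hnorm Y (D x) \<le> op_norm X Y D * e" if "0 < e" for e
  proof -
    obtain v where v: "v \<in> lin_span (zro X) (add X) (scl X) A" "hnorm X (hsub X x v) < e"
      using A(2) x \<open>0 < e\<close> by (auto simp: spans_densely_def)
    have vc: "v \<in> car X" by (rule X.lin_span_closed[OF A(1) v(1)])
    have "D x = D (hsub X x v)"
      using x vc adjointable_closed[OF D x] by (simp add: adjointable_linear(4)[OF D] D0[OF v(1)] Y.hsub_zro)
    then have "hnorm Y (D x) \<le> op_norm X Y D * hnorm X (hsub X x v)"
      using hnorm_le_op_norm[OF D, of "hsub X x v"] x vc by (simp add: X.closed)
    also have "\<dots> \<le> op_norm X Y D * e" by (intro mult_left_mono op_norm_nonneg[OF D]) (use v in simp)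
    finally show ?thesis .
  qed
  have "hnorm Y (D x) \<le> 0 * op_norm X Y D"
    by (rule le_mult_if_le_greater[OF _ op_norm_nonneg[OF D]]) (subst mult.commute, rule small)
  then have "hnorm Y (D x) = 0" using Y.hnorm_nonneg[of "D x"] by simp
  then have "D x = zro Y" using adjointable_closed[OF D x] by (rule Y.hnorm_eq_0[rotated])
  then have "hsub Y (T x) (S x) = zro Y" using x by (simp add: D_def op_sub_def)
  then show "T x = S x" by (rule Y.eq_if_hsub_zro[OF adjointable_closed[OF T x] adjointable_closed[OF S x]])
qed

lemma (in hilbert_pair) hnorm_adjoint_le:
  assumes T: "T \<in> adjointables X Y" and S: "is_adjoint X Y T S" and y: "y \<in> car Y"
  shows "hnorm X (S y) \<le> op_norm X Y T * hnorm Y y"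
proof (rule X.hnorm_le_by_ip)
  have Sy: "S y \<in> car X" by (rule adjoint_closed[OF S y])
  then show "S y \<in> car X" .
  have "norm (ip X (S y) (S y)) = norm (ip Y (T (S y)) y)" using ip_adjoint(1)[OF T S Sy y] by simp
  also have "\<dots> \<le> hnorm Y (T (S y)) * hnorm Y y" by (intro Y.Cauchy_Schwarz adjointable_closed[OF T Sy] y)
  also have "\<dots> \<le> (op_norm X Y T * hnorm X (S y)) * hnorm Y y"
    by (intro mult_right_mono hnorm_le_op_norm[OF T Sy] Y.hnorm_nonneg)
  finally show "norm (ip X (S y) (S y)) \<le> op_norm X Y T * hnorm Y y * hnorm X (S y)" by (simp add: mult_ac)
qed (simp add: op_norm_nonneg[OF T] Y.hnorm_nonneg)

text \<open>If \<parallel>b\<parallel> < 1, then 1 - \<open>star b * b\<close> = (1 - k)^2 by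
  \<open>sqrt_one_minus\<close>, so \<langle>b f, b f\<rangle> + \<langle>g, g\<rangle> =
  \<langle>f, f\<rangle> for g = f - k f, and \<open>norm_star_mult_self_le\<close> drops the second
  term. The general case follows by scaling.\<close>

lemma correspondence_hnorm_le:
  assumes c: "correspondence F l" and f: "f \<in> car F"
  shows "hnorm F (l b f) \<le> norm b * hnorm F f"
proof -
  interpret F: hilbert_module F using c by (simp add: correspondence_def)
  interpret FF: hilbert_pair F F ..
  have la: "l a \<in> adjointables F F" for a using c by (simp add: correspondence_def)
  note lc = FF.adjointable_closed[OF la]
  have ladd: "l (a + a') g = add F (l a g) (l a' g)" if "g \<in> car F" for a a' g
    using c that by (simp add: correspondence_def op_add_def)
  have lmult: "l (a * a') g = l a (l a' g)" if "g \<in> car F" for a a' g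
    using c that by (simp add: correspondence_def compose_def)
  have lscl: "l (cscale z a) g = scl F z (l a g)" if "g \<in> car F" for z a g
    using c that by (simp add: correspondence_def op_scl_def)
  have lstar: "ip F (l a g) h = ip F g (l (star a) h)" if "g \<in> car F" "h \<in> car F" for a g h
    using c that by (simp add: correspondence_def)
  have contr: "hnorm F (l b f) \<le> hnorm F f" if b: "norm b < 1" for b
  proof -
    define h where "h = star b * b"
    have "star h = h" by (simp add: h_def star_mult star_star)
    moreover have "norm h < 1" using b by (simp add: h_def cstar_identity power_less_one_iff)
    ultimately obtain k where k: "star k = k" "h = 2 *\<^sub>R k - k * k" using sqrt_one_minus by metis
    define \<phi> where "\<phi> a = ip F f (l a f)" for a
    have \<phi>_add: "\<phi> (a + a') = \<phi> a + \<phi> a'" for a a' using f lc by (simp add: \<phi>_def ladd F.ip_simps)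
    define g where "g = hsub F f (l k f)"
    have gc: "g \<in> car F" using f lc by (simp add: g_def F.closed)
    have "ip F g g = (ip F f f - \<phi> k) - (ip F (l k f) f - ip F (l k f) (l k f))"
      using f lc by (simp add: g_def F.closed F.ip_simps \<phi>_def)
    also have "ip F (l k f) f = \<phi> k" using f lc by (simp add: lstar k \<phi>_def)
    also have "ip F (l k f) (l k f) = \<phi> (k * k)" using f lc by (simp add: lstar k \<phi>_def lmult)
    \<comment> \<open>The relation between h and k is used in the additive form h + k^2 = k + k,
      because \<open>\<phi>\<close> is additive.\<close>
    also have "\<phi> (k * k) = \<phi> k + \<phi> k - \<phi> h"
    proof -
      have "h + k * k = k + k" by (simp add: k(2) scaleR_2)
      then show ?thesis by (metis \<phi>_add add_diff_cancel_left')
    qed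
    finally have "ip F g g = ip F f f - \<phi> h" by simp
    moreover have "ip F (l b f) (l b f) = \<phi> h" using f lc by (simp add: lstar \<phi>_def h_def lmult)
    ultimately have sum: "ip F (l b f) (l b f) + ip F g g = ip F f f" by simp
    obtain c where c: "ip F (l b f) (l b f) = star c * c" using F.ip_pos[OF lc[OF f]] unfolding cstar_pos_def by blast
    obtain d where d: "ip F g g = star d * d" using F.ip_pos[OF gc] unfolding cstar_pos_def by blast
    have "norm (ip F (l b f) (l b f)) \<le> norm (ip F f f)"
      using norm_star_mult_self_le[of c d] by (simp add: c[symmetric] d[symmetric] sum)
    then show ?thesis by (simp add: hnorm_def)
  qed
  show ?thesis
  proof (rule le_mult_if_le_greater)
    fix s assume s: "norm b < s"
    have s0: "0 < s" using s norm_ge_zero[of b] by linarith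
    have "b = cscale (complex_of_real s) ((1/s) *\<^sub>R b)" using s0 by (simp add: cscale_of_real)
    then have "hnorm F (l b f) = s * hnorm F (l ((1/s) *\<^sub>R b) f)"
      using f lc s0 by (metis F.hnorm_scl lscl norm_of_real abs_of_pos)
    also have "\<dots> \<le> s * hnorm F f" using s s0 by (intro mult_left_mono contr) auto
    finally show "hnorm F (l b f) \<le> s * hnorm F f" .
  qed (rule F.hnorm_nonneg)
qed

section \<open>Pure tensors and their finite sums\<close>

locale tensor =
  fixes F :: "('b::cstar_algebra, 'f) hmod" and l :: "'a::cstar_algebra \<Rightarrow> 'f \<Rightarrow> 'f"
    and X :: "('a, 'x) hmod" and H :: "('b, 'y) hmod" and t :: "'x \<Rightarrow> 'f \<Rightarrow> 'y"
  assumes corr: "correspondence F l" and module_X: "hilbert_module X" and tp: "tensor_product F l X H t"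
begin

sublocale F: hilbert_module F using corr by (simp add: correspondence_def)
sublocale X: hilbert_module X by (rule module_X)
sublocale H: hilbert_module H using tp by (simp add: tensor_product_def)

lemma t_closed: "\<lbrakk>x \<in> car X; f \<in> car F\<rbrakk> \<Longrightarrow> t x f \<in> car H"
  and t_scl: "\<lbrakk>x \<in> car X; f \<in> car F\<rbrakk> \<Longrightarrow> t (scl X c x) f = scl H c (t x f)"
  and t_hsub: "\<lbrakk>x \<in> car X; x' \<in> car X; f \<in> car F\<rbrakk> \<Longrightarrow> t (hsub X x x') f = hsub H (t x f) (t x' f)"
  and t_add: "\<lbrakk>x \<in> car X; x' \<in> car X; f \<in> car F\<rbrakk> \<Longrightarrow> t (add X x x') f = add H (t x f) (t x' f)"
  and ip_t: "\<lbrakk>x \<in> car X; x' \<in> car X; f \<in> car F; f' \<in> car F\<rbrakk>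
    \<Longrightarrow> ip H (t x f) (t x' f') = ip F f (l (ip X x x') f')"
  and t_dense: "spans_densely H {t x f |x f. x \<in> car X \<and> f \<in> car F}"
  using tp by (simp_all add: tensor_product_def hsub_def X.closed)

text \<open>Writing \<langle>x, x\<rangle> = \<open>star b * b\<close>, the norm of x \<otimes> f
  equals that of b f, and \<parallel>b\<parallel> = \<parallel>x\<parallel>.\<close>

lemma hnorm_t_le:
  assumes x: "x \<in> car X" and f: "f \<in> car F"
  shows "hnorm H (t x f) \<le> hnorm X x * hnorm F f"
proof (rule power2_le_imp_le)
  obtain b where b: "ip X x x = star b * b" using X.ip_pos[OF x] unfolding cstar_pos_def by blast
  interpret FF: hilbert_pair F F ..
  have la: "l a \<in> adjointables F F" for a using corr by (simp add: correspondence_def)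
  note lc = FF.adjointable_closed[OF la f]
  have "ip F f (l (star b * b) f) = ip F f (l (star b) (l b f))"
    using corr f by (simp add: correspondence_def compose_def)
  also have "\<dots> = ip F (l b f) (l b f)" using corr f lc by (simp add: correspondence_def)
  finally have "(hnorm H (t x f))\<^sup>2 = (hnorm F (l b f))\<^sup>2"
    by (simp add: H.hnorm_square F.hnorm_square ip_t x f b)
  also have "\<dots> \<le> (norm b * hnorm F f)\<^sup>2"
    by (rule power_mono[OF correspondence_hnorm_le[OF corr f] F.hnorm_nonneg])
  also have "\<dots> = (hnorm X x * hnorm F f)\<^sup>2"
    by (simp add: power_mult_distrib X.hnorm_square b cstar_identity)
  finally show "(hnorm H (t x f))\<^sup>2 \<le> (hnorm X x * hnorm F f)\<^sup>2" .
qed (simp add: X.hnorm_nonneg F.hnorm_nonneg)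

text \<open>Lists of pairs represent elements of the algebraic tensor product. Scalars are absorbed
  into the first factor, so a linear combination of pure tensors is again a plain sum.\<close>

definition tsum :: "('x \<times> 'f) list \<Rightarrow> 'y" where
  "tsum zs = foldr (\<lambda>(x, f). add H (t x f)) zs (zro H)"

definition terms :: "('x \<times> 'f) list \<Rightarrow> bool" where
  "terms zs \<longleftrightarrow> set zs \<subseteq> car X \<times> car F"

lemma tsum_simps [simp]: "tsum [] = zro H" "tsum ((x, f) # zs) = add H (t x f) (tsum zs)"
  by (simp_all add: tsum_def)

lemma terms_simps [simp]: "terms []" "terms ((x, f) # zs) \<longleftrightarrow> x \<in> car X \<and> f \<in> car F \<and> terms zs"
  "terms (zs @ ws) \<longleftrightarrow> terms zs \<and> terms ws"
  by (auto simp: terms_def)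

lemma tsum_closed: "terms zs \<Longrightarrow> tsum zs \<in> car H"
  by (induction zs) (auto simp: H.closed t_closed)

lemma tsum_append: "\<lbrakk>terms zs; terms ws\<rbrakk> \<Longrightarrow> tsum (zs @ ws) = add H (tsum zs) (tsum ws)"
proof (induction zs)
  case Nil
  then show ?case using tsum_closed[of ws] by (simp add: H.add_commute[OF H.zro_closed] H.add_zro)
next
  case (Cons z zs)
  then show ?case by (cases z) (simp add: H.add_assoc tsum_closed t_closed)
qed

lemma tsum_dense:
  assumes "z \<in> car H" "0 < e"
  obtains zs where "terms zs" "hnorm H (hsub H z (tsum zs)) < e"
proof -
  obtain v where v: "v \<in> lin_span (zro H) (add H) (scl H) {t x f |x f. x \<in> car X \<and> f \<in> car F}"
      "hnorm H (hsub H z v) < e"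
    using t_dense assms by (auto simp: spans_densely_def)
  from v(1) have "\<exists>zs. terms zs \<and> v = tsum zs"
  proof induction
    case lin_span_zero
    show ?case by (intro exI[of _ "[]"]) simp
  next
    case (lin_span_step s v c)
    then obtain x f zs where "x \<in> car X" "f \<in> car F" "s = t x f" "terms zs" "v = tsum zs" by blast
    then show ?case by (intro exI[of _ "(scl X c x, f) # zs"]) (simp add: X.closed t_scl)
  qed
  with v(2) show ?thesis using that by blast
qed

end

section \<open>Construction of S \<otimes> 1\<close>

locale tensor_pair = T: tensor F l X H t + T': tensor F l X' H' t'
  for F :: "('b::cstar_algebra, 'f) hmod" and l :: "'a::cstar_algebra \<Rightarrow> 'f \<Rightarrow> 'f"
    and X :: "('a, 'x) hmod" and H :: "('b, 'y) hmod" and t :: "'x \<Rightarrow> 'f \<Rightarrow> 'y"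
    and X' :: "('a, 'x2) hmod" and H' :: "('b, 'y2) hmod" and t' :: "'x2 \<Rightarrow> 'f \<Rightarrow> 'y2"

text \<open>S \<otimes> 1 on representatives. That the sum of the lifted list depends only on the
  sum of the given list is a consequence of the norm estimates below.\<close>

definition lift :: "('x \<Rightarrow> 'x2) \<Rightarrow> ('x \<times> 'f) list \<Rightarrow> ('x2 \<times> 'f) list" where
  "lift S = map (\<lambda>(x, f). (S x, f))"

lemma lift_simps [simp]: "lift S [] = []" "lift S ((x, f) # zs) = (S x, f) # lift S zs"
  "lift S (zs @ ws) = lift S zs @ lift S ws"
  by (simp_all add: lift_def)

lemma lift_lift: "lift S (lift R zs) = lift (S \<circ> R) zs"
  by (simp add: lift_def comp_def case_prod_unfold)

context tensor_pair
begin

lemma terms_lift: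
  assumes "\<And>x. x \<in> car X \<Longrightarrow> S x \<in> car X'" "T.terms zs"
  shows "T'.terms (lift S zs)"
  using assms(2) by (induction zs) (auto simp: assms(1))

lemma ip_lift:
  assumes S: "\<And>x. x \<in> car X \<Longrightarrow> S x \<in> car X'" "\<And>y. y \<in> car X' \<Longrightarrow> S' y \<in> car X"
    and adj: "\<And>x y. \<lbrakk>x \<in> car X; y \<in> car X'\<rbrakk> \<Longrightarrow> ip X' (S x) y = ip X x (S' y)"
    and zs: "T.terms zs" and ws: "T'.terms ws"
  shows "ip H' (T'.tsum (lift S zs)) (T'.tsum ws) = ip H (T.tsum zs) (T.tsum (lift S' ws))"
proof -
  interpret flip: tensor_pair F l X' H' t' X H t ..
  note tc = T.tsum_closed T'.tsum_closed terms_lift[OF S(1)] flip.terms_lift[OF S(2)]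
  have one: "ip H' (t' (S x) f) (T'.tsum ws) = ip H (t x f) (T.tsum (lift S' ws))"
    if "x \<in> car X" "f \<in> car F" for x f
    using ws
  proof (induction ws)
    case Nil
    then show ?case using that by (simp add: T.H.ip_simps T'.H.ip_simps T.t_closed T'.t_closed S)
  next
    case (Cons w ws)
    then show ?case using that
      by (cases w) (simp add: T.H.ip_simps T'.H.ip_simps T.t_closed T'.t_closed S tc T.ip_t T'.ip_t adj)
  qed
  show ?thesis using zs
  proof (induction zs)
    case Nil
    show ?case using ws by (simp add: T.H.ip_simps T'.H.ip_simps tc)
  next
    case (Cons z zs)
    then show ?case using ws
      by (cases z) (simp add: T.H.ip_simps T'.H.ip_simps T.t_closed T'.t_closed S tc one)
  qed
qed

end

text \<open>A crude bound whose factor depends on the list but not on S. Applied to powers, it stays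
  fixed while the exponent grows, so it vanishes under roots.\<close>

lemma (in tensor) hnorm_tsum_lift_le:
  assumes "terms zs" "\<And>x. x \<in> car X \<Longrightarrow> S x \<in> car X" "\<And>x. x \<in> car X \<Longrightarrow> hnorm X (S x) \<le> C * hnorm X x" "0 \<le> C"
  shows "hnorm H (tsum (lift S zs)) \<le> sum_list (map (\<lambda>(x, f). hnorm X x * hnorm F f) zs) * C"
  using assms(1)
proof (induction zs)
  case Nil
  show ?case by (simp add: H.hnorm_zro)
next
  case (Cons z zs)
  obtain x f where z: "z = (x, f)" by (cases z)
  have xf: "x \<in> car X" "f \<in> car F" "terms zs" using Cons(2) by (simp_all add: z)
  have "terms (lift S zs)" using xf(3) assms(2) by (induction zs) auto
  then have "hnorm H (add H (t (S x) f) (tsum (lift S zs))) \<le> hnorm H (t (S x) f) + hnorm H (tsum (lift S zs))"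
    by (intro H.hnorm_triangle t_closed tsum_closed assms(2) xf)
  also have "\<dots> \<le> (C * hnorm X x) * hnorm F f + sum_list (map (\<lambda>(x, f). hnorm X x * hnorm F f) zs) * C"
  proof (rule add_mono)
    have "hnorm H (t (S x) f) \<le> hnorm X (S x) * hnorm F f" by (intro hnorm_t_le assms(2) xf)
    also have "\<dots> \<le> (C * hnorm X x) * hnorm F f" by (intro mult_right_mono assms(3) xf F.hnorm_nonneg)
    finally show "hnorm H (t (S x) f) \<le> (C * hnorm X x) * hnorm F f" .
  qed (rule Cons(1)[OF xf(3)])
  finally show ?case by (simp add: z algebra_simps)
qed

context tensor_pair
begin

sublocale XX: hilbert_pair X X' ..
sublocale HH: hilbert_pair H H' ..
sublocale flip: tensor_pair F l X' H' t' X H t ..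

text \<open>
  With \<open>P = S\<^sup>* S\<close> and \<open>a\<^sub>n = \<parallel>P\<^sup>n z\<parallel>\<close> one has \<open>a\<^sub>n\<^sup>2 \<le> a\<^sub>0 a\<^sub>2\<^sub>n\<close>, while \<open>a\<^sub>n\<close> grows
  at most like \<open>\<parallel>P\<parallel>\<^sup>n\<close> because \<open>z\<close> is a finite sum of pure tensors.
\<close>

lemma hnorm_lift_le:
  assumes S: "S \<in> adjointables X X'" and zs: "T.terms zs"
  shows "hnorm H' (T'.tsum (lift S zs)) \<le> op_norm X X' S * hnorm H (T.tsum zs)"
proof (rule le_mult_if_le_greater)
  fix s assume s: "op_norm X X' S < s"
  have s0: "0 < s" using s XX.op_norm_nonneg[OF S] by simp
  obtain S' where S': "is_adjoint X X' S S'" using XX.adjoint_exists[OF S] .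
  note Sc = XX.adjointable_closed[OF S] XX.adjoint_closed[OF S']
  define P where "P = (\<lambda>x. S' (S x))"
  have Pc: "x \<in> car X \<Longrightarrow> P x \<in> car X" for x by (simp add: P_def Sc)
  have Pn: "hnorm X (P x) \<le> s\<^sup>2 * hnorm X x" if x: "x \<in> car X" for x
  proof -
    have "hnorm X (P x) \<le> op_norm X X' S * hnorm X' (S x)"
      unfolding P_def by (rule XX.hnorm_adjoint_le[OF S S' Sc(1)[OF x]])
    also have "\<dots> \<le> s * (s * hnorm X x)"
    proof (rule mult_mono)
      have "hnorm X' (S x) \<le> op_norm X X' S * hnorm X x" by (rule XX.hnorm_le_op_norm[OF S x])
      also have "\<dots> \<le> s * hnorm X x" using s by (intro mult_right_mono T.X.hnorm_nonneg) simp
      finally show "hnorm X' (S x) \<le> s * hnorm X x" .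
    qed (use s s0 in \<open>simp_all add: T'.X.hnorm_nonneg\<close>)
    finally show ?thesis by (simp add: power2_eq_square mult.assoc)
  qed
  have Padj: "ip X (P x) y = ip X x (P y)" if "x \<in> car X" "y \<in> car X" for x y
    using that Sc by (simp add: P_def XX.ip_adjoint(2)[OF S S', symmetric] XX.ip_adjoint(1)[OF S S'])
  have Pnc: "x \<in> car X \<Longrightarrow> (P ^^ n) x \<in> car X" for x n by (induction n) (simp_all add: Pc)
  have Pnn: "hnorm X ((P ^^ n) x) \<le> (s\<^sup>2) ^ n * hnorm X x" if x: "x \<in> car X" for x n
  proof (induction n)
    case (Suc n)
    have "hnorm X (P ((P ^^ n) x)) \<le> s\<^sup>2 * hnorm X ((P ^^ n) x)" by (rule Pn[OF Pnc[OF x]])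
    also have "\<dots> \<le> s\<^sup>2 * ((s\<^sup>2) ^ n * hnorm X x)" by (intro mult_left_mono Suc) simp
    finally show ?case by (simp add: mult.assoc)
  qed simp
  have Pnadj: "ip X ((P ^^ n) x) y = ip X x ((P ^^ n) y)" if "x \<in> car X" "y \<in> car X" for x y n
    using that
  proof (induction n arbitrary: y)
    case (Suc n)
    have "ip X ((P ^^ Suc n) x) y = ip X ((P ^^ n) x) (P y)" using Suc(2,3) by (simp add: Padj Pnc)
    also have "\<dots> = ip X x ((P ^^ n) (P y))" by (rule Suc(1)) (simp_all add: Suc Pc)
    finally show ?case by (simp add: funpow_swap1)
  qed simp
  interpret TT: tensor_pair F l X H t X H t ..
  \<comment> \<open>The powers act on the list \<open>zs\<close>, because P \<otimes> 1 is not yet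
    known to be well defined on sums.\<close>
  define z where "z n = T.tsum (lift (P ^^ n) zs)" for n
  define a where "a n = hnorm H (z n)" for n
  have zc: "z n \<in> car H" for n unfolding z_def by (intro T.tsum_closed TT.terms_lift Pnc zs)
  have a0: "0 \<le> a n" for n by (simp add: a_def T.H.hnorm_nonneg)
  have z0: "z 0 = T.tsum zs" by (simp add: z_def lift_def case_prod_unfold)
  have asq: "(a n)\<^sup>2 \<le> a 0 * a (n + n)" for n
  proof -
    have "ip H (z n) (z n) = ip H (T.tsum zs) (T.tsum (lift (P ^^ n) (lift (P ^^ n) zs)))"
      unfolding z_def by (intro TT.ip_lift Pnadj Pnc zs TT.terms_lift)
    also have "\<dots> = ip H (z 0) (z (n + n))" by (simp only: lift_lift z0) (simp only: z_def funpow_add)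
    finally show ?thesis using T.H.Cauchy_Schwarz[OF zc zc, of 0 "n + n"] by (simp add: a_def T.H.hnorm_square)
  qed
  define C where "C = sum_list (map (\<lambda>(x, f). hnorm X x * hnorm F f) zs)"
  have aC: "a n \<le> C * (s\<^sup>2) ^ n" for n
    unfolding a_def z_def C_def by (intro T.hnorm_tsum_lift_le zs Pnc Pnn) simp_all
  have a1: "a 1 \<le> s\<^sup>2 * a 0"
  proof (cases "a 0 = 0")
    case True
    then show ?thesis using asq[of 1] by simp
  next
    case False
    then have p: "0 < a 0" using a0[of 0] by simp
    have up: "(a 1 / a 0) ^ 2 ^ n \<le> a (2 ^ n) / a 0" for n
    proof (induction n)
      case (Suc n)
      have "(a 1 / a 0) ^ 2 ^ Suc n = ((a 1 / a 0) ^ 2 ^ n)\<^sup>2" by (simp add: power_mult[symmetric] mult.commute)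
      also have "\<dots> \<le> (a (2 ^ n) / a 0)\<^sup>2" by (intro power_mono Suc) (simp add: a0)
      also have "\<dots> \<le> (a 0 * a (2 ^ n + 2 ^ n)) / (a 0)\<^sup>2"
        unfolding power_divide by (intro divide_right_mono asq) simp
      also have "\<dots> = a (2 ^ Suc n) / a 0" using p by (simp add: power2_eq_square mult_2)
      finally show ?case .
    qed simp
    have "a (2 ^ n) / a 0 \<le> (C / a 0 + 0 * 2 ^ n) * (s\<^sup>2) ^ 2 ^ n" for n
      using divide_right_mono[OF aC[of "2 ^ n"], of "a 0"] p by simp
    with up have le: "(a 1 / a 0) ^ 2 ^ n \<le> (C / a 0 + 0 * 2 ^ n) * (s\<^sup>2) ^ 2 ^ n" for n
      by (rule order_trans)
    have "a 1 / a 0 \<le> s\<^sup>2"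
      by (rule growth_bound[OF _ _ le]) (use s0 in \<open>simp_all add: a0\<close>)
    then show ?thesis using p by (simp add: divide_le_eq)
  qed
  show "hnorm H' (T'.tsum (lift S zs)) \<le> s * hnorm H (T.tsum zs)"
  proof (rule power2_le_imp_le)
    have "ip H' (T'.tsum (lift S zs)) (T'.tsum (lift S zs)) = ip H (T.tsum zs) (T.tsum (lift S' (lift S zs)))"
      by (intro ip_lift Sc XX.ip_adjoint(1)[OF S S'] zs terms_lift)
    also have "\<dots> = ip H (z 0) (z 1)" by (simp add: lift_lift z0) (simp add: z_def P_def comp_def)
    finally have "(hnorm H' (T'.tsum (lift S zs)))\<^sup>2 \<le> a 0 * a 1"
      using T.H.Cauchy_Schwarz[OF zc zc, of 0 1] by (simp add: a_def T'.H.hnorm_square)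
    also have "\<dots> \<le> a 0 * (s\<^sup>2 * a 0)" by (intro mult_left_mono a1 a0)
    finally show "(hnorm H' (T'.tsum (lift S zs)))\<^sup>2 \<le> (s * hnorm H (T.tsum zs))\<^sup>2"
      by (simp add: a_def z0 power2_eq_square mult_ac)
  qed (use s0 T.H.hnorm_nonneg in simp)
qed (rule T.H.hnorm_nonneg)

text \<open>The closure of the graph of S \<otimes> 1: a single list must approximate
  \<open>z\<close> and, after lifting, \<open>w\<close>. That the relation is single-valued follows
  from \<open>approximates_adjoint\<close>.\<close>

definition approximates :: "('x \<Rightarrow> 'x2) \<Rightarrow> 'y \<Rightarrow> 'y2 \<Rightarrow> bool" where
  "approximates S z w \<longleftrightarrow> z \<in> car H \<and> w \<in> car H' \<and>
    (\<forall>e>0. \<exists>zs. T.terms zs \<and> hnorm H (hsub H z (T.tsum zs)) < e \<and>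
      hnorm H' (hsub H' w (T'.tsum (lift S zs))) < e)"

end

context tensor_pair
begin

text \<open>A difference of two sums is the sum over one list, the second list being appended with
  negated first factors; \<open>hnorm_lift_le\<close> applies to it.\<close>

lemma hnorm_lift_diff_le:
  assumes S: "S \<in> adjointables X X'" and zs: "T.terms zs" and ws: "T.terms ws"
  shows "hnorm H' (hsub H' (T'.tsum (lift S zs)) (T'.tsum (lift S ws)))
    \<le> op_norm X X' S * hnorm H (hsub H (T.tsum zs) (T.tsum ws))"
proof -
  interpret TT: tensor_pair F l X H t X H t ..
  interpret TT': tensor_pair F l X' H' t' X' H' t' ..
  note Sc = XX.adjointable_closed[OF S]
  have neg: "T.tsum (lift (scl X (- 1)) ws) = scl H (- 1) (T.tsum ws)" if "T.terms ws" for ws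
    using that
  proof (induction ws)
    case Nil
    show ?case by (rule T.H.eq_by_ip) (simp_all add: T.H.closed T.H.ip_simps)
  next
    case (Cons w ws)
    then show ?case
      by (cases w) (simp add: T.t_scl T.H.scl_add T.t_closed T.tsum_closed)
  qed
  have neg': "T'.tsum (lift (scl X' (- 1)) ws) = scl H' (- 1) (T'.tsum ws)" if "T'.terms ws" for ws
    using that
  proof (induction ws)
    case Nil
    show ?case by (rule T'.H.eq_by_ip) (simp_all add: T'.H.closed T'.H.ip_simps)
  next
    case (Cons w ws)
    then show ?case
      by (cases w) (simp add: T'.t_scl T'.H.scl_add T'.t_closed T'.tsum_closed)
  qed
  have swap: "lift S (lift (scl X (- 1)) ws) = lift (scl X' (- 1)) (lift S ws)" if "T.terms ws" for ws
    using that
  proof (induction ws)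
    case (Cons w ws)
    then show ?case by (cases w) (simp add: XX.adjointable_linear(2)[OF S])
  qed simp
  have nt: "T.terms (lift (scl X (- 1)) ws)" by (intro TT.terms_lift ws T.X.closed)
  have nt': "T'.terms (lift (scl X' (- 1)) (lift S ws))" "T'.terms (lift S zs)" "T'.terms (lift S ws)"
    by (intro TT'.terms_lift terms_lift zs ws Sc T'.X.closed; assumption)+
  have "hsub H' (T'.tsum (lift S zs)) (T'.tsum (lift S ws)) = T'.tsum (lift S (zs @ lift (scl X (- 1)) ws))"
    by (simp add: hsub_def swap[OF ws] T'.tsum_append nt' neg')
  moreover have "hsub H (T.tsum zs) (T.tsum ws) = T.tsum (zs @ lift (scl X (- 1)) ws)"
    by (simp add: hsub_def T.tsum_append zs ws nt neg)
  ultimately show ?thesis using hnorm_lift_le[OF S, of "zs @ lift (scl X (- 1)) ws"] zs nt by simp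
qed

text \<open>Sums converging to \<open>z\<close> have lifts that form a Cauchy sequence by
  \<open>hnorm_lift_diff_le\<close>; their limit exists by completeness.\<close>

lemma approximates_exists:
  assumes S: "S \<in> adjointables X X'" and z: "z \<in> car H"
  obtains w where "approximates S z w"
proof -
  define e where "e n = inverse (real (Suc n))" for n
  have e: "0 < e n" for n by (simp add: e_def)
  have "\<exists>zs. T.terms zs \<and> hnorm H (hsub H z (T.tsum zs)) < e n" for n
    using T.tsum_dense[OF z e] by metis
  then obtain zs where zs: "\<And>n. T.terms (zs n)" "\<And>n. hnorm H (hsub H z (T.tsum (zs n))) < e n" by metis
  define w where "w n = T'.tsum (lift S (zs n))" for n
  have wc: "w n \<in> car H'" for n
    unfolding w_def by (intro T'.tsum_closed terms_lift XX.adjointable_closed[OF S] zs)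
  have small: "\<exists>N. \<forall>n\<ge>N. e n < d" if d: "0 < d" for d
  proof -
    obtain N where N: "e N < d" using reals_Archimedean[OF d] by (auto simp: e_def)
    have "e n \<le> e N" if "N \<le> n" for n using that by (simp add: e_def le_imp_inverse_le)
    then show ?thesis using N by (meson le_less_trans)
  qed
  define c where "c = op_norm X X' S"
  have c0: "0 \<le> c" unfolding c_def by (rule XX.op_norm_nonneg[OF S])
  have "\<exists>l\<in>car H'. (\<lambda>n. hnorm H' (hsub H' (w n) l)) \<longlonglongrightarrow> 0"
  proof (rule T'.H.complete)
    show "\<forall>n. w n \<in> car H'" using wc by blast
    show "\<forall>d>0. \<exists>N. \<forall>m\<ge>N. \<forall>n\<ge>N. hnorm H' (hsub H' (w m) (w n)) < d"
    proof (intro allI impI)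
      fix d :: real assume d: "0 < d"
      define r where "r = d / (c + 1)"
      have "0 < r / 2" using d c0 by (simp add: r_def)
      then obtain N where N: "\<And>n. N \<le> n \<Longrightarrow> e n < r / 2" using small by metis
      have half: "r / 2 + r / 2 = r" by (rule field_sum_of_halves)
      have "hnorm H' (hsub H' (w m) (w n)) < d" if "N \<le> m" "N \<le> n" for m n
      proof -
        have "hnorm H (hsub H (T.tsum (zs m)) (T.tsum (zs n)))
            \<le> hnorm H (hsub H (T.tsum (zs m)) z) + hnorm H (hsub H z (T.tsum (zs n)))"
          by (intro T.H.hnorm_hsub_triangle T.tsum_closed zs z)
        also have "hnorm H (hsub H (T.tsum (zs m)) z) = hnorm H (hsub H z (T.tsum (zs m)))"
          by (intro T.H.hnorm_hsub_commute T.tsum_closed zs z)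
        finally have "hnorm H (hsub H (T.tsum (zs m)) (T.tsum (zs n))) \<le> r"
          using zs(2)[of m] zs(2)[of n] N[OF that(1)] N[OF that(2)] half by linarith
        then have "c * hnorm H (hsub H (T.tsum (zs m)) (T.tsum (zs n))) \<le> c * r"
          by (intro mult_left_mono c0)
        also have "\<dots> < d" using c0 d by (simp add: r_def) (simp add: divide_less_eq algebra_simps)
        finally show ?thesis
          using hnorm_lift_diff_le[OF S zs(1) zs(1), of m n] by (simp add: w_def c_def)
      qed
      then show "\<exists>N. \<forall>m\<ge>N. \<forall>n\<ge>N. hnorm H' (hsub H' (w m) (w n)) < d" by blast
    qed
  qed
  then obtain v where v: "v \<in> car H'" "(\<lambda>n. hnorm H' (hsub H' (w n) v)) \<longlonglongrightarrow> 0" by blast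
  have "approximates S z v"
    unfolding approximates_def
  proof (intro conjI allI impI)
    fix d :: real assume d: "0 < d"
    have "eventually (\<lambda>n. hnorm H' (hsub H' (w n) v) < d) sequentially" using order_tendstoD(2)[OF v(2) d] .
    then obtain M where M: "\<And>n. M \<le> n \<Longrightarrow> hnorm H' (hsub H' (w n) v) < d" by (auto simp: eventually_sequentially)
    obtain N where N: "\<And>n. N \<le> n \<Longrightarrow> e n < d" using small[OF d] by metis
    define n where "n = max M N"
    have "hnorm H (hsub H z (T.tsum (zs n))) < d" using zs(2)[of n] N[of n] by (simp add: n_def)
    moreover have "hnorm H' (hsub H' v (w n)) < d"
      using M[of n] T'.H.hnorm_hsub_commute[OF v(1) wc[of n]] by (simp add: n_def)
    ultimately show "\<exists>zs. T.terms zs \<and> hnorm H (hsub H z (T.tsum zs)) < d \<and>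
        hnorm H' (hsub H' v (T'.tsum (lift S zs))) < d"
      using zs(1) unfolding w_def by metis
  qed (use z v in auto)
  then show ?thesis by (rule that)
qed

text \<open>Passes \<open>ip_lift\<close> to the limit. The two approximations are independent, and
  \<open>ip_diff_le\<close> controls both inner products by a multiple of \<open>e\<close>.\<close>

lemma approximates_adjoint:
  assumes S: "S \<in> adjointables X X'" and S': "is_adjoint X X' S S'"
    and zw: "approximates S z w" and wz: "flip.approximates S' w' z'"
  shows "ip H' w w' = ip H z z'"
proof -
  have c: "z \<in> car H" "w \<in> car H'" "w' \<in> car H'" "z' \<in> car H"
    using zw wz by (simp_all add: approximates_def flip.approximates_def)
  note Sc = XX.adjointable_closed[OF S] XX.adjoint_closed[OF S']
  define K where "K = (hnorm H' w + hnorm H' w' + 1) + (hnorm H z + hnorm H z' + 1)"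
  have small: "norm (ip H' w w' - ip H z z') \<le> e * K" if e: "0 < e" "e \<le> 1" for e
  proof -
    obtain zs where zs: "T.terms zs" "hnorm H (hsub H z (T.tsum zs)) < e"
        "hnorm H' (hsub H' w (T'.tsum (lift S zs))) < e"
      using zw e(1) unfolding approximates_def by blast
    obtain ws where ws: "T'.terms ws" "hnorm H' (hsub H' w' (T'.tsum ws)) < e"
        "hnorm H (hsub H z' (T.tsum (lift S' ws))) < e"
      using wz e(1) unfolding flip.approximates_def by blast
    have tc: "T.terms (lift S' ws)" "T'.terms (lift S zs)"
      by (intro flip.terms_lift terms_lift Sc zs ws; assumption)+
    have eq: "ip H' (T'.tsum (lift S zs)) (T'.tsum ws) = ip H (T.tsum zs) (T.tsum (lift S' ws))"
      by (intro ip_lift Sc XX.ip_adjoint(1)[OF S S'] zs ws)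
    have "norm (ip H' w w' - ip H' (T'.tsum (lift S zs)) (T'.tsum ws)) \<le> e * (hnorm H' w + hnorm H' w' + 1)"
      by (rule T'.H.ip_diff_le) (use zs ws c tc e in \<open>simp_all add: T'.tsum_closed\<close>)
    moreover have "norm (ip H z z' - ip H (T.tsum zs) (T.tsum (lift S' ws))) \<le> e * (hnorm H z + hnorm H z' + 1)"
      by (rule T.H.ip_diff_le) (use zs ws c tc e in \<open>simp_all add: T.tsum_closed\<close>)
    moreover have "ip H' w w' - ip H z z' = (ip H' w w' - ip H' (T'.tsum (lift S zs)) (T'.tsum ws))
        - (ip H z z' - ip H (T.tsum zs) (T.tsum (lift S' ws)))" by (simp add: eq)
    then have "norm (ip H' w w' - ip H z z') \<le> norm (ip H' w w' - ip H' (T'.tsum (lift S zs)) (T'.tsum ws))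
        + norm (ip H z z' - ip H (T.tsum zs) (T.tsum (lift S' ws)))" by (simp only: norm_triangle_ineq4)
    ultimately show ?thesis by (simp add: K_def distrib_left)
  qed
  have K: "0 < K"
    unfolding K_def
    using T.H.hnorm_nonneg[of z] T.H.hnorm_nonneg[of z'] T'.H.hnorm_nonneg[of w] T'.H.hnorm_nonneg[of w']
    by linarith
  have "norm (ip H' w w' - ip H z z') \<le> 0"
  proof (rule field_le_epsilon)
    fix d :: real assume d: "0 < d"
    have "norm (ip H' w w' - ip H z z') \<le> min 1 (d / K) * K" by (rule small) (use d K in auto)
    also have "\<dots> \<le> (d / K) * K" using K by (intro mult_right_mono) auto
    finally show "norm (ip H' w w' - ip H z z') \<le> 0 + d" using K by simp
  qed
  then show ?thesis by simp
qed

lemma approximates_hnorm_le: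
  assumes S: "S \<in> adjointables X X'" and zw: "approximates S z w"
  shows "hnorm H' w \<le> op_norm X X' S * hnorm H z"
proof (rule field_le_epsilon)
  fix d :: real assume d: "0 < d"
  define c where "c = op_norm X X' S"
  have c0: "0 \<le> c" unfolding c_def by (rule XX.op_norm_nonneg[OF S])
  define e where "e = d / (c + 1)"
  have e: "0 < e" "e * (c + 1) = d" using d c0 by (simp_all add: e_def)
  obtain zs where zs: "T.terms zs" "hnorm H (hsub H z (T.tsum zs)) < e"
      "hnorm H' (hsub H' w (T'.tsum (lift S zs))) < e"
    using zw e(1) unfolding approximates_def by blast
  have zwc: "z \<in> car H" "w \<in> car H'" using zw by (simp_all add: approximates_def)
  have tc: "T.tsum zs \<in> car H" "T'.tsum (lift S zs) \<in> car H'"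
    using zs(1) by (simp_all add: T.tsum_closed T'.tsum_closed terms_lift XX.adjointable_closed[OF S])
  have "hnorm H (T.tsum zs) \<le> hnorm H z + e"
    using T.H.hnorm_le_add_hsub[OF tc(1) zwc(1)] T.H.hnorm_hsub_commute[OF tc(1) zwc(1)] zs(2) by simp
  then have "c * hnorm H (T.tsum zs) \<le> c * (hnorm H z + e)" by (intro mult_left_mono c0)
  moreover have "hnorm H' w \<le> c * hnorm H (T.tsum zs) + e"
    using T'.H.hnorm_le_add_hsub[OF zwc(2) tc(2)] hnorm_lift_le[OF S zs(1)] zs(3) by (simp add: c_def)
  ultimately show "hnorm H' w \<le> op_norm X X' S * hnorm H z + d"
    by (simp add: c_def[symmetric] e(2)[symmetric] algebra_simps)
qed

lemma approximates_t:
  assumes S: "S \<in> adjointables X X'" and "x \<in> car X" "f \<in> car F"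
  shows "approximates S (t x f) (t' (S x) f)"
  unfolding approximates_def
proof (intro conjI allI impI)
  note Sx = XX.adjointable_closed[OF S assms(2)]
  show "t x f \<in> car H" "t' (S x) f \<in> car H'" using assms Sx by (simp_all add: T.t_closed T'.t_closed)
  show "\<exists>zs. T.terms zs \<and> hnorm H (hsub H (t x f) (T.tsum zs)) < e \<and>
      hnorm H' (hsub H' (t' (S x) f) (T'.tsum (lift S zs))) < e" if "0 < e" for e
    by (rule exI[of _ "[(x, f)]"])
      (use assms Sx that in \<open>simp add: T.t_closed T'.t_closed T.H.add_zro T'.H.add_zro T.H.hsub_self T'.H.hsub_self
        T.H.hnorm_zro T'.H.hnorm_zro\<close>)
qed

end

context tensor_pair
begin

text \<open>The operators come from the closed graphs of S \<otimes> 1 and S^* \<otimes> 1. Being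
  adjoint to each other already makes them adjointable, so linearity is not checked
  separately.\<close>

lemma tensor_operator_exists:
  assumes S: "S \<in> adjointables X X'"
  obtains R where "R \<in> adjointables H H'" "\<And>x f. \<lbrakk>x \<in> car X; f \<in> car F\<rbrakk> \<Longrightarrow> R (t x f) = t' (S x) f"
    "op_norm H H' R \<le> op_norm X X' S"
proof -
  obtain S' where S': "is_adjoint X X' S S'" using XX.adjoint_exists[OF S] .
  have S'a: "S' \<in> adjointables X' X" using S' by (simp add: is_adjoint_def)
  define R where "R = (\<lambda>z\<in>car H. SOME w. approximates S z w)"
  define R' where "R' w = (SOME z. flip.approximates S' w z)" for w
  have R: "approximates S z (R z)" if "z \<in> car H" for z
    using that approximates_exists[OF S that] by (auto simp: R_def intro: someI)
  have R': "flip.approximates S' w (R' w)" if "w \<in> car H'" for w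
    using flip.approximates_exists[OF S'a that] unfolding R'_def by (auto intro: someI)
  have Rc: "R z \<in> car H'" if "z \<in> car H" for z using R[OF that] by (simp add: approximates_def)
  have R'c: "R' w \<in> car H" if "w \<in> car H'" for w using R'[OF that] by (simp add: flip.approximates_def)
  \<comment> \<open>Stated for every \<open>w\<close> related to \<open>z\<close>, not only for the
    chosen \<open>R z\<close>. Applied to \<open>approximates_t\<close> it identifies the value at a
    pure tensor.\<close>
  have adj: "ip H' w w' = ip H z (R' w')" if "approximates S z w" "w' \<in> car H'" for z w w'
    by (rule approximates_adjoint[OF S S' that(1) R'[OF that(2)]])
  show ?thesis
  proof (rule that)
    show "R \<in> adjointables H H'"
      by (rule HH.adjointablesI[where S=R']) (use Rc R'c adj R in \<open>auto simp: R_def extensional_def\<close>)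
    show "R (t x f) = t' (S x) f" if "x \<in> car X" "f \<in> car F" for x f
      using that S by (intro T'.H.eq_by_ip_left)
        (simp_all add: Rc T.t_closed T'.t_closed XX.adjointable_closed adj[OF R] adj[OF approximates_t])
    show "op_norm H H' R \<le> op_norm X X' S"
      by (intro HH.op_norm_le XX.op_norm_nonneg S approximates_hnorm_le R)
  qed
qed

end

text \<open>All later computations with \<open>tensor_map\<close> go through this criterion: pure
  tensors span densely, so they determine the operator.\<close>

lemma tensor_map_equality:
  assumes "tensor_functor F l T t" "correspondence F l" "hilbert_module X" "hilbert_module X'"
    and R: "R \<in> adjointables (T X) (T X')" "\<And>x f. \<lbrakk>x \<in> car X; f \<in> car F\<rbrakk> \<Longrightarrow> R (t X x f) = t X' (S x) f"
  shows "tensor_map F T t X X' S = R"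
proof -
  interpret tensor_pair F l X "T X" "t X" X' "T X'" "t X'"
    using assms by (intro tensor_pair.intro tensor.intro) (simp_all add: tensor_functor_def)
  have sub: "{t X x f |x f. x \<in> car X \<and> f \<in> car F} \<subseteq> car (T X)" using T.t_closed by auto
  show ?thesis
    unfolding tensor_map_def
  proof (rule the_equality)
    show "R' = R" if "R' \<in> adjointables (T X) (T X') \<and> (\<forall>x\<in>car X. \<forall>f\<in>car F. R' (t X x f) = t X' (S x) f)" for R'
      using that by (intro HH.adjointable_eq_on_dense[OF _ R(1) sub T.t_dense]) (auto simp: R(2))
  qed (use R in auto)
qed

lemma tensor_map:
  assumes "tensor_functor F l T t" "correspondence F l" "hilbert_module X" "hilbert_module X'"
    and S: "S \<in> adjointables X X'"
  shows "tensor_map F T t X X' S \<in> adjointables (T X) (T X')"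
    "\<lbrakk>x \<in> car X; f \<in> car F\<rbrakk> \<Longrightarrow> tensor_map F T t X X' S (t X x f) = t X' (S x) f"
    "op_norm (T X) (T X') (tensor_map F T t X X' S) \<le> op_norm X X' S"
proof -
  interpret tensor_pair F l X "T X" "t X" X' "T X'" "t X'"
    using assms by (intro tensor_pair.intro tensor.intro) (simp_all add: tensor_functor_def)
  obtain R where R: "R \<in> adjointables (T X) (T X')" 
      "\<And>x f. \<lbrakk>x \<in> car X; f \<in> car F\<rbrakk> \<Longrightarrow> R (t X x f) = t X' (S x) f"
      "op_norm (T X) (T X') R \<le> op_norm X X' S"
    using tensor_operator_exists[OF S] by metis
  have eq: "tensor_map F T t X X' S = R" by (rule tensor_map_equality[OF assms(1-4) R(1,2)])
  show "tensor_map F T t X X' S \<in> adjointables (T X) (T X')"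
    "\<lbrakk>x \<in> car X; f \<in> car F\<rbrakk> \<Longrightarrow> tensor_map F T t X X' S (t X x f) = t X' (S x) f"
    "op_norm (T X) (T X') (tensor_map F T t X X' S) \<le> op_norm X X' S"
    unfolding eq by (fact R(1), erule (1) R(2), fact R(3))
qed

section \<open>Compact operators\<close>

definition rank_ones :: "('a::cstar_algebra, 'x) hmod \<Rightarrow> ('a, 'y) hmod \<Rightarrow> ('x \<Rightarrow> 'y) set" where
  "rank_ones X Y = {rank_one X Y y x |y x. y \<in> car Y \<and> x \<in> car X}"

context hilbert_pair
begin

abbreviation finite_rank :: "('x \<Rightarrow> 'y) set" where
  "finite_rank \<equiv> lin_span (op_zero X Y) (op_add X Y) (op_scl X Y) (rank_ones X Y)"

lemma compacts_eq: "compacts X Y = {T \<in> adjointables X Y.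
    \<forall>e>0. \<exists>S\<in>finite_rank. op_norm X Y (op_sub X Y T S) < e}"
  unfolding compacts_def rank_ones_def by (rule refl)

lemma rank_ones_adjointable: "s \<in> rank_ones X Y \<Longrightarrow> s \<in> adjointables X Y"
  by (auto simp: rank_ones_def rank_one_adjointable)

lemma finite_rank_adjointable: "S \<in> finite_rank \<Longrightarrow> S \<in> adjointables X Y"
  by (induction rule: lin_span.induct)
    (simp_all add: op_zero_adjointable op_add_adjointable op_scl_adjointable rank_ones_adjointable)

lemma op_add_assoc:
  "\<lbrakk>T \<in> adjointables X Y; S \<in> adjointables X Y; R \<in> adjointables X Y\<rbrakk>
    \<Longrightarrow> op_add X Y (op_add X Y T S) R = op_add X Y T (op_add X Y S R)"
  by (auto simp: op_add_def Y.add_assoc adjointable_closed)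

lemma op_zero_add: "T \<in> adjointables X Y \<Longrightarrow> op_add X Y (op_zero X Y) T = T"
  by (rule adjointable_eqI)
    (auto simp: op_add_adjointable op_zero_adjointable, simp add: op_add_def op_zero_def
      Y.add_commute[OF Y.zro_closed] Y.add_zro adjointable_closed)

lemma finite_rank_add:
  assumes "T \<in> finite_rank" "S \<in> finite_rank"
  shows "op_add X Y T S \<in> finite_rank"
  using assms(1)
proof (induction rule: lin_span.induct)
  case lin_span_zero
  show ?case using assms(2) by (simp add: op_zero_add finite_rank_adjointable)
next
  case (lin_span_step s v c)
  have "op_add X Y (op_add X Y (op_scl X Y c s) v) S = op_add X Y (op_scl X Y c s) (op_add X Y v S)"
    using lin_span_step assms(2)
    by (intro op_add_assoc op_scl_adjointable rank_ones_adjointable finite_rank_adjointable)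
  also have "\<dots> \<in> finite_rank" by (rule lin_span.lin_span_step) (rule lin_span_step)+
  finally show ?case .
qed

lemma finite_rank_scl:
  assumes "T \<in> finite_rank"
  shows "op_scl X Y c T \<in> finite_rank"
  using assms
proof (induction rule: lin_span.induct)
  case lin_span_zero
  have "op_scl X Y c (op_zero X Y) = op_zero X Y"
    by (rule adjointable_eqI)
      (auto simp: op_scl_adjointable op_zero_adjointable, auto simp: op_scl_def op_zero_def Y.closed Y.ip_simps intro!: restrict_ext Y.eq_by_ip)
  then show ?case by (simp add: lin_span.lin_span_zero)
next
  case (lin_span_step s v d)
  have sv: "s \<in> adjointables X Y" "v \<in> adjointables X Y"
    using lin_span_step by (auto intro: rank_ones_adjointable finite_rank_adjointable)
  have "op_scl X Y c (op_add X Y (op_scl X Y d s) v) = op_add X Y (op_scl X Y (c * d) s) (op_scl X Y c v)"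
    using adjointable_closed[OF sv(1)] adjointable_closed[OF sv(2)]
    by (auto simp: op_scl_def op_add_def Y.scl_add Y.scl_scl Y.closed)
  also have "\<dots> \<in> finite_rank" by (rule lin_span.lin_span_step) (rule lin_span_step)+
  finally show ?case .
qed

lemma rank_one_zro_left: "x \<in> car X \<Longrightarrow> rank_one X Y (zro Y) x = op_zero X Y"
  by (auto simp: rank_one_def op_zero_def Y.closed Y.ip_simps intro!: restrict_ext Y.eq_by_ip)

lemma rank_one_zro_right: "y \<in> car Y \<Longrightarrow> rank_one X Y y (zro X) = op_zero X Y"
  by (auto simp: rank_one_def op_zero_def Y.closed Y.ip_simps X.ip_simps intro!: restrict_ext Y.eq_by_ip)

text \<open>The shape of the argument is that of \<open>lin_span_step\<close>, for inductions over a
  span; in the second argument of \<open>rank_one\<close> the scalar is conjugated.\<close>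

lemma rank_one_add_left: "\<lbrakk>y \<in> car Y; y' \<in> car Y; x \<in> car X\<rbrakk> \<Longrightarrow>
    rank_one X Y (add Y (scl Y c y) y') x = op_add X Y (op_scl X Y c (rank_one X Y y x)) (rank_one X Y y' x)"
  by (auto simp: rank_one_def op_add_def op_scl_def Y.act_add_left Y.act_scl_left Y.closed)

lemma rank_one_add_right: "\<lbrakk>y \<in> car Y; x \<in> car X; x' \<in> car X\<rbrakk> \<Longrightarrow>
    rank_one X Y y (add X (scl X c x) x') = op_add X Y (op_scl X Y (cnj c) (rank_one X Y y x)) (rank_one X Y y x')"
  by (auto simp: rank_one_def op_add_def op_scl_def X.ip_simps X.closed Y.act_add_right Y.act_scl_right)

lemma rank_one_hsub_left: "\<lbrakk>y \<in> car Y; y' \<in> car Y; x \<in> car X\<rbrakk> \<Longrightarrow>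
    op_sub X Y (rank_one X Y y x) (rank_one X Y y' x) = rank_one X Y (hsub Y y y') x"
  by (auto simp: rank_one_def op_sub_def Y.closed Y.ip_simps algebra_simps intro!: restrict_ext Y.eq_by_ip)

lemma rank_one_hsub_right: "\<lbrakk>y \<in> car Y; x \<in> car X; x' \<in> car X\<rbrakk> \<Longrightarrow>
    op_sub X Y (rank_one X Y y x) (rank_one X Y y x') = rank_one X Y y (hsub X x x')"
  by (auto simp: rank_one_def op_sub_def X.ip_simps Y.closed Y.ip_simps algebra_simps intro!: restrict_ext Y.eq_by_ip)

lemma compacts_adjointable: "T \<in> compacts X Y \<Longrightarrow> T \<in> adjointables X Y"
  by (simp add: compacts_eq)

lemma op_sub_self: "T \<in> adjointables X Y \<Longrightarrow> op_sub X Y T T = op_zero X Y"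
  by (auto simp: op_sub_def op_zero_def Y.hsub_self adjointable_closed)

lemma finite_rank_compact: "T \<in> finite_rank \<Longrightarrow> T \<in> compacts X Y"
  by (auto simp: compacts_eq finite_rank_adjointable op_sub_self op_norm_zero intro!: bexI[of _ T])

lemma rank_one_finite_rank:
  assumes "y \<in> car Y" "x \<in> car X"
  shows "rank_one X Y y x \<in> finite_rank"
proof -
  have a: "rank_one X Y y x \<in> adjointables X Y" by (rule rank_one_adjointable[OF assms])
  have "op_add X Y (op_scl X Y 1 (rank_one X Y y x)) (op_zero X Y) \<in> finite_rank"
    by (rule lin_span.intros) (use assms in \<open>auto simp: rank_ones_def intro: lin_span.intros\<close>)
  moreover have "op_add X Y (op_scl X Y 1 (rank_one X Y y x)) (op_zero X Y) = rank_one X Y y x"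
    by (rule adjointable_eqI[OF _ a])
      (simp_all add: op_add_adjointable op_scl_adjointable op_zero_adjointable a,
        simp add: op_add_def op_scl_def op_zero_def Y.scl_one Y.add_zro adjointable_closed[OF a])
  ultimately show ?thesis by simp
qed

lemma rank_one_compact: "\<lbrakk>y \<in> car Y; x \<in> car X\<rbrakk> \<Longrightarrow> rank_one X Y y x \<in> compacts X Y"
  by (intro finite_rank_compact rank_one_finite_rank)

lemma op_norm_sub_triangle:
  assumes "T \<in> adjointables X Y" "S \<in> adjointables X Y" "R \<in> adjointables X Y"
  shows "op_norm X Y (op_sub X Y T R) \<le> op_norm X Y (op_sub X Y T S) + op_norm X Y (op_sub X Y S R)"
proof -
  have "hsub Y (T x) (R x) = add Y (hsub Y (T x) (S x)) (hsub Y (S x) (R x))" if "x \<in> car X" for x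
    by (rule Y.eq_by_ip) (use adjointable_closed[OF assms(1) that] adjointable_closed[OF assms(2) that]
      adjointable_closed[OF assms(3) that] in \<open>simp_all add: Y.closed Y.ip_simps\<close>)
  then have "op_sub X Y T R = op_add X Y (op_sub X Y T S) (op_sub X Y S R)"
    by (auto simp: op_sub_def op_add_def)
  then show ?thesis by (simp add: op_norm_add_le op_sub_adjointable assms)
qed

lemma compacts_closed:
  assumes T: "T \<in> adjointables X Y" and "\<And>e. 0 < e \<Longrightarrow> \<exists>S\<in>compacts X Y. op_norm X Y (op_sub X Y T S) < e"
  shows "T \<in> compacts X Y"
  unfolding compacts_eq
proof (intro CollectI conjI allI impI T)
  fix e :: real assume e: "0 < e"
  obtain S where S: "S \<in> compacts X Y" "op_norm X Y (op_sub X Y T S) < e / 2"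
    using assms(2)[of "e / 2"] e by auto
  then obtain R where R: "R \<in> finite_rank" "op_norm X Y (op_sub X Y S R) < e / 2"
    using half_gt_zero[OF e] unfolding compacts_eq by blast
  have "op_norm X Y (op_sub X Y T R) < e"
    using op_norm_sub_triangle[OF T compacts_adjointable[OF S(1)] finite_rank_adjointable[OF R(1)]] S(2) R(2)
    by simp
  with R(1) show "\<exists>S\<in>finite_rank. op_norm X Y (op_sub X Y T S) < e" by blast
qed

lemma compacts_add:
  assumes T: "T \<in> compacts X Y" and S: "S \<in> compacts X Y"
  shows "op_add X Y T S \<in> compacts X Y"
proof (rule compacts_closed)
  note a = compacts_adjointable[OF T] compacts_adjointable[OF S]
  show "op_add X Y T S \<in> adjointables X Y" by (intro op_add_adjointable a)
  fix e :: real assume e: "0 < e"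
  obtain T' where T': "T' \<in> finite_rank" "op_norm X Y (op_sub X Y T T') < e / 2"
    using T half_gt_zero[OF e] unfolding compacts_eq by blast
  obtain S' where S': "S' \<in> finite_rank" "op_norm X Y (op_sub X Y S S') < e / 2"
    using S half_gt_zero[OF e] unfolding compacts_eq by blast
  note b = finite_rank_adjointable[OF T'(1)] finite_rank_adjointable[OF S'(1)]
  have "hsub Y (add Y (T x) (S x)) (add Y (T' x) (S' x)) = add Y (hsub Y (T x) (T' x)) (hsub Y (S x) (S' x))"
    if "x \<in> car X" for x
    by (rule Y.eq_by_ip) (use a[THEN adjointable_closed, OF that] b[THEN adjointable_closed, OF that]
      in \<open>simp_all add: Y.closed Y.ip_simps\<close>)
  then have "op_sub X Y (op_add X Y T S) (op_add X Y T' S') = op_add X Y (op_sub X Y T T') (op_sub X Y S S')"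
    by (auto simp: op_sub_def op_add_def)
  then have "op_norm X Y (op_sub X Y (op_add X Y T S) (op_add X Y T' S')) < e"
    using op_norm_add_le[of "op_sub X Y T T'" "op_sub X Y S S'"] a b T'(2) S'(2) by (simp add: op_sub_adjointable)
  then show "\<exists>R\<in>compacts X Y. op_norm X Y (op_sub X Y (op_add X Y T S) R) < e"
    using finite_rank_compact[OF finite_rank_add[OF T'(1) S'(1)]] by blast
qed

lemma compacts_zero: "op_zero X Y \<in> compacts X Y"
  by (intro finite_rank_compact lin_span.lin_span_zero)

lemma compacts_scl:
  assumes T: "T \<in> compacts X Y"
  shows "op_scl X Y c T \<in> compacts X Y"
proof (rule compacts_closed)
  note a = compacts_adjointable[OF T]
  show "op_scl X Y c T \<in> adjointables X Y" by (intro op_scl_adjointable a)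
  fix e :: real assume e: "0 < e"
  have "0 < e / (cmod c + 1)" using e by (simp add: add_nonneg_pos)
  then obtain T' where T': "T' \<in> finite_rank" "op_norm X Y (op_sub X Y T T') < e / (cmod c + 1)"
    using T unfolding compacts_eq by blast
  note b = finite_rank_adjointable[OF T'(1)]
  have "hsub Y (scl Y c (T x)) (scl Y c (T' x)) = scl Y c (hsub Y (T x) (T' x))" if "x \<in> car X" for x
    by (rule Y.eq_by_ip) (use adjointable_closed[OF a that] adjointable_closed[OF b that]
      in \<open>simp_all add: Y.closed Y.ip_simps cscale_diff_right\<close>)
  then have eq: "op_sub X Y (op_scl X Y c T) (op_scl X Y c T') = op_scl X Y c (op_sub X Y T T')"
    by (auto simp: op_sub_def op_scl_def)
  have "op_norm X Y (op_sub X Y (op_scl X Y c T) (op_scl X Y c T')) \<le> cmod c * op_norm X Y (op_sub X Y T T')"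
    unfolding eq by (intro op_norm_scl_le op_sub_adjointable a b)
  also have "\<dots> \<le> cmod c * (e / (cmod c + 1))" using T'(2) by (intro mult_left_mono) auto
  also have "\<dots> < e" using e by (simp add: divide_less_eq add_nonneg_pos distrib_left mult.commute)
  finally show "\<exists>R\<in>compacts X Y. op_norm X Y (op_sub X Y (op_scl X Y c T) R) < e"
    using finite_rank_compact[OF finite_rank_scl[OF T'(1)]] by blast
qed

end

text \<open>Used with \<open>h = \<Phi>\<close> and with the inverse of \<open>\<Phi>\<close>.\<close>

locale bounded_operator_map = PQ: hilbert_pair P Q + PQ': hilbert_pair P' Q'
  for P :: "('b::cstar_algebra, 'p) hmod" and Q :: "('b, 'q) hmod"
    and P' :: "('a::cstar_algebra, 'p2) hmod" and Q' :: "('a, 'q2) hmod" +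
  fixes h :: "('p \<Rightarrow> 'q) \<Rightarrow> 'p2 \<Rightarrow> 'q2" and C :: real
  assumes h_adjointable: "T \<in> adjointables P Q \<Longrightarrow> h T \<in> adjointables P' Q'"
    and h_add: "\<lbrakk>T \<in> adjointables P Q; S \<in> adjointables P Q\<rbrakk> \<Longrightarrow> h (op_add P Q T S) = op_add P' Q' (h T) (h S)"
    and h_scl: "T \<in> adjointables P Q \<Longrightarrow> h (op_scl P Q c T) = op_scl P' Q' c (h T)"
    and h_bound: "T \<in> adjointables P Q \<Longrightarrow> op_norm P' Q' (h T) \<le> C * op_norm P Q T"
    and C_nonneg: "0 \<le> C"
begin

lemma h_sub: "\<lbrakk>T \<in> adjointables P Q; S \<in> adjointables P Q\<rbrakk> \<Longrightarrow> h (op_sub P Q T S) = op_sub P' Q' (h T) (h S)"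
  by (simp add: PQ.op_sub_eq PQ'.op_sub_eq h_add h_scl PQ.op_scl_adjointable)

text \<open>The image of a limit is a limit of images because \<open>h\<close> is bounded, and
  \<open>compacts\<close> is closed under limits.\<close>

lemma h_closed:
  assumes T: "T \<in> adjointables P Q"
    and e: "\<And>e. 0 < e \<Longrightarrow> \<exists>S\<in>adjointables P Q. h S \<in> compacts P' Q' \<and> op_norm P Q (op_sub P Q T S) \<le> e"
  shows "h T \<in> compacts P' Q'"
proof (rule PQ'.compacts_closed[OF h_adjointable[OF T]])
  fix d :: real assume d: "0 < d"
  have "0 < d / (C + 1)" using d C_nonneg by simp
  then obtain S where S: "S \<in> adjointables P Q" "h S \<in> compacts P' Q'" "op_norm P Q (op_sub P Q T S) \<le> d / (C + 1)"
    using e by blast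
  have "op_norm P' Q' (op_sub P' Q' (h T) (h S)) \<le> C * op_norm P Q (op_sub P Q T S)"
    using h_bound[OF PQ.op_sub_adjointable[OF T S(1)]] by (simp add: h_sub T S)
  also have "\<dots> \<le> C * (d / (C + 1))" using S C_nonneg by (intro mult_left_mono)
  also have "\<dots> < d" using d C_nonneg by (simp add: divide_less_eq algebra_simps)
  finally show "\<exists>S\<in>compacts P' Q'. op_norm P' Q' (op_sub P' Q' (h T) S) < d" using S(2) by blast
qed

lemma h_zero: "h (op_zero P Q) \<in> compacts P' Q'"
proof -
  have "op_scl P Q 0 (op_zero P Q) = op_zero P Q"
    by (auto simp: op_scl_def op_zero_def PQ.Y.closed PQ.Y.ip_simps intro!: restrict_ext PQ.Y.eq_by_ip)
  then have "h (op_zero P Q) = op_scl P' Q' 0 (h (op_zero P Q))" by (metis h_scl PQ.op_zero_adjointable)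
  also have "\<dots> = op_zero P' Q'"
    using PQ'.adjointable_closed[OF h_adjointable[OF PQ.op_zero_adjointable]]
    by (auto simp: op_scl_def op_zero_def PQ'.Y.closed PQ'.Y.ip_simps intro!: restrict_ext PQ'.Y.eq_by_ip)
  finally show ?thesis by (simp add: PQ'.compacts_zero)
qed

text \<open>\<open>rank_one\<close> is linear in y, antilinear in x and continuous in each. The
  property therefore passes from A and B to their spans and closures in one variable after the
  other, then to operators of finite rank and to their limits. A or B will be a set of pure
  tensors.\<close>

lemma h_compact:
  assumes A: "A \<subseteq> car Q" "spans_densely Q A" and B: "B \<subseteq> car P" "spans_densely P B"
    and h: "\<And>y x. \<lbrakk>y \<in> A; x \<in> B\<rbrakk> \<Longrightarrow> h (rank_one P Q y x) \<in> compacts P' Q'"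
    and T: "T \<in> compacts P Q"
  shows "h T \<in> compacts P' Q'"
proof -
  note lin = PQ.op_add_adjointable PQ.op_scl_adjointable PQ.rank_one_adjointable
  have 1: "h (rank_one P Q y x) \<in> compacts P' Q'"
    if y: "y \<in> lin_span (zro Q) (add Q) (scl Q) A" and x: "x \<in> B" for y x
    using y
  proof (induction rule: lin_span.induct)
    case lin_span_zero
    then show ?case using x B by (simp add: PQ.rank_one_zro_left h_zero subset_iff)
  next
    case (lin_span_step s v c)
    have c: "s \<in> car Q" "v \<in> car Q" "x \<in> car P"
      using lin_span_step(1) A x B PQ.Y.lin_span_closed[OF A(1) lin_span_step(2)] by auto
    show ?case unfolding PQ.rank_one_add_left[OF c]
      using lin_span_step(3) h[OF lin_span_step(1) x] c
      by (simp add: h_add h_scl lin PQ'.compacts_add PQ'.compacts_scl)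
  qed
  have 2: "h (rank_one P Q y x) \<in> compacts P' Q'" if y: "y \<in> car Q" and x: "x \<in> B" for y x
  proof (rule h_closed)
    have xc: "x \<in> car P" using x B by auto
    show "rank_one P Q y x \<in> adjointables P Q" using y xc by (rule lin)
    fix e :: real assume e: "0 < e"
    have "0 < e / (hnorm P x + 1)" using e PQ.X.hnorm_nonneg[of x] by simp
    then obtain v where v: "v \<in> lin_span (zro Q) (add Q) (scl Q) A" "hnorm Q (hsub Q y v) < e / (hnorm P x + 1)"
      using A(2) y unfolding spans_densely_def by blast
    have vc: "v \<in> car Q" by (rule PQ.Y.lin_span_closed[OF A(1) v(1)])
    have "op_norm P Q (rank_one P Q (hsub Q y v) x) \<le> hnorm Q (hsub Q y v) * hnorm P x"
      by (intro PQ.op_norm_rank_one_le PQ.Y.closed y vc xc)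
    also have "\<dots> \<le> e / (hnorm P x + 1) * (hnorm P x + 1)"
      using v(2) PQ.X.hnorm_nonneg[of x] PQ.Y.hnorm_nonneg by (intro mult_mono) (auto intro: less_imp_le order_trans)
    also have "\<dots> = e" using PQ.X.hnorm_nonneg[of x] by simp
    finally show "\<exists>S\<in>adjointables P Q. h S \<in> compacts P' Q' \<and> op_norm P Q (op_sub P Q (rank_one P Q y x) S) \<le> e"
      by (intro bexI[of _ "rank_one P Q v x"] conjI 1[OF v(1) x] lin vc xc)
        (simp add: PQ.rank_one_hsub_left y vc xc)
  qed
  have 3: "h (rank_one P Q y x) \<in> compacts P' Q'"
    if y: "y \<in> car Q" and x: "x \<in> lin_span (zro P) (add P) (scl P) B" for y x
    using x
  proof (induction rule: lin_span.induct)
    case lin_span_zero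
    then show ?case using y by (simp add: PQ.rank_one_zro_right h_zero)
  next
    case (lin_span_step s v c)
    have c: "y \<in> car Q" "s \<in> car P" "v \<in> car P"
      using lin_span_step(1) y B PQ.X.lin_span_closed[OF B(1) lin_span_step(2)] by auto
    show ?case unfolding PQ.rank_one_add_right[OF c]
      using lin_span_step(3) 2[OF y lin_span_step(1)] c
      by (simp add: h_add h_scl lin PQ'.compacts_add PQ'.compacts_scl)
  qed
  have 4: "h (rank_one P Q y x) \<in> compacts P' Q'" if y: "y \<in> car Q" and x: "x \<in> car P" for y x
  proof (rule h_closed)
    show "rank_one P Q y x \<in> adjointables P Q" using y x by (rule lin)
    fix e :: real assume e: "0 < e"
    have "0 < e / (hnorm Q y + 1)" using e PQ.Y.hnorm_nonneg[of y] by simp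
    then obtain v where v: "v \<in> lin_span (zro P) (add P) (scl P) B" "hnorm P (hsub P x v) < e / (hnorm Q y + 1)"
      using B(2) x unfolding spans_densely_def by blast
    have vc: "v \<in> car P" by (rule PQ.X.lin_span_closed[OF B(1) v(1)])
    have "op_norm P Q (rank_one P Q y (hsub P x v)) \<le> hnorm Q y * hnorm P (hsub P x v)"
      by (intro PQ.op_norm_rank_one_le PQ.X.closed y vc x)
    also have "\<dots> \<le> (hnorm Q y + 1) * (e / (hnorm Q y + 1))"
      using v(2) PQ.Y.hnorm_nonneg[of y] PQ.X.hnorm_nonneg by (intro mult_mono) (auto intro: less_imp_le order_trans)
    also have "\<dots> = e" using PQ.Y.hnorm_nonneg[of y] by simp
    finally show "\<exists>S\<in>adjointables P Q. h S \<in> compacts P' Q' \<and> op_norm P Q (op_sub P Q (rank_one P Q y x) S) \<le> e"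
      by (intro bexI[of _ "rank_one P Q y v"] conjI 3[OF y v(1)] lin y vc)
        (simp add: PQ.rank_one_hsub_right y vc x)
  qed
  have 5: "h S \<in> compacts P' Q'" if "S \<in> PQ.finite_rank" for S
    using that
  proof (induction rule: lin_span.induct)
    case lin_span_zero
    show ?case by (rule h_zero)
  next
    case (lin_span_step s v c)
    have "s \<in> adjointables P Q" "v \<in> adjointables P Q"
      using lin_span_step by (auto intro: PQ.rank_ones_adjointable PQ.finite_rank_adjointable)
    moreover have "h s \<in> compacts P' Q'" using lin_span_step(1) 4 by (auto simp: rank_ones_def)
    ultimately show ?case using lin_span_step(3) 
      by (simp add: h_add h_scl lin PQ'.compacts_add PQ'.compacts_scl)
  qed
  show ?thesis
  proof (rule h_closed[OF PQ.compacts_adjointable[OF T]])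
    fix e :: real assume "0 < e"
    then obtain S where "S \<in> PQ.finite_rank" "op_norm P Q (op_sub P Q T S) < e"
      using T unfolding PQ.compacts_eq by blast
    then show "\<exists>S\<in>adjointables P Q. h S \<in> compacts P' Q' \<and> op_norm P Q (op_sub P Q T S) \<le> e"
      using 5 PQ.finite_rank_adjointable by (intro bexI[of _ S]) auto
  qed
qed

end

text \<open>If \<langle>x, x\<rangle> = \<open>star c * c\<close>, then \<langle>x a, x b\<rangle> =
  \<open>star (c * a) * (c * b)\<close>, so x behaves metrically like c and
  \<open>approximate_factorization\<close> transfers to x.\<close>

lemma (in hilbert_module) rank_one_approximation:
  assumes x: "x \<in> car X" and e: "0 < e"
  obtains w where "w \<in> car X" "hnorm X (hsub X x (act X w (ip X x x))) < e"
proof -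
  obtain c where c: "ip X x x = star c * c" using ip_pos[OF x] unfolding cstar_pos_def by blast
  obtain l a where la: "norm (c - (cscale l c + c * a) * (star c * c)) < e" by (rule approximate_factorization[OF e])
  define w where "w = add X (scl X l x) (act X x a)"
  have w: "w \<in> car X" using x by (simp add: w_def closed)
  define u where "u = hsub X x (act X w (ip X x x))"
  \<comment> \<open>Right multiplication by l + a, an element of the unitization; \<open>w\<close>
    is x (l + a).\<close>
  define g where "g = (\<lambda>b. cscale l b + b * a)"
  define d where "d = c - g c * (star c * c)"
  have "ip X u u = star d * d"
    using x w unfolding u_def d_def g_def w_def
    by (simp add: closed ip_simps c star_diff star_add star_mult star_cscale star_star
        cscale_mult_left cscale_mult_right cscale_cscale algebra_simps cscale_add_right cscale_diff_right)
  then have "hnorm X u = norm d" by (simp add: hnorm_def cstar_identity)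
  then show ?thesis using la w by (intro that[of w]) (simp_all add: u_def d_def g_def)
qed

section \<open>Adjunctions\<close>

lemma (in hilbert_module) spans_densely_car: "spans_densely X (car X)"
  unfolding spans_densely_def
proof (intro ballI allI impI)
  fix x and e :: real assume x: "x \<in> car X" and e: "0 < e"
  have "add X (scl X 1 x) (zro X) \<in> lin_span (zro X) (add X) (scl X) (car X)"
    by (intro lin_span.intros x)
  moreover have "add X (scl X 1 x) (zro X) = x" using x by (simp add: scl_one add_zro)
  ultimately show "\<exists>v\<in>lin_span (zro X) (add X) (scl X) (car X). hnorm X (hsub X x v) < e"
    using x e by (intro bexI[of _ x]) (simp_all add: hsub_self hnorm_zro)
qed

lemma (in hilbert_pair) compose_op_id:
  assumes "T \<in> adjointables X Y"
  shows "compose (car X) (op_id Y) T = T" "compose (car X) T (op_id X) = T"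
  using adjointable_closed[OF assms] adjointable_undefined[OF assms]
  by (auto simp: compose_def op_id_def)

lemma tensor_map_op_id:
  assumes "tensor_functor F l T t" "correspondence F l" "hilbert_module X"
  shows "tensor_map F T t X X (op_id X) = op_id (T X)"
proof -
  interpret tensor F l X "T X" "t X" using assms by (intro tensor.intro) (simp_all add: tensor_functor_def)
  show ?thesis
    by (rule tensor_map_equality[OF assms(1,2,3,3) op_id_adjointable])
      (simp add: op_id_def t_closed)
qed

lemma tensor_map_linear:
  assumes T: "tensor_functor F l T t" "correspondence F l" "hilbert_module X" "hilbert_module X'"
    and S: "S \<in> adjointables X X'" and R: "R \<in> adjointables X X'"
  shows "tensor_map F T t X X' (op_add X X' S R)
      = op_add (T X) (T X') (tensor_map F T t X X' S) (tensor_map F T t X X' R)"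
    "tensor_map F T t X X' (op_scl X X' c S) = op_scl (T X) (T X') c (tensor_map F T t X X' S)"
proof -
  interpret tensor_pair F l X "T X" "t X" X' "T X'" "t X'"
    using assms by (intro tensor_pair.intro tensor.intro) (simp_all add: tensor_functor_def)
  note tm = tensor_map[OF T S] tensor_map[OF T R]
  show "tensor_map F T t X X' (op_add X X' S R)
      = op_add (T X) (T X') (tensor_map F T t X X' S) (tensor_map F T t X X' R)"
    by (rule tensor_map_equality[OF T HH.op_add_adjointable[OF tm(1,4)]])
      (simp add: op_add_def T.t_closed tm(2,5) T'.t_add XX.adjointable_closed[OF S] XX.adjointable_closed[OF R])
  show "tensor_map F T t X X' (op_scl X X' c S) = op_scl (T X) (T X') c (tensor_map F T t X X' S)"
    by (rule tensor_map_equality[OF T HH.op_scl_adjointable[OF tm(1)]])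
      (simp add: op_scl_def T.t_closed tm(2) T'.t_scl XX.adjointable_closed[OF S])
qed

section \<open>Unit, counit and the bounded maps they induce\<close>

locale tensor_adjunction =
  fixes F :: "('b::cstar_algebra, 'f) hmod" and lF :: "'a::cstar_algebra \<Rightarrow> 'f \<Rightarrow> 'f"
    and E :: "('a, 'e) hmod" and lE :: "'b \<Rightarrow> 'e \<Rightarrow> 'e"
    and TF :: "('a, 'x) hmod \<Rightarrow> ('b, 'y) hmod" and tF :: "('a, 'x) hmod \<Rightarrow> 'x \<Rightarrow> 'f \<Rightarrow> 'y"
    and TE :: "('b, 'y) hmod \<Rightarrow> ('a, 'x) hmod" and tE :: "('b, 'y) hmod \<Rightarrow> 'y \<Rightarrow> 'e \<Rightarrow> 'x"
    and \<Phi> :: "('a, 'x) hmod \<Rightarrow> ('b, 'y) hmod \<Rightarrow> ('y \<Rightarrow> 'y) \<Rightarrow> ('x \<Rightarrow> 'x)"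
  assumes F: "correspondence F lF" and E: "correspondence E lE"
    and TF: "tensor_functor F lF TF tF" and TE: "tensor_functor E lE TE tE"
    and adj: "adjunction F TF tF E TE tE \<Phi>"
begin

lemma bij: "\<lbrakk>hilbert_module X; hilbert_module Y\<rbrakk>
    \<Longrightarrow> bij_betw (\<Phi> X Y) (adjointables (TF X) Y) (adjointables X (TE Y))"
  using adj by (simp add: adjunction_def natural_isomorphism_def)

lemma natural: "\<lbrakk>hilbert_module X; hilbert_module X'; hilbert_module Y; hilbert_module Y';
      S \<in> adjointables X' X; R \<in> adjointables Y Y'; T \<in> adjointables (TF X) Y\<rbrakk> \<Longrightarrow>
    \<Phi> X' Y' (compose (car (TF X')) R (compose (car (TF X')) T (tensor_map F TF tF X' X S)))
      = compose (car X') (tensor_map E TE tE Y Y' R) (compose (car X') (\<Phi> X Y T) S)"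
  using adj unfolding adjunction_def natural_isomorphism_def by blast

lemma modules: "hilbert_module X \<Longrightarrow> hilbert_module (TF X)" "hilbert_module Y \<Longrightarrow> hilbert_module (TE Y)"
  using TF TE by (simp_all add: tensor_functor_def tensor_product_def)

definition unit :: "('a, 'x) hmod \<Rightarrow> 'x \<Rightarrow> 'x" where
  "unit X = \<Phi> X (TF X) (op_id (TF X))"

definition inverse_adj :: "('a, 'x) hmod \<Rightarrow> ('b, 'y) hmod \<Rightarrow> ('x \<Rightarrow> 'x) \<Rightarrow> 'y \<Rightarrow> 'y" where
  "inverse_adj X Y = inv_into (adjointables (TF X) Y) (\<Phi> X Y)"

definition counit :: "('b, 'y) hmod \<Rightarrow> 'y \<Rightarrow> 'y" where
  "counit Y = inverse_adj (TE Y) Y (op_id (TE Y))"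

end

text \<open>The objects X and Y are locale parameters so that the facts can be instantiated at other
  pairs, as is done with \<open>TE Y\<close> for X to treat the counit.\<close>

locale tensor_adjunction_at = tensor_adjunction F lF E lE TF tF TE tE \<Phi>
  for F :: "('b::cstar_algebra, 'f) hmod" and lF :: "'a::cstar_algebra \<Rightarrow> 'f \<Rightarrow> 'f"
    and E :: "('a, 'e) hmod" and lE :: "'b \<Rightarrow> 'e \<Rightarrow> 'e"
    and TF :: "('a, 'x) hmod \<Rightarrow> ('b, 'y) hmod" and tF :: "('a, 'x) hmod \<Rightarrow> 'x \<Rightarrow> 'f \<Rightarrow> 'y"
    and TE :: "('b, 'y) hmod \<Rightarrow> ('a, 'x) hmod" and tE :: "('b, 'y) hmod \<Rightarrow> 'y \<Rightarrow> 'e \<Rightarrow> 'x"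
    and \<Phi> :: "('a, 'x) hmod \<Rightarrow> ('b, 'y) hmod \<Rightarrow> ('y \<Rightarrow> 'y) \<Rightarrow> ('x \<Rightarrow> 'x)" +
  fixes X :: "('a, 'x) hmod" and Y :: "('b, 'y) hmod"
  assumes X: "hilbert_module X" and Y: "hilbert_module Y"
begin

sublocale FX: tensor F lF X "TF X" "tF X"
  by (intro tensor.intro) (use F X TF in \<open>simp_all add: tensor_functor_def\<close>)

sublocale EY: tensor E lE Y "TE Y" "tE Y"
  by (intro tensor.intro) (use E Y TE in \<open>simp_all add: tensor_functor_def\<close>)

sublocale left: hilbert_pair "TF X" Y ..
sublocale right: hilbert_pair X "TE Y" ..
sublocale XX: hilbert_pair X X ..
sublocale YY: hilbert_pair Y Y ..

lemma \<Phi>_adjointable: "T \<in> adjointables (TF X) Y \<Longrightarrow> \<Phi> X Y T \<in> adjointables X (TE Y)"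
  using bij_betwE[OF bij[OF X Y]] by blast

lemma inverse_adjointable: "S \<in> adjointables X (TE Y) \<Longrightarrow> inverse_adj X Y S \<in> adjointables (TF X) Y"
  unfolding inverse_adj_def using bij[OF X Y] by (metis bij_betw_def inv_into_into)

lemma \<Phi>_inverse: "S \<in> adjointables X (TE Y) \<Longrightarrow> \<Phi> X Y (inverse_adj X Y S) = S"
  unfolding inverse_adj_def using bij_betw_inv_into_right[OF bij[OF X Y]] .

lemma inverse_\<Phi>: "T \<in> adjointables (TF X) Y \<Longrightarrow> inverse_adj X Y (\<Phi> X Y T) = T"
  unfolding inverse_adj_def using bij_betw_inv_into_left[OF bij[OF X Y]] .

lemma unit_adjointable: "unit X \<in> adjointables X (TE (TF X))"
  unfolding unit_def using bij_betwE[OF bij[OF X modules(1)[OF X]]] op_id_adjointable by blast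

lemma \<Phi>_eq:
  assumes T: "T \<in> adjointables (TF X) Y"
  shows "\<Phi> X Y T = compose (car X) (tensor_map E TE tE (TF X) Y T) (unit X)"
proof -
  interpret U: hilbert_pair X "TE (TF X)" by (intro hilbert_pair.intro X modules)
  interpret H: hilbert_pair "TF X" "TF X" by (intro hilbert_pair.intro X modules)
  have "\<Phi> X Y (compose (car (TF X)) T (compose (car (TF X)) (op_id (TF X)) (tensor_map F TF tF X X (op_id X))))
      = compose (car X) (tensor_map E TE tE (TF X) Y T) (compose (car X) (\<Phi> X (TF X) (op_id (TF X))) (op_id X))"
    by (intro natural X Y modules T op_id_adjointable)
  then show ?thesis
    by (simp add: tensor_map_op_id[OF TF F X] H.compose_op_id op_id_adjointable left.compose_op_id[OF T]
        unit_def[symmetric] U.compose_op_id[OF unit_adjointable])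
qed

lemma counit_adjointable: "counit Y \<in> adjointables (TF (TE Y)) Y"
  "\<Phi> (TE Y) Y (counit Y) = op_id (TE Y)"
proof -
  have m: "hilbert_module (TE Y)" using Y by (rule modules)
  interpret at_TE: tensor_adjunction_at F lF E lE TF tF TE tE \<Phi> "TE Y" Y
    by (intro tensor_adjunction_at.intro tensor_adjunction_axioms tensor_adjunction_at_axioms.intro m Y)
  show "counit Y \<in> adjointables (TF (TE Y)) Y" "\<Phi> (TE Y) Y (counit Y) = op_id (TE Y)"
    unfolding counit_def
    by (rule at_TE.inverse_adjointable[OF op_id_adjointable] at_TE.\<Phi>_inverse[OF op_id_adjointable])+
qed

text \<open>Naturality along S, applied to the counit, shows that \<open>\<Phi>\<close> sends the
  right-hand side to the composite of the identity of \<open>TE Y\<close> with S.\<close>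

lemma inverse_eq:
  assumes S: "S \<in> adjointables X (TE Y)"
  shows "inverse_adj X Y S = compose (car (TF X)) (counit Y) (tensor_map F TF tF X (TE Y) S)"
proof -
  have m: "hilbert_module (TE Y)" "hilbert_module (TF (TE Y))" "hilbert_module (TF X)" using X Y by (simp_all add: modules)
  note tm = tensor_map(1)[OF TF F X m(1) S]
  have c: "compose (car (TF X)) (counit Y) (tensor_map F TF tF X (TE Y) S) \<in> adjointables (TF X) Y"
    by (rule compose_adjointable[OF m(3,2) Y tm counit_adjointable(1)])
  have "\<Phi> X Y (compose (car (TF X)) (op_id Y) (compose (car (TF X)) (counit Y) (tensor_map F TF tF X (TE Y) S)))
      = compose (car X) (tensor_map E TE tE Y Y (op_id Y)) (compose (car X) (\<Phi> (TE Y) Y (counit Y)) S)"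
    by (rule natural[OF m(1) X Y Y S op_id_adjointable counit_adjointable(1)])
  then have "\<Phi> X Y (compose (car (TF X)) (counit Y) (tensor_map F TF tF X (TE Y) S)) = S"
    by (simp add: left.compose_op_id[OF c] tensor_map_op_id[OF TE E Y] counit_adjointable(2) right.compose_op_id[OF S])
  then show ?thesis using inverse_\<Phi>[OF c] by simp
qed

sublocale \<Phi>_map: bounded_operator_map "TF X" Y X "TE Y" "\<Phi> X Y" "op_norm X (TE (TF X)) (unit X)"
proof
  have m: "hilbert_module (TF X)" "hilbert_module (TE (TF X))" "hilbert_module (TE Y)" using X Y by (simp_all add: modules)
  interpret U: hilbert_pair X "TE (TF X)" by (intro hilbert_pair.intro X m)
  note uc = U.adjointable_closed[OF unit_adjointable]
  note tm = tensor_map[OF TE E m(1) Y] tensor_map_linear[OF TE E m(1) Y]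
  fix T S and c
  show "0 \<le> op_norm X (TE (TF X)) (unit X)" by (rule U.op_norm_nonneg[OF unit_adjointable])
  assume T: "T \<in> adjointables (TF X) Y"
  show "\<Phi> X Y T \<in> adjointables X (TE Y)" by (rule \<Phi>_adjointable[OF T])
  show "\<Phi> X Y (op_scl (TF X) Y c T) = op_scl X (TE Y) c (\<Phi> X Y T)"
    unfolding \<Phi>_eq[OF T] \<Phi>_eq[OF left.op_scl_adjointable[OF T]] tm(5)[OF T T]
    by (auto simp: compose_def op_scl_def uc intro!: restrict_ext)
  have "op_norm X (TE Y) (\<Phi> X Y T)
      \<le> op_norm (TE (TF X)) (TE Y) (tensor_map E TE tE (TF X) Y T) * op_norm X (TE (TF X)) (unit X)"
    unfolding \<Phi>_eq[OF T] by (rule op_norm_compose_le[OF X m(2,3) unit_adjointable tm(1)[OF T]])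
  also have "\<dots> \<le> op_norm (TF X) Y T * op_norm X (TE (TF X)) (unit X)"
    by (intro mult_right_mono tm(3)[OF T] U.op_norm_nonneg[OF unit_adjointable])
  finally show "op_norm X (TE Y) (\<Phi> X Y T) \<le> op_norm X (TE (TF X)) (unit X) * op_norm (TF X) Y T"
    by (simp add: mult.commute)
  assume S: "S \<in> adjointables (TF X) Y"
  show "\<Phi> X Y (op_add (TF X) Y T S) = op_add X (TE Y) (\<Phi> X Y T) (\<Phi> X Y S)"
    unfolding \<Phi>_eq[OF T] \<Phi>_eq[OF S] \<Phi>_eq[OF left.op_add_adjointable[OF T S]] tm(4)[OF T S]
    by (auto simp: compose_def op_add_def uc intro!: restrict_ext)
qed

sublocale inverse_map: bounded_operator_map X "TE Y" "TF X" Y "inverse_adj X Y" "op_norm (TF (TE Y)) Y (counit Y)"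
proof
  have m: "hilbert_module (TE Y)" "hilbert_module (TF (TE Y))" "hilbert_module (TF X)" using X Y by (simp_all add: modules)
  interpret U: hilbert_pair "TF (TE Y)" Y by (intro hilbert_pair.intro Y m)
  interpret V: hilbert_pair "TF X" "TF (TE Y)" by (intro hilbert_pair.intro m)
  note cl = U.adjointable_linear[OF counit_adjointable(1)]
  note tm = tensor_map[OF TF F X m(1)] tensor_map_linear[OF TF F X m(1)]
  fix T S and c
  show "0 \<le> op_norm (TF (TE Y)) Y (counit Y)" by (rule U.op_norm_nonneg[OF counit_adjointable(1)])
  assume T: "T \<in> adjointables X (TE Y)"
  note Tc = V.adjointable_closed[OF tm(1)[OF T]]
  show "inverse_adj X Y T \<in> adjointables (TF X) Y" by (rule inverse_adjointable[OF T])
  show "inverse_adj X Y (op_scl X (TE Y) c T) = op_scl (TF X) Y c (inverse_adj X Y T)"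
    unfolding inverse_eq[OF T] inverse_eq[OF right.op_scl_adjointable[OF T]] tm(5)[OF T T]
    by (auto simp: compose_def op_scl_def cl Tc intro!: restrict_ext)
  have "op_norm (TF X) Y (inverse_adj X Y T)
      \<le> op_norm (TF (TE Y)) Y (counit Y) * op_norm (TF X) (TF (TE Y)) (tensor_map F TF tF X (TE Y) T)"
    unfolding inverse_eq[OF T] by (rule op_norm_compose_le[OF m(3,2) Y tm(1)[OF T] counit_adjointable(1)])
  also have "\<dots> \<le> op_norm (TF (TE Y)) Y (counit Y) * op_norm X (TE Y) T"
    by (intro mult_left_mono tm(3)[OF T] U.op_norm_nonneg[OF counit_adjointable(1)])
  finally show "op_norm (TF X) Y (inverse_adj X Y T) \<le> op_norm (TF (TE Y)) Y (counit Y) * op_norm X (TE Y) T" .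
  assume S: "S \<in> adjointables X (TE Y)"
  note Sc = V.adjointable_closed[OF tm(1)[OF S]]
  show "inverse_adj X Y (op_add X (TE Y) T S) = op_add (TF X) Y (inverse_adj X Y T) (inverse_adj X Y S)"
    unfolding inverse_eq[OF T] inverse_eq[OF S] inverse_eq[OF right.op_add_adjointable[OF T S]] tm(4)[OF T S]
       
    by (auto simp: compose_def op_add_def cl Tc Sc intro!: restrict_ext)
qed

section \<open>Rank one operators under \<Phi> and its inverse\<close>

text \<open>For v = w \<langle>x, x\<rangle> the identity \<langle>v, x'\<rangle> = \<langle>x, K
  x'\<rangle> shows that T (K \<otimes> 1) is exactly y \<otimes> (v \<otimes> f)^*, that is T with
  x replaced by v. The error is thus governed by x - v alone.\<close>

lemma \<Phi>_rank_one_compact: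
  assumes y: "y \<in> car Y" and x: "x \<in> car X" and f: "f \<in> car F"
  shows "\<Phi> X Y (rank_one (TF X) Y y (tF X x f)) \<in> compacts X (TE Y)"
proof (rule \<Phi>_map.h_closed)
  define T where "T = rank_one (TF X) Y y (tF X x f)"
  have T: "T \<in> adjointables (TF X) Y" unfolding T_def by (intro left.rank_one_adjointable y FX.t_closed x f)
  then show "rank_one (TF X) Y y (tF X x f) \<in> adjointables (TF X) Y" by (simp add: T_def)
  fix e :: real assume e: "0 < e"
  define M where "M = hnorm Y y * hnorm F f"
  have M: "0 \<le> M" by (simp add: M_def EY.X.hnorm_nonneg FX.F.hnorm_nonneg)
  have "0 < e / (M + 1)" using e M by simp
  then obtain w where w: "w \<in> car X" "hnorm X (hsub X x (act X w (ip X x x))) < e / (M + 1)"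
    using FX.X.rank_one_approximation[OF x] by metis
  define v where "v = act X w (ip X x x)"
  have v: "v \<in> car X" using w x by (simp add: v_def FX.X.closed)
  define K where "K = rank_one X X x w"
  have K: "K \<in> adjointables X X" unfolding K_def by (intro XX.rank_one_adjointable x w)
  define S where "S = rank_one (TF X) Y y (tF X v f)"
  have S: "S \<in> adjointables (TF X) Y" unfolding S_def by (intro left.rank_one_adjointable y FX.t_closed v f)
  note tm = tensor_map[OF TF F X X K]
  have TK: "compose (car (TF X)) T (tensor_map F TF tF X X K) \<in> adjointables (TF X) Y"
    by (rule compose_adjointable[OF modules(1)[OF X] modules(1)[OF X] Y tm(1) T])
  have ST: "S = compose (car (TF X)) T (tensor_map F TF tF X X K)"
  proof (rule left.adjointable_eq_on_dense[OF S TK _ FX.t_dense])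
    show "{tF X x f |x f. x \<in> car X \<and> f \<in> car F} \<subseteq> car (TF X)" using FX.t_closed by auto
    fix z assume "z \<in> {tF X x f |x f. x \<in> car X \<and> f \<in> car F}"
    then obtain x' f' where z: "z = tF X x' f'" "x' \<in> car X" "f' \<in> car F" by blast
    have "ip X v x' = ip X x x * ip X w x'"
      using w x z by (simp add: v_def FX.X.ip_simps FX.X.ip_star)
    moreover have "ip X x (K x') = ip X x x * ip X w x'"
      using w x z by (simp add: K_def rank_one_def FX.X.ip_simps FX.X.closed)
    ultimately have "ip (TF X) (tF X v f) z = ip (TF X) (tF X x f) (tF X (K x') f')"
      using z v x f XX.adjointable_closed[OF K] by (simp add: FX.ip_t)
    then show "S z = compose (car (TF X)) T (tensor_map F TF tF X X K) z"
      using z XX.adjointable_closed[OF K]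
      by (simp add: S_def T_def rank_one_def compose_def FX.t_closed tm(2))
  qed
  have "\<Phi> X Y (compose (car (TF X)) (op_id Y) (compose (car (TF X)) T (tensor_map F TF tF X X K)))
      = compose (car X) (tensor_map E TE tE Y Y (op_id Y)) (compose (car X) (\<Phi> X Y T) K)"
    by (rule natural[OF X X Y Y K op_id_adjointable T])
  moreover have "compose (car X) (\<Phi> X Y T) K \<in> adjointables X (TE Y)"
    by (rule compose_adjointable[OF X X modules(2)[OF Y] K \<Phi>_adjointable[OF T]])
  ultimately have "\<Phi> X Y S = compose (car X) (\<Phi> X Y T) K"
    by (simp add: ST left.compose_op_id[OF TK] tensor_map_op_id[OF TE E Y] right.compose_op_id)
  \<comment> \<open>The operator \<open>\<Phi> X Y T\<close> is A-linear and K z = x \<langle>w,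
    z\<rangle>, so the composite maps z to (\<open>\<Phi> X Y T\<close> x) \<langle>w,
    z\<rangle>.\<close>
  also have "\<dots> = rank_one X (TE Y) (\<Phi> X Y T x) w"
    using x by (auto simp: K_def rank_one_def compose_def right.adjointable_linear(3)[OF \<Phi>_adjointable[OF T]])
  also have "\<dots> \<in> compacts X (TE Y)"
    by (intro right.rank_one_compact right.adjointable_closed[OF \<Phi>_adjointable[OF T]] x w)
  finally have "\<Phi> X Y S \<in> compacts X (TE Y)" .
  moreover have "op_norm (TF X) Y (op_sub (TF X) Y T S) \<le> e"
  proof -
    have "op_sub (TF X) Y T S = rank_one (TF X) Y y (tF X (hsub X x v) f)"
      unfolding T_def S_def using x v y f by (simp add: left.rank_one_hsub_right FX.t_closed FX.t_hsub)
    then have "op_norm (TF X) Y (op_sub (TF X) Y T S) \<le> hnorm Y y * hnorm (TF X) (tF X (hsub X x v) f)"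
      using left.op_norm_rank_one_le[of y "tF X (hsub X x v) f"] x v y f by (simp add: FX.t_closed FX.X.closed)
    also have "\<dots> \<le> hnorm Y y * (hnorm X (hsub X x v) * hnorm F f)"
      by (intro mult_left_mono FX.hnorm_t_le FX.X.closed x v f EY.X.hnorm_nonneg)
    also have "\<dots> = M * hnorm X (hsub X x v)" by (simp add: M_def mult_ac)
    also have "\<dots> \<le> (M + 1) * (e / (M + 1))"
      using w(2) M by (intro mult_mono) (auto simp: v_def FX.X.hnorm_nonneg)
    also have "\<dots> = e" using M by simp
    finally show ?thesis .
  qed
  ultimately show "\<exists>S\<in>adjointables (TF X) Y. \<Phi> X Y S \<in> compacts X (TE Y) \<and>
      op_norm (TF X) Y (op_sub (TF X) Y (rank_one (TF X) Y y (tF X x f)) S) \<le> e"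
    using S unfolding T_def by blast
qed

text \<open>Here the approximation acts on the left: L = w \<otimes> y^* maps y to v = w \<langle>y,
  y\<rangle>, so (L \<otimes> 1) T is T with y replaced by v, and the inverse of
  \<open>\<Phi>\<close> sends it to L composed with the preimage of T.\<close>

lemma inverse_rank_one_compact:
  assumes x: "x \<in> car X" and y: "y \<in> car Y" and f: "f \<in> car E"
  shows "inverse_adj X Y (rank_one X (TE Y) (tE Y y f) x) \<in> compacts (TF X) Y"
proof (rule inverse_map.h_closed)
  define T where "T = rank_one X (TE Y) (tE Y y f) x"
  have T: "T \<in> adjointables X (TE Y)" unfolding T_def by (intro right.rank_one_adjointable x EY.t_closed y f)
  then show "rank_one X (TE Y) (tE Y y f) x \<in> adjointables X (TE Y)" by (simp add: T_def)
  fix e :: real assume e: "0 < e"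
  define M where "M = hnorm E f * hnorm X x"
  have M: "0 \<le> M" by (simp add: M_def EY.F.hnorm_nonneg FX.X.hnorm_nonneg)
  have "0 < e / (M + 1)" using e M by simp
  then obtain w where w: "w \<in> car Y" "hnorm Y (hsub Y y (act Y w (ip Y y y))) < e / (M + 1)"
    using EY.X.rank_one_approximation[OF y] by metis
  define v where "v = act Y w (ip Y y y)"
  have v: "v \<in> car Y" using w y by (simp add: v_def EY.X.closed)
  define L where "L = rank_one Y Y w y"
  have L: "L \<in> adjointables Y Y" unfolding L_def by (intro YY.rank_one_adjointable y w)
  have Ly: "L y = v" using y by (simp add: L_def rank_one_def v_def)
  define S where "S = rank_one X (TE Y) (tE Y v f) x"
  have S: "S \<in> adjointables X (TE Y)" unfolding S_def by (intro right.rank_one_adjointable x EY.t_closed v f)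
  note tm = tensor_map[OF TE E Y Y L]
  interpret EE: hilbert_pair "TE Y" "TE Y" ..
  have ST: "S = compose (car X) (tensor_map E TE tE Y Y L) T"
    using y f by (auto simp: S_def T_def rank_one_def compose_def EE.adjointable_linear(3)[OF tm(1)] EY.t_closed tm(2) Ly)
  note iT = inverse_adjointable[OF T]
  define R where "R = compose (car (TF X)) L (inverse_adj X Y T)"
  have R: "R \<in> adjointables (TF X) Y"
    unfolding R_def by (rule compose_adjointable[OF modules(1)[OF X] Y Y iT L])
  have "\<Phi> X Y (compose (car (TF X)) L (compose (car (TF X)) (inverse_adj X Y T) (tensor_map F TF tF X X (op_id X))))
      = compose (car X) (tensor_map E TE tE Y Y L) (compose (car X) (\<Phi> X Y (inverse_adj X Y T)) (op_id X))"
    by (rule natural[OF X X Y Y op_id_adjointable L iT])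
  then have "\<Phi> X Y R = S"
    by (simp add: R_def ST tensor_map_op_id[OF TF F X] left.compose_op_id[OF iT] \<Phi>_inverse[OF T] right.compose_op_id[OF T])
  then have "inverse_adj X Y S = R" using inverse_\<Phi>[OF R] by simp
  moreover obtain T' where T': "is_adjoint (TF X) Y (inverse_adj X Y T) T'" using left.adjoint_exists[OF iT] .
  \<comment> \<open>L applied after an operator has rank one only because that operator has an
    adjoint: \<langle>y, Q z\<rangle> = \<langle>Q^* y, z\<rangle> for the preimage Q of T.\<close>
  have "R = rank_one (TF X) Y w (T' y)"
    using y left.adjointable_closed[OF iT] by (auto simp: R_def L_def rank_one_def compose_def left.ip_adjoint(2)[OF iT T'])
  then have "R \<in> compacts (TF X) Y"
    using left.rank_one_compact[OF w(1) left.adjoint_closed[OF T' y]] by simp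
  moreover have "op_norm X (TE Y) (op_sub X (TE Y) T S) \<le> e"
  proof -
    have "op_sub X (TE Y) T S = rank_one X (TE Y) (tE Y (hsub Y y v) f) x"
      unfolding T_def S_def using x v y f by (simp add: right.rank_one_hsub_left EY.t_closed EY.t_hsub)
    then have "op_norm X (TE Y) (op_sub X (TE Y) T S) \<le> hnorm (TE Y) (tE Y (hsub Y y v) f) * hnorm X x"
      using right.op_norm_rank_one_le[of "tE Y (hsub Y y v) f" x] x v y f by (simp add: EY.t_closed EY.X.closed)
    also have "\<dots> \<le> (hnorm Y (hsub Y y v) * hnorm E f) * hnorm X x"
      by (intro mult_right_mono EY.hnorm_t_le EY.X.closed y v f FX.X.hnorm_nonneg)
    also have "\<dots> = M * hnorm Y (hsub Y y v)" by (simp add: M_def mult_ac)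
    also have "\<dots> \<le> (M + 1) * (e / (M + 1))"
      using w(2) M by (intro mult_mono) (auto simp: v_def EY.X.hnorm_nonneg)
    also have "\<dots> = e" using M by simp
    finally show ?thesis .
  qed
  ultimately show "\<exists>S\<in>adjointables X (TE Y). inverse_adj X Y S \<in> compacts (TF X) Y \<and>
      op_norm X (TE Y) (op_sub X (TE Y) (rank_one X (TE Y) (tE Y y f) x) S) \<le> e"
    using S unfolding T_def by (intro bexI[of _ S] conjI) simp_all
qed

lemma \<Phi>_compact: "T \<in> compacts (TF X) Y \<Longrightarrow> \<Phi> X Y T \<in> compacts X (TE Y)"
  by (rule \<Phi>_map.h_compact[OF subset_refl EY.X.spans_densely_car _ FX.t_dense])
    (auto simp: FX.t_closed \<Phi>_rank_one_compact)

lemma inverse_compact: "S \<in> compacts X (TE Y) \<Longrightarrow> inverse_adj X Y S \<in> compacts (TF X) Y"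
  by (rule inverse_map.h_compact[OF _ EY.t_dense subset_refl FX.X.spans_densely_car])
    (auto simp: EY.t_closed inverse_rank_one_compact)

lemma bij_compacts: "bij_betw (\<Phi> X Y) (compacts (TF X) Y) (compacts X (TE Y))"
  by (rule bij_betw_byWitness[where f'="inverse_adj X Y"])
    (auto simp: \<Phi>_compact inverse_compact \<Phi>_inverse inverse_\<Phi> left.compacts_adjointable right.compacts_adjointable)

lemma \<Phi>_continuous:
  assumes T: "T \<in> compacts (TF X) Y" and e: "0 < e"
  shows "\<exists>d>0. \<forall>S\<in>compacts (TF X) Y. op_norm (TF X) Y (op_sub (TF X) Y S T) < d \<longrightarrow>
    op_norm X (TE Y) (op_sub X (TE Y) (\<Phi> X Y S) (\<Phi> X Y T)) < e"
proof (intro exI conjI ballI impI)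
  define C where "C = op_norm X (TE (TF X)) (unit X)"
  have C: "0 \<le> C" unfolding C_def by (rule \<Phi>_map.C_nonneg)
  show "0 < e / (C + 1)" using e C by simp
  fix S assume S: "S \<in> compacts (TF X) Y" and less: "op_norm (TF X) Y (op_sub (TF X) Y S T) < e / (C + 1)"
  note a = left.compacts_adjointable[OF S] left.compacts_adjointable[OF T]
  have "op_norm X (TE Y) (op_sub X (TE Y) (\<Phi> X Y S) (\<Phi> X Y T)) \<le> C * op_norm (TF X) Y (op_sub (TF X) Y S T)"
    using \<Phi>_map.h_bound[OF left.op_sub_adjointable[OF a]] by (simp add: \<Phi>_map.h_sub a C_def)
  also have "\<dots> \<le> C * (e / (C + 1))" using less C by (intro mult_left_mono) auto
  also have "\<dots> < e" using e C by (simp add: divide_less_eq algebra_simps)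
  finally show "op_norm X (TE Y) (op_sub X (TE Y) (\<Phi> X Y S) (\<Phi> X Y T)) < e" .
qed

end

theorem corollary3p9:
  fixes F :: "('b::cstar_algebra, 'f) hmod" and lF :: "'a::cstar_algebra \<Rightarrow> 'f \<Rightarrow> 'f"
    and E :: "('a, 'e) hmod" and lE :: "'b \<Rightarrow> 'e \<Rightarrow> 'e"
    and TF :: "('a, 'x) hmod \<Rightarrow> ('b, 'y) hmod" and tF :: "('a, 'x) hmod \<Rightarrow> 'x \<Rightarrow> 'f \<Rightarrow> 'y"
    and TE :: "('b, 'y) hmod \<Rightarrow> ('a, 'x) hmod" and tE :: "('b, 'y) hmod \<Rightarrow> 'y \<Rightarrow> 'e \<Rightarrow> 'x"
    and \<Phi> :: "('a, 'x) hmod \<Rightarrow> ('b, 'y) hmod \<Rightarrow> ('y \<Rightarrow> 'y) \<Rightarrow> ('x \<Rightarrow> 'x)"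
  assumes "correspondence F lF"
    and "correspondence E lE"
    and "tensor_functor F lF TF tF"
    and "tensor_functor E lE TE tE"
    and "adjunction F TF tF E TE tE \<Phi>"
  shows "local_adjunction F TF tF E TE tE \<Phi>"
proof -
  interpret tensor_adjunction F lF E lE TF tF TE tE \<Phi> using assms by (rule tensor_adjunction.intro)
  have at: "tensor_adjunction_at F lF E lE TF tF TE tE \<Phi> X Y" if "hilbert_module X" "hilbert_module Y" for X Y
    using that by (intro tensor_adjunction_at.intro tensor_adjunction_axioms tensor_adjunction_at_axioms.intro)
  \<comment> \<open>Compact operators are adjointable, so naturality, linearity and continuity are
    inherited from \<open>\<Phi>\<close> on all adjointable operators. Only the bijectivity between
    compact operators rests on the rank one computations.\<close>
  have compact: "T \<in> adjointables (TF X) Y" if "T \<in> compacts (TF X) Y" for T X Y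
    using that by (simp add: compacts_def)
  show ?thesis
    unfolding local_adjunction_def natural_isomorphism_def
  proof (intro conjI allI impI ballI; (elim conjE)?)
    fix X :: "('a, 'x) hmod" and Y :: "('b, 'y) hmod"
    assume XY: "hilbert_module X" "hilbert_module Y"
    interpret tensor_adjunction_at F lF E lE TF tF TE tE \<Phi> X Y by (rule at[OF XY])
    show "bij_betw (\<Phi> X Y) (compacts (TF X) Y) (compacts X (TE Y))" by (rule bij_compacts)
    fix T assume T: "T \<in> compacts (TF X) Y"
    show "\<Phi> X Y (op_scl (TF X) Y c T) = op_scl X (TE Y) c (\<Phi> X Y T)" for c
      by (rule \<Phi>_map.h_scl[OF compact[OF T]])
    show "\<Phi> X Y (op_add (TF X) Y T S) = op_add X (TE Y) (\<Phi> X Y T) (\<Phi> X Y S)" if "S \<in> compacts (TF X) Y" for S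
      by (rule \<Phi>_map.h_add[OF compact[OF T] compact[OF that]])
    show "\<exists>d>0. \<forall>S\<in>compacts (TF X) Y. op_norm (TF X) Y (op_sub (TF X) Y S T) < d \<longrightarrow>
        op_norm X (TE Y) (op_sub X (TE Y) (\<Phi> X Y S) (\<Phi> X Y T)) < e" if "0 < e" for e
      by (rule \<Phi>_continuous[OF T that])
  qed (intro natural compact; assumption)
qed

end
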